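(* Let $d\in\{2,3\}$, let $\Omega\subset\mathbb{R}^d$ be a bounded domain, let $\nu>0$ be a constant, and let $\mathbf{b}\in L^\infty(\Omega;\mathbb{R}^d)$ be weakly divergence-free, $\operatorname{div}\mathbf{b}=0$. Define $\mathcal{A}_{11}:H^1_0(\Omega;\mathbb{R}^d)\to H^{-1}(\Omega;\mathbb{R}^d)$ by $$\langle\mathcal{A}_{11}v,w\rangle=\langle\nu(\nabla v+\nabla v^\top),\nabla w\rangle_{L^2(\Omega;\mathbb{R}^{d\times d})}+\langle\mathbf{b}^\top\nabla v,w\rangle_{L^2(\Omega;\mathbb{R}^d)},\qquad v,w\in H^1_0(\Omega;\mathbb{R}^d),$$ define $\mathcal{A}_{12}:L^2(\Omega)\to H^{-1}(\Omega;\mathbb{R}^d)$ by $$\langle\mathcal{A}_{12}P,w\rangle=-\langle P,\operatorname{div}w\rangle_{L^2(\Omega)},\qquad P\in L^2(\Omega),\ w\in H^1_0(\Omega;\mathbb{R}^d),$$ and let $\mathcal{A}_{21}=\operatorname{div}:H^1_0(\Omega;\mathbb{R}^d)\to L^2(\Omega)$. Then the Schur complement $$\mathcal{W}=-\mathcal{A}_{21}\mathcal{A}_{11}^{-1}\mathcal{A}_{12}$$ is bounded, that is, $\mathcal{W}\in L(L^2(\Omega),L^2(\Omega))$, and accretive.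
   Context: All function spaces are real. $H^1_0(\Omega;\mathbb{R}^d)$ denotes vector fields in $H^1(\Omega;\mathbb{R}^d)$ with zero trace; $H^{-1}(\Omega;\mathbb{R}^d)$ is its dual and $\langle\cdot,\cdot\rangle$ without subscript is the duality pairing. For a vector field $v$, $\nabla v$ is its Jacobian, $\nabla v^\top$ the transpose of the Jacobian, and $\mathbf{b}^\top\nabla v$ denotes the vector field with components $\mathbf{b}^\top\nabla v_i$, $i=1,\dots,d$. $\mathcal{A}_{11}^{-1}$ denotes the inverse of $\mathcal{A}_{11}:H^1_0(\Omega;\mathbb{R}^d)\to H^{-1}(\Omega;\mathbb{R}^d)$, which is an isomorphism under the stated assumptions, so $\mathcal{W}$ is well-defined on $L^2(\Omega)$. $L(X,Y)$ is the space of bounded linear operators from $X$ to $Y$. An operator $\mathcal{T}$ on a Hilbert space is accretive if $\langle\mathcal{T}x,x\rangle\ge0$ for all $x$ in its domain. *)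

theory Defs
  imports "HOL-Analysis.Analysis"
begin

definition square_integrable :: "('a::euclidean_space \<Rightarrow> 'b::euclidean_space) \<Rightarrow> bool" where
  "square_integrable f \<longleftrightarrow>
     f \<in> borel_measurable lebesgue \<and> integrable lebesgue (\<lambda>x. (norm (f x))\<^sup>2)"

definition l2_rel :: "('a::euclidean_space \<Rightarrow> 'b::euclidean_space) \<Rightarrow> ('a \<Rightarrow> 'b) \<Rightarrow> bool" where
  "l2_rel f g \<longleftrightarrow>
     square_integrable f \<and> square_integrable g \<and> (AE x in lebesgue. f x = g x)"

lemma square_integrable_zero: "square_integrable (\<lambda>x. 0)"
  by (simp add: square_integrable_def)

lemma square_integrable_scaleR:
  "square_integrable f \<Longrightarrow> square_integrable (\<lambda>x. c *\<^sub>R f x)"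
  by (auto simp: square_integrable_def power_mult_distrib)

lemma integrable_bound_real:
  fixes u :: "'a::euclidean_space \<Rightarrow> real"
  assumes u: "integrable lebesgue u" and h: "h \<in> borel_measurable lebesgue"
    and le: "\<And>x. \<bar>h x\<bar> \<le> u x"
  shows "integrable lebesgue h"
proof (rule Bochner_Integration.integrable_bound[OF u h])
  have "norm (h x) \<le> norm (u x)" for x
    using le[of x] by simp
  then show "AE x in lebesgue. norm (h x) \<le> norm (u x)"
    by simp
qed

lemma square_integrable_add:
  assumes f: "square_integrable f" and g: "square_integrable g"
  shows "square_integrable (\<lambda>x. f x + g x)"
proof -
  have "(norm (a + b))\<^sup>2 \<le> 2 * (norm a)\<^sup>2 + 2 * (norm b)\<^sup>2" for a b :: 'b
  proof -
    have "(norm (a + b))\<^sup>2 \<le> (norm a + norm b)\<^sup>2"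
      by (intro power_mono norm_triangle_ineq) auto
    also have "\<dots> \<le> 2 * (norm a)\<^sup>2 + 2 * (norm b)\<^sup>2"
      using sum_squares_bound[of "norm a" "norm b"] by (simp add: power2_sum)
    finally show ?thesis .
  qed
  note bound = this
  have meas: "(\<lambda>x. f x + g x) \<in> borel_measurable lebesgue"
    using f g unfolding square_integrable_def by (blast intro: borel_measurable_add)
  have "integrable lebesgue (\<lambda>x. (norm (f x + g x))\<^sup>2)"
  proof (rule integrable_bound_real)
    show "integrable lebesgue (\<lambda>x. 2 * (norm (f x))\<^sup>2 + 2 * (norm (g x))\<^sup>2)"
      using f g by (simp add: square_integrable_def)
    show "(\<lambda>x. (norm (f x + g x))\<^sup>2) \<in> borel_measurable lebesgue"
      using meas by measurable
    show "\<bar>(norm (f x + g x))\<^sup>2\<bar> \<le> 2 * (norm (f x))\<^sup>2 + 2 * (norm (g x))\<^sup>2" for x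
      using bound[of "f x" "g x"] by simp
  qed
  with meas show ?thesis
    by (simp add: square_integrable_def)
qed

lemma square_integrable_uminus:
  "square_integrable f \<Longrightarrow> square_integrable (\<lambda>x. - f x)"
  using square_integrable_scaleR[of f "-1"] by simp

lemma square_integrable_diff:
  "square_integrable f \<Longrightarrow> square_integrable g \<Longrightarrow> square_integrable (\<lambda>x. f x - g x)"
  using square_integrable_add[of f "\<lambda>x. (-1) *\<^sub>R g x"] square_integrable_scaleR[of g "-1"] by simp

lemma integrable_inner_square_integrable:
  assumes f: "square_integrable f" and g: "square_integrable g"
  shows "integrable lebesgue (\<lambda>x. inner (f x) (g x))"
proof -
  have "\<bar>inner a b\<bar> \<le> (norm a)\<^sup>2 + (norm b)\<^sup>2" for a b :: 'b
    using Cauchy_Schwarz_ineq2[of a b] sum_squares_bound[of "norm a" "norm b"]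
      mult_nonneg_nonneg[OF norm_ge_zero[of a] norm_ge_zero[of b]]
    by linarith
  note bound = this
  have fg: "f \<in> borel_measurable lebesgue" "g \<in> borel_measurable lebesgue"
    using f g by (simp_all add: square_integrable_def)
  show ?thesis
  proof (rule integrable_bound_real)
    show "integrable lebesgue (\<lambda>x. (norm (f x))\<^sup>2 + (norm (g x))\<^sup>2)"
      using f g by (simp add: square_integrable_def)
    show "(\<lambda>x. inner (f x) (g x)) \<in> borel_measurable lebesgue"
      using fg by measurable
    show "\<bar>inner (f x) (g x)\<bar> \<le> (norm (f x))\<^sup>2 + (norm (g x))\<^sup>2" for x
      by (rule bound)
  qed
qed

lemma l2_rel_zero: "l2_rel (\<lambda>x. 0) (\<lambda>x. 0)"
  by (simp add: l2_rel_def square_integrable_zero)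

lemma l2_rel_add:
  assumes "l2_rel f f'" and "l2_rel g g'"
  shows "l2_rel (\<lambda>x. f x + g x) (\<lambda>x. f' x + g' x)"
proof -
  have "AE x in lebesgue. f x = f' x" and "AE x in lebesgue. g x = g' x"
    using assms by (simp_all add: l2_rel_def)
  then have "AE x in lebesgue. f x + g x = f' x + g' x"
    by (rule eventually_elim2) simp
  then show ?thesis
    using assms by (simp add: l2_rel_def square_integrable_add)
qed

lemma l2_rel_scaleR:
  assumes "l2_rel f f'"
  shows "l2_rel (\<lambda>x. c *\<^sub>R f x) (\<lambda>x. c *\<^sub>R f' x)"
proof -
  have "AE x in lebesgue. f x = f' x"
    using assms by (simp add: l2_rel_def)
  then have "AE x in lebesgue. c *\<^sub>R f x = c *\<^sub>R f' x"
    by (rule eventually_mono) simp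
  then show ?thesis
    using assms by (simp add: l2_rel_def square_integrable_scaleR)
qed

lemma l2_rel_uminus: "l2_rel f f' \<Longrightarrow> l2_rel (\<lambda>x. - f x) (\<lambda>x. - f' x)"
  using l2_rel_scaleR[of f f' "-1"] by simp

lemma l2_rel_diff:
  "l2_rel f f' \<Longrightarrow> l2_rel g g' \<Longrightarrow> l2_rel (\<lambda>x. f x - g x) (\<lambda>x. f' x - g' x)"
  using l2_rel_add[of f f' "\<lambda>x. - g x" "\<lambda>x. - g' x"] l2_rel_uminus[of g g'] by simp

lemma l2_rel_integral_inner:
  assumes "l2_rel f f'" and "l2_rel g g'"
  shows "integral\<^sup>L lebesgue (\<lambda>x. inner (f x) (g x)) = integral\<^sup>L lebesgue (\<lambda>x. inner (f' x) (g' x))"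
proof (rule integral_cong_AE)
  have "AE x in lebesgue. f x = f' x" and "AE x in lebesgue. g x = g' x"
    using assms by (simp_all add: l2_rel_def)
  then show "AE x in lebesgue. inner (f x) (g x) = inner (f' x) (g' x)"
    by (rule eventually_elim2) simp
  have "f \<in> borel_measurable lebesgue" "g \<in> borel_measurable lebesgue"
    and "f' \<in> borel_measurable lebesgue" "g' \<in> borel_measurable lebesgue"
    using assms by (simp_all add: l2_rel_def square_integrable_def)
  then show "(\<lambda>x. inner (f x) (g x)) \<in> borel_measurable lebesgue"
    and "(\<lambda>x. inner (f' x) (g' x)) \<in> borel_measurable lebesgue"
    by measurable
qed

quotient_type (overloaded) ('a, 'b) l2 =
  "'a::euclidean_space \<Rightarrow> 'b::euclidean_space" / partial: l2_rel
proof (rule part_equivpI)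
  show "\<exists>f::'a \<Rightarrow> 'b. l2_rel f f"
    using square_integrable_zero by (auto simp: l2_rel_def)
  show "symp (l2_rel :: ('a \<Rightarrow> 'b) \<Rightarrow> _)"
    by (auto simp: symp_def l2_rel_def)
  show "transp (l2_rel :: ('a \<Rightarrow> 'b) \<Rightarrow> _)"
    by (auto simp: transp_def l2_rel_def)
qed

instantiation l2 :: (euclidean_space, euclidean_space) real_vector
begin

lift_definition zero_l2 :: "('a, 'b) l2" is "\<lambda>x. 0"
  by (rule l2_rel_zero)

lift_definition plus_l2 :: "('a, 'b) l2 \<Rightarrow> ('a, 'b) l2 \<Rightarrow> ('a, 'b) l2" is "\<lambda>f g x. f x + g x"
  by (rule l2_rel_add)

lift_definition scaleR_l2 :: "real \<Rightarrow> ('a, 'b) l2 \<Rightarrow> ('a, 'b) l2" is "\<lambda>c f x. c *\<^sub>R f x"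
  by (rule l2_rel_scaleR)

lift_definition uminus_l2 :: "('a, 'b) l2 \<Rightarrow> ('a, 'b) l2" is "\<lambda>f x. - f x"
  by (rule l2_rel_uminus)

lift_definition minus_l2 :: "('a, 'b) l2 \<Rightarrow> ('a, 'b) l2 \<Rightarrow> ('a, 'b) l2" is "\<lambda>f g x. f x - g x"
  by (rule l2_rel_diff)

instance
proof
  fix f g h :: "('a, 'b) l2" and c d :: real
  show "f + g + h = f + (g + h)"
    by transfer (auto simp: l2_rel_def add.assoc intro!: square_integrable_add)
  show "f + g = g + f"
    by transfer (auto simp: l2_rel_def add.commute intro!: square_integrable_add)
  show "0 + f = f"
    by transfer (auto simp: l2_rel_def)
  show "c *\<^sub>R (f + g) = c *\<^sub>R f + c *\<^sub>R g"
    by transfer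
      (auto simp: l2_rel_def scaleR_right_distrib
            intro!: square_integrable_add square_integrable_scaleR)
  show "(c + d) *\<^sub>R f = c *\<^sub>R f + d *\<^sub>R f"
    by transfer
      (auto simp: l2_rel_def scaleR_left_distrib
            intro!: square_integrable_add square_integrable_scaleR)
  show "c *\<^sub>R d *\<^sub>R f = (c * d) *\<^sub>R f"
    by transfer (auto simp: l2_rel_def intro!: square_integrable_scaleR)
  show "1 *\<^sub>R f = f"
    by transfer (auto simp: l2_rel_def)
  show "- f + f = 0"
    by transfer (auto simp: l2_rel_def square_integrable_zero)
  show "f - g = f + - g"
    by transfer (auto simp: l2_rel_def square_integrable_diff)
qed

end

instantiation l2 :: (euclidean_space, euclidean_space) real_inner
begin

lift_definition inner_l2 :: "('a, 'b) l2 \<Rightarrow> ('a, 'b) l2 \<Rightarrow> real"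
  is "\<lambda>f g. integral\<^sup>L lebesgue (\<lambda>x. inner (f x) (g x))"
  by (rule l2_rel_integral_inner)

definition norm_l2 :: "('a, 'b) l2 \<Rightarrow> real" where
  "norm_l2 f = sqrt (inner f f)"

definition dist_l2 :: "('a, 'b) l2 \<Rightarrow> ('a, 'b) l2 \<Rightarrow> real" where
  "dist_l2 f g = norm (f - g)"

definition sgn_l2 :: "('a, 'b) l2 \<Rightarrow> ('a, 'b) l2" where
  "sgn_l2 f = f /\<^sub>R norm f"

definition uniformity_l2 :: "(('a, 'b) l2 \<times> ('a, 'b) l2) filter" where
  "uniformity_l2 = (INF e\<in>{0<..}. principal {(f, g). dist f g < e})"

definition open_l2 :: "('a, 'b) l2 set \<Rightarrow> bool" where
  "open_l2 U \<longleftrightarrow> (\<forall>f\<in>U. \<forall>\<^sub>F (f', g) in uniformity. f' = f \<longrightarrow> g \<in> U)"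

instance
proof
  fix f g h :: "('a, 'b) l2" and c :: real
  show "inner f g = inner g f"
    by transfer (simp add: inner_commute)
  show "inner (f + g) h = inner f h + inner g h"
    by transfer
      (auto simp: l2_rel_def inner_add_left integrable_inner_square_integrable
            intro!: Bochner_Integration.integral_add)
  show "inner (c *\<^sub>R f) g = c * inner f g"
    by transfer simp
  show "0 \<le> inner f f"
    by transfer simp
  show "inner f f = 0 \<longleftrightarrow> f = 0"
    by transfer
      (auto simp: l2_rel_def integral_nonneg_eq_0_iff_AE integrable_inner_square_integrable
            square_integrable_zero)
qed (simp_all add: norm_l2_def dist_l2_def sgn_l2_def uniformity_l2_def open_l2_def)

end

text \<open>
  \<open>L\<^sup>2(\<Omega>)\<close> is identified, isometrically, with the classes of functions on the whole space that
  vanish almost everywhere outside \<open>\<Omega>\<close>; \<open>L2_of \<Omega> f\<close> is the class of \<open>f\<close> restricted to \<open>\<Omega>\<close> (only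
  meaningful if \<open>f\<close> is square integrable on \<open>\<Omega>\<close>).
\<close>

definition L2 :: "'a set \<Rightarrow> ('a::euclidean_space, 'b::euclidean_space) l2 set" where
  "L2 \<Omega> = {f. AE x in lebesgue. x \<notin> \<Omega> \<longrightarrow> rep_l2 f x = 0}"

definition L2_of :: "'a set \<Rightarrow> ('a::euclidean_space \<Rightarrow> 'b::euclidean_space) \<Rightarrow> ('a, 'b) l2" where
  "L2_of \<Omega> f = abs_l2 (\<lambda>x. indicator \<Omega> x *\<^sub>R f x)"

definition Linfty :: "'a set \<Rightarrow> ('a::euclidean_space \<Rightarrow> 'b::euclidean_space) set" where
  "Linfty \<Omega> = {f. f \<in> borel_measurable (lebesgue_on \<Omega>) \<and>
                  (\<exists>C. AE x in lebesgue_on \<Omega>. norm (f x) \<le> C)}"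

definition partial_deriv :: "'n \<Rightarrow> (real^'n \<Rightarrow> 'b::real_normed_vector) \<Rightarrow> real^'n \<Rightarrow> 'b" where
  "partial_deriv j f x = frechet_derivative f (at x) (axis j 1)"

primrec Ck :: "nat \<Rightarrow> (real^'n \<Rightarrow> 'b::real_normed_vector) \<Rightarrow> bool" where
  "Ck 0 f \<longleftrightarrow> continuous_on UNIV f"
| "Ck (Suc k) f \<longleftrightarrow> (\<forall>x. f differentiable (at x)) \<and> (\<forall>j. Ck k (partial_deriv j f))"

definition test_functions :: "(real^'n) set \<Rightarrow> (real^'n \<Rightarrow> 'b::real_normed_vector) set" where
  "test_functions \<Omega> =
     {\<phi>. (\<forall>k. Ck k \<phi>) \<and> compact (closure {x. \<phi> x \<noteq> 0}) \<and> closure {x. \<phi> x \<noteq> 0} \<subseteq> \<Omega>}"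

definition weakly_divergence_free :: "(real^'n) set \<Rightarrow> (real^'n \<Rightarrow> real^'n) \<Rightarrow> bool" where
  "weakly_divergence_free \<Omega> b \<longleftrightarrow>
     (\<forall>\<phi>\<in>test_functions \<Omega>. (LINT x:\<Omega>|lebesgue. (\<Sum>j\<in>UNIV. b x $ j * partial_deriv j \<phi> x)) = 0)"

text \<open>Row \<open>i\<close>, column \<open>j\<close> of the Jacobian is \<open>\<partial>\<^sub>j v\<^sub>i\<close>.\<close>

definition is_weak_jacobian ::
    "(real^'n) set \<Rightarrow> (real^'n, real^'n) l2 \<Rightarrow> (real^'n, real^'n^'n) l2 \<Rightarrow> bool" where
  "is_weak_jacobian \<Omega> v G \<longleftrightarrow> G \<in> L2 \<Omega> \<and>
     (\<forall>\<phi>\<in>test_functions \<Omega>. \<forall>i j.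
        (LINT x:\<Omega>|lebesgue. rep_l2 v x $ i * partial_deriv j \<phi> x)
          = - (LINT x:\<Omega>|lebesgue. rep_l2 G x $ i $ j * \<phi> x))"

definition jacobian ::
    "(real^'n) set \<Rightarrow> (real^'n, real^'n) l2 \<Rightarrow> (real^'n, real^'n^'n) l2" where
  "jacobian \<Omega> v = (THE G. is_weak_jacobian \<Omega> v G)"

definition H1 :: "(real^'n) set \<Rightarrow> (real^'n, real^'n) l2 set" where
  "H1 \<Omega> = {v \<in> L2 \<Omega>. \<exists>G. is_weak_jacobian \<Omega> v G}"

definition H1_norm :: "(real^'n) set \<Rightarrow> (real^'n, real^'n) l2 \<Rightarrow> real" where
  "H1_norm \<Omega> v = sqrt ((norm v)\<^sup>2 + (norm (jacobian \<Omega> v))\<^sup>2)"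

text \<open>
  As the boundary of \<open>\<Omega>\<close> is arbitrary, vanishing trace means belonging to the \<open>H\<^sup>1\<close>-closure of the
  test functions.
\<close>

definition H10 :: "(real^'n) set \<Rightarrow> (real^'n, real^'n) l2 set" where
  "H10 \<Omega> = {v \<in> H1 \<Omega>. \<forall>e>0. \<exists>\<phi>\<in>test_functions \<Omega>. H1_norm \<Omega> (v - L2_of \<Omega> \<phi>) < e}"

text \<open>
  \<open>bounded_ops X p Y q\<close> is the space of bounded linear operators from the normed space \<open>(X, p)\<close> to
  the normed space \<open>(Y, q)\<close>. Operators are extensional functions, so that two of them are equal
  iff they agree on \<open>X\<close>.
\<close>

definition bounded_ops ::
    "'a::real_vector set \<Rightarrow> ('a \<Rightarrow> real) \<Rightarrow> 'b::real_vector set \<Rightarrow> ('b \<Rightarrow> real) \<Rightarrow> ('a \<Rightarrow> 'b) set" where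
  "bounded_ops X p Y q =
     {T \<in> X \<rightarrow>\<^sub>E Y. (\<forall>x\<in>X. \<forall>y\<in>X. T (x + y) = T x + T y) \<and>
                   (\<forall>c. \<forall>x\<in>X. T (c *\<^sub>R x) = c *\<^sub>R T x) \<and>
                   (\<exists>C. \<forall>x\<in>X. q (T x) \<le> C * p x)}"

definition accretive_on :: "'a::real_inner set \<Rightarrow> ('a \<Rightarrow> 'a) \<Rightarrow> bool" where
  "accretive_on X T \<longleftrightarrow> (\<forall>x\<in>X. inner (T x) x \<ge> 0)"

definition Hm1 :: "(real^'n) set \<Rightarrow> ((real^'n, real^'n) l2 \<Rightarrow> real) set" where
  "Hm1 \<Omega> = bounded_ops (H10 \<Omega>) (H1_norm \<Omega>) UNIV norm"

definition A11 ::
    "(real^'n) set \<Rightarrow> real \<Rightarrow> (real^'n \<Rightarrow> real^'n) \<Rightarrow>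
     (real^'n, real^'n) l2 \<Rightarrow> (real^'n, real^'n) l2 \<Rightarrow> real" where
  "A11 \<Omega> \<nu> b = (\<lambda>v\<in>H10 \<Omega>. \<lambda>w\<in>H10 \<Omega>.
     inner (L2_of \<Omega> (\<lambda>x. \<nu> *\<^sub>R (rep_l2 (jacobian \<Omega> v) x + transpose (rep_l2 (jacobian \<Omega> v) x))))
           (jacobian \<Omega> w)
     + inner (L2_of \<Omega> (\<lambda>x. rep_l2 (jacobian \<Omega> v) x *v b x)) w)"

definition A11_inv ::
    "(real^'n) set \<Rightarrow> real \<Rightarrow> (real^'n \<Rightarrow> real^'n) \<Rightarrow>
     ((real^'n, real^'n) l2 \<Rightarrow> real) \<Rightarrow> (real^'n, real^'n) l2" where
  "A11_inv \<Omega> \<nu> b = (\<lambda>F\<in>Hm1 \<Omega>. the_inv_into (H10 \<Omega>) (A11 \<Omega> \<nu> b) F)"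

definition A21 :: "(real^'n) set \<Rightarrow> (real^'n, real^'n) l2 \<Rightarrow> (real^'n, real) l2" where
  "A21 \<Omega> = (\<lambda>v\<in>H10 \<Omega>. L2_of \<Omega> (\<lambda>x. trace (rep_l2 (jacobian \<Omega> v) x)))"

definition A12 :: "(real^'n) set \<Rightarrow> (real^'n, real) l2 \<Rightarrow> (real^'n, real^'n) l2 \<Rightarrow> real" where
  "A12 \<Omega> = (\<lambda>P\<in>L2 \<Omega>. \<lambda>w\<in>H10 \<Omega>. - inner P (A21 \<Omega> w))"

definition schur_complement ::
    "(real^'n) set \<Rightarrow> real \<Rightarrow> (real^'n \<Rightarrow> real^'n) \<Rightarrow> (real^'n, real) l2 \<Rightarrow> (real^'n, real) l2" where
  "schur_complement \<Omega> \<nu> b = (\<lambda>P\<in>L2 \<Omega>. - A21 \<Omega> (A11_inv \<Omega> \<nu> b (A12 \<Omega> P)))"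

end

theory Submission
  imports Defs
begin

text \<open>
  Lax-Milgram gives the velocity \<open>v = \<A>\<^sub>1\<^sub>1\<^sup>-\<^sup>1 \<A>\<^sub>1\<^sub>2 P\<close> with \<open>\<parallel>v\<parallel> \<le> C \<parallel>P\<parallel>\<close>, and testing the equation with
  \<open>v\<close> itself gives \<open>\<langle>\<W>P, P\<rangle> = \<langle>\<A>\<^sub>1\<^sub>2 P, v\<rangle> = \<langle>\<A>\<^sub>1\<^sub>1 v, v\<rangle> \<ge> 0\<close>. Coercivity is a closed condition, so it
  is enough to have it for test functions. There the advection term vanishes, as it is the integral
  of \<open>b \<bullet> \<nabla>\<bar>v\<bar>\<^sup>2 / 2\<close>; the viscous term equals
  \<open>\<nu> (\<parallel>\<nabla>v\<parallel>\<^sup>2 + \<parallel>div v\<parallel>\<^sup>2)\<close> after two integrations by parts; and \<open>\<parallel>\<nabla>v\<parallel>\<close> bounds the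
  \<open>H\<^sup>1\<close> norm by Poincare's inequality.
\<close>

subsection \<open>The Lax-Milgram theorem\<close>

text \<open>In the definitions \<open>jacobian\<close> is a description and \<open>H10\<close> a
  bare set, so neither comes with a Hilbert space structure. The argument therefore lives in the
  product of two \<open>l2\<close> types, on the closed subspace \<open>H10_graph\<close> of pairs
  (v, grad v). There the product norm is \<open>H1_norm\<close>, and the bilinear form and the
  functional \<open>A12 \<Omega> P\<close> are inner products with values of the bounded linear maps
  \<open>form\<close> and \<open>load\<close>. This rests on completeness of \<open>l2\<close> and
  on uniqueness of the weak Jacobian; the latter is why the fundamental lemma and explicit bump
  functions appear. Test functions are forced on the coercivity estimate by \<open>b\<close>: its
  divergence condition speaks of smooth compactly supported functions only, and |v|^2 is known to be
  one when v is. The inverse of \<open>A11\<close> is evaluated only at functionals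
  \<open>A12 \<Omega> P\<close>. There \<open>the_inv_into\<close> describes the v in
  \<open>H10\<close> with \<open>A11 v = A12 P\<close>, so unique solvability of this equation pins
  it down.\<close>

lemma subspace_closure:
  fixes S :: "'a::real_normed_vector set"
  assumes "subspace S"
  shows "subspace (closure S)"
proof (rule subspaceI)
  show "0 \<in> closure S"
    using subspace_0[OF assms] closure_subset by blast
next
  fix x y assume "x \<in> closure S" "y \<in> closure S"
  then obtain f g where f: "\<And>n. f n \<in> S" "f \<longlonglongrightarrow> x" and g: "\<And>n. g n \<in> S" "g \<longlonglongrightarrow> y"
    by (auto simp: closure_sequential)
  have "(\<lambda>n. f n + g n) \<longlonglongrightarrow> x + y"
    by (intro tendsto_add f g)
  then show "x + y \<in> closure S"
    using f(1) g(1) subspace_add[OF assms]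
    unfolding closure_sequential by (intro exI[of _ "\<lambda>n. f n + g n"]) auto
next
  fix c :: real and x assume "x \<in> closure S"
  then obtain f where f: "\<And>n. f n \<in> S" "f \<longlonglongrightarrow> x"
    by (auto simp: closure_sequential)
  have "(\<lambda>n. c *\<^sub>R f n) \<longlonglongrightarrow> c *\<^sub>R x"
    by (intro tendsto_intros f)
  then show "c *\<^sub>R x \<in> closure S"
    using f(1) subspace_scale[OF assms]
    unfolding closure_sequential by (intro exI[of _ "\<lambda>n. c *\<^sub>R f n"]) auto
qed

text \<open>The nearest point of \<open>S\<close> works: a minimizing sequence is Cauchy by the
  parallelogram law, and minimality along each line \<open>p + t s\<close> gives orthogonality.
  Completeness is asked of \<open>S\<close> alone, not of the ambient space.\<close>

lemma orthogonal_projection_exists: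
  fixes S :: "'a::real_inner set"
  assumes S: "subspace S" and "complete S"
  shows "\<exists>p\<in>S. \<forall>s\<in>S. inner (x - p) s = 0"
proof -
  define d where "d = (INF s\<in>S. (norm (x - s))\<^sup>2)"
  have bdd: "bdd_below ((\<lambda>s. (norm (x - s))\<^sup>2) ` S)"
    by (rule bdd_belowI[of _ 0]) auto
  have ne: "S \<noteq> {}"
    using subspace_0[OF S] by auto
  have d_le: "d \<le> (norm (x - s))\<^sup>2" if "s \<in> S" for s
    unfolding d_def by (rule cINF_lower[OF bdd that])
  have "\<exists>s\<in>S. (norm (x - s))\<^sup>2 < d + 1 / real (Suc n)" for n
    using cINF_less_iff[OF ne bdd, of "d + 1 / real (Suc n)"] unfolding d_def by auto
  then obtain y where yS: "\<And>n. y n \<in> S" and y: "\<And>n. (norm (x - y n))\<^sup>2 < d + 1 / real (Suc n)"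
    by metis
  \<comment> \<open>Parallelogram law for \<open>x - y m\<close> and \<open>x - y n\<close>. The
    midpoint of \<open>y m\<close> and \<open>y n\<close> lies in \<open>S\<close>, so its squared
    distance to \<open>x\<close> is at least \<open>d\<close>; the terms \<open>4 * d\<close> cancel
    and only the two errors remain.\<close>
  have close: "(norm (y m - y n))\<^sup>2 \<le> 4 / real (Suc N)" if "m \<ge> N" "n \<ge> N" for m n N
  proof -
    have "d \<le> (norm (x - (1/2) *\<^sub>R (y m + y n)))\<^sup>2"
      by (intro d_le subspace_scale subspace_add S yS)
    moreover have "(norm (y m - y n))\<^sup>2 =
        2 * (norm (x - y m))\<^sup>2 + 2 * (norm (x - y n))\<^sup>2 - 4 * (norm (x - (1/2) *\<^sub>R (y m + y n)))\<^sup>2"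
      by (simp add: power2_norm_eq_inner inner_simps inner_commute algebra_simps)
    moreover have "1 / real (Suc m) \<le> 1 / real (Suc N)" "1 / real (Suc n) \<le> 1 / real (Suc N)"
      using that by (auto intro!: divide_left_mono)
    ultimately show ?thesis
      using y[of m] y[of n] by argo
  qed
  have "Cauchy y"
  proof (rule metric_CauchyI)
    fix e :: real assume "e > 0"
    then obtain N where N: "inverse (real (Suc N)) < e\<^sup>2 / 4"
      using reals_Archimedean[of "e\<^sup>2 / 4"] by auto
    have "dist (y m) (y n) < e" if "m \<ge> N" "n \<ge> N" for m n
    proof -
      have "(norm (y m - y n))\<^sup>2 < e\<^sup>2"
        using le_less_trans[OF close[OF that], of "e\<^sup>2"] N by (simp add: field_simps)
      then show ?thesis
        using \<open>e > 0\<close> by (simp add: dist_norm power2_less_imp_less)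
    qed
    then show "\<exists>N. \<forall>m\<ge>N. \<forall>n\<ge>N. dist (y m) (y n) < e"
      by blast
  qed
  then obtain p where p: "p \<in> S" "y \<longlonglongrightarrow> p"
    using \<open>complete S\<close> yS unfolding complete_def by blast
  have "(norm (x - p))\<^sup>2 \<le> d + 0"
  proof (rule LIMSEQ_le)
    show "(\<lambda>n. (norm (x - y n))\<^sup>2) \<longlonglongrightarrow> (norm (x - p))\<^sup>2"
      by (intro tendsto_intros p)
    show "(\<lambda>n. d + 1 / real (Suc n)) \<longlonglongrightarrow> d + 0"
      by (intro tendsto_add tendsto_const LIMSEQ_Suc[OF lim_1_over_n])
    show "\<exists>N. \<forall>n\<ge>N. (norm (x - y n))\<^sup>2 \<le> d + 1 / real (Suc n)"
      using y less_imp_le by blast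
  qed
  then have min: "(norm (x - p))\<^sup>2 \<le> (norm (x - s))\<^sup>2" if "s \<in> S" for s
    using d_le[OF that] by linarith
  have "inner (x - p) s = 0" if s: "s \<in> S" for s
  proof (cases "s = 0")
    case False
    \<comment> \<open>The minimizer of the quadratic \<open>t \<mapsto> norm (x - p - t s)\<close>
      squared; inserting it lowers the value by the square of \<open>inner (x - p) s\<close> over
      \<open>inner s s\<close>, which minimality of \<open>p\<close> forces to be 0.\<close>
    define t where "t = inner (x - p) s / inner s s"
    have "(norm (x - p))\<^sup>2 \<le> (norm (x - (p + t *\<^sub>R s)))\<^sup>2"
      by (intro min subspace_add subspace_scale S p s)
    also have "x - (p + t *\<^sub>R s) = (x - p) - t *\<^sub>R s"
      by simp
    also have "(norm \<dots>)\<^sup>2 = (norm (x - p))\<^sup>2 - 2 * t * inner (x - p) s + t\<^sup>2 * inner s s"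
      unfolding power2_norm_eq_inner by (simp add: inner_simps inner_commute power2_eq_square algebra_simps)
    also have "\<dots> = (norm (x - p))\<^sup>2 - (inner (x - p) s)\<^sup>2 / inner s s"
      using False by (simp add: t_def power2_eq_square)
    finally have "(inner (x - p) s)\<^sup>2 / inner s s \<le> 0"
      by simp
    moreover have "inner s s > 0"
      using False by simp
    ultimately show ?thesis
      by (simp add: divide_le_0_iff)
  qed simp
  with p(1) show ?thesis
    by blast
qed

text \<open>The solution is the fixed point of the contraction \<open>u \<mapsto> P (u - \<rho> (A u - f))\<close> for small
  \<open>\<rho>\<close>, where \<open>P\<close> is the orthogonal projection onto \<open>S\<close>.\<close>

lemma lax_milgram:
  fixes S :: "'a::real_inner set" and A :: "'a \<Rightarrow> 'a"
  assumes S: "subspace S" and "complete S" and A: "bounded_linear A"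
    and "c > 0" and coercive: "\<And>u. u \<in> S \<Longrightarrow> c * (norm u)\<^sup>2 \<le> inner (A u) u"
  shows "\<exists>!u. u \<in> S \<and> (\<forall>s\<in>S. inner (A u) s = inner f s)"
proof (rule ex_ex1I)
  fix u w
  assume u: "u \<in> S \<and> (\<forall>s\<in>S. inner (A u) s = inner f s)"
    and w: "w \<in> S \<and> (\<forall>s\<in>S. inner (A w) s = inner f s)"
  then have uw: "u - w \<in> S"
    using subspace_diff[OF S] by blast
  have "inner (A (u - w)) (u - w) = 0"
    using u w uw by (simp add: linear_diff[OF bounded_linear.linear[OF A]] inner_diff_left)
  with coercive[OF uw] \<open>c > 0\<close> show "u = w"
    by (simp add: mult_le_0_iff)
next
  obtain P where P: "\<And>x. P x \<in> S" "\<And>x s. s \<in> S \<Longrightarrow> inner (x - P x) s = 0"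
    using orthogonal_projection_exists[OF S \<open>complete S\<close>] by metis
  obtain K where K: "K > 0" "\<And>x. norm (A x) \<le> norm x * K"
    using bounded_linear.pos_bounded[OF A] by blast
  \<comment> \<open>The maximum guarantees \<open>c \<le> M\<close>, hence \<open>0 \<le> q\<close>.
    Coercivity yields \<open>c \<le> K\<close> only if \<open>S\<close> has a nonzero
    element.\<close>
  define M where "M = max K c"
  have M: "M > 0" "c \<le> M" "norm (A x) \<le> M * norm x" for x
    using K(2)[of x] K(1) mult_right_mono[of K M "norm x"] by (auto simp: M_def mult.commute)
  \<comment> \<open>This value minimizes the contraction factor
    \<open>1 - 2 \<rho> c + (\<rho> M)^2\<close>; the minimum is \<open>q\<close>.\<close>
  define \<rho> where "\<rho> = c / M\<^sup>2"
  define q where "q = 1 - (c / M)\<^sup>2"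
  define g where "g u = P (u - \<rho> *\<^sub>R (A u - f))" for u
  have "0 \<le> q" "q < 1"
    using \<open>c > 0\<close> M(1,2) by (auto simp: q_def power_le_one)
  have contr: "dist (g u) (g w) \<le> sqrt q * dist u w" if "u \<in> S" "w \<in> S" for u w
  proof -
    let ?z = "u - w"
    let ?y = "?z - \<rho> *\<^sub>R A ?z"
    have z: "?z \<in> S" and gS: "g u - g w \<in> S"
      using that P(1) subspace_diff[OF S] by (auto simp: g_def)
    \<comment> \<open>\<open>P\<close> is merely a choice of orthogonal projections, with no
      linearity established. That it is nonexpansive follows from the orthogonality relations at the
      two points, tested with \<open>g u - g w\<close>.\<close>
    have "inner (?y - (g u - g w)) (g u - g w) = 0"
    proof -
      have "?y = (u - \<rho> *\<^sub>R (A u - f)) - (w - \<rho> *\<^sub>R (A w - f))"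
        by (simp add: linear_diff[OF bounded_linear.linear[OF A]] algebra_simps)
      then have eq: "?y - (g u - g w) =
          (u - \<rho> *\<^sub>R (A u - f) - g u) - (w - \<rho> *\<^sub>R (A w - f) - g w)"
        by simp
      have "inner (u - \<rho> *\<^sub>R (A u - f) - g u) (g u - g w) = 0"
        "inner (w - \<rho> *\<^sub>R (A w - f) - g w) (g u - g w) = 0"
        using P(2)[OF gS] unfolding g_def by blast+
      then show ?thesis
        by (subst eq, subst inner_diff_left) simp
    qed
    then have "(norm (g u - g w))\<^sup>2 = inner ?y (g u - g w)"
      by (simp add: power2_norm_eq_inner inner_diff_left)
    also have "\<dots> \<le> norm ?y * norm (g u - g w)"
      by (rule norm_cauchy_schwarz)
    finally have "norm (g u - g w) \<le> norm ?y"
      by (cases "g u - g w = 0") (auto simp: power2_eq_square)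
    moreover have "(norm ?y)\<^sup>2 \<le> q * (norm ?z)\<^sup>2"
    proof -
      have "(norm ?y)\<^sup>2 = (norm ?z)\<^sup>2 - 2 * \<rho> * inner (A ?z) ?z + \<rho>\<^sup>2 * (norm (A ?z))\<^sup>2"
        unfolding power2_norm_eq_inner
        by (simp add: inner_diff_left inner_diff_right inner_commute power2_eq_square algebra_simps)
      also have "\<dots> \<le> (norm ?z)\<^sup>2 - 2 * \<rho> * (c * (norm ?z)\<^sup>2) + \<rho>\<^sup>2 * (M * norm ?z)\<^sup>2"
        using coercive[OF z] M(3)[of ?z] \<open>c > 0\<close> M(1)
        by (intro add_mono diff_mono mult_left_mono power_mono) (auto simp: \<rho>_def)
      also have "\<dots> = (1 - 2 * \<rho> * c + \<rho>\<^sup>2 * M\<^sup>2) * (norm ?z)\<^sup>2"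
        by (simp add: algebra_simps power2_eq_square)
      also have "1 - 2 * \<rho> * c + \<rho>\<^sup>2 * M\<^sup>2 = q"
        using M(1) by (simp add: q_def \<rho>_def power2_eq_square field_simps)
      finally show ?thesis .
    qed
    then have "norm ?y \<le> sqrt q * norm ?z"
      using real_le_rsqrt[of "norm ?y" "q * (norm ?z)\<^sup>2"] by (simp add: real_sqrt_mult)
    ultimately show ?thesis
      by (simp add: dist_norm)
  qed
  have "\<exists>!u. u \<in> S \<and> g u = u"
    using \<open>0 \<le> q\<close> \<open>q < 1\<close> contr subspace_0[OF S] P(1)
    by (intro Banach_fix[OF \<open>complete S\<close>, of "sqrt q"]) (auto simp: g_def)
  then obtain u where u: "u \<in> S" "g u = u"
    by blast
  have "inner (A u) s = inner f s" if "s \<in> S" for s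
  proof -
    have "inner (- \<rho> *\<^sub>R (A u - f)) s = 0"
      using P(2)[OF that, of "u - \<rho> *\<^sub>R (A u - f)"] u(2) by (simp add: g_def)
    moreover have "\<rho> \<noteq> 0"
      using \<open>c > 0\<close> M(1) by (simp add: \<rho>_def)
    ultimately show ?thesis
      by (simp add: inner_diff_left)
  qed
  with u(1) show "\<exists>u. u \<in> S \<and> (\<forall>s\<in>S. inner (A u) s = inner f s)"
    by blast
qed

subsection \<open>Completeness of \<open>L\<^sup>2\<close>\<close>

lemma square_integrable_rep_l2: "square_integrable (rep_l2 f)"
proof -
  have "l2_rel (rep_l2 f) (rep_l2 f)"
    by (rule Quotient3_rep_reflp[OF Quotient3_l2])
  then show ?thesis
    by (simp add: l2_rel_def)
qed

lemma borel_measurable_rep_l2 [measurable]: "rep_l2 f \<in> borel_measurable lebesgue"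
  using square_integrable_rep_l2 by (auto simp: square_integrable_def)

lemma integrable_norm_rep_l2: "integrable lebesgue (\<lambda>x. (norm (rep_l2 f x))\<^sup>2)"
  using square_integrable_rep_l2 by (simp add: square_integrable_def)

lemma rep_abs_l2:
  assumes "square_integrable f"
  shows "AE x in lebesgue. rep_l2 (abs_l2 f) x = f x"
proof -
  have "l2_rel f f"
    using assms by (simp add: l2_rel_def)
  then have "l2_rel (rep_l2 (abs_l2 f)) f"
    by (metis Quotient3_l2 Quotient3_rep_abs)
  then show ?thesis
    by (simp add: l2_rel_def)
qed

lemma abs_l2_cong:
  assumes "square_integrable f" "square_integrable g" "AE x in lebesgue. f x = g x"
  shows "abs_l2 f = abs_l2 g"
  by (rule Quotient3_rel_abs[OF Quotient3_l2]) (simp add: l2_rel_def assms)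

lemma abs_rep_l2: "abs_l2 (rep_l2 f) = f"
  by (rule Quotient3_abs_rep[OF Quotient3_l2])

lemma l2_eqI: "AE x in lebesgue. rep_l2 f x = rep_l2 g x \<Longrightarrow> f = g"
  using abs_l2_cong[OF square_integrable_rep_l2 square_integrable_rep_l2, of f g]
  by (simp add: abs_rep_l2)

lemma rep_l2_plus: "AE x in lebesgue. rep_l2 (f + g) x = rep_l2 f x + rep_l2 g x"
proof -
  have "f + g = abs_l2 (\<lambda>x. rep_l2 f x + rep_l2 g x)"
    by (simp add: plus_l2_def map_fun_def)
  then show ?thesis
    by (simp add: rep_abs_l2 square_integrable_add square_integrable_rep_l2)
qed

lemma rep_l2_diff: "AE x in lebesgue. rep_l2 (f - g) x = rep_l2 f x - rep_l2 g x"
proof -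
  have "f - g = abs_l2 (\<lambda>x. rep_l2 f x - rep_l2 g x)"
    by (simp add: minus_l2_def map_fun_def)
  then show ?thesis
    by (simp add: rep_abs_l2 square_integrable_diff square_integrable_rep_l2)
qed

lemma rep_l2_scaleR: "AE x in lebesgue. rep_l2 (c *\<^sub>R f) x = c *\<^sub>R rep_l2 f x"
proof -
  have "c *\<^sub>R f = abs_l2 (\<lambda>x. c *\<^sub>R rep_l2 f x)"
    by (simp add: scaleR_l2_def map_fun_def)
  then show ?thesis
    by (simp add: rep_abs_l2 square_integrable_scaleR square_integrable_rep_l2)
qed

lemma rep_l2_zero: "AE x in lebesgue. rep_l2 0 x = 0"
  by (simp add: zero_l2_def rep_abs_l2 square_integrable_zero)

lemma inner_l2_eq: "inner f g = integral\<^sup>L lebesgue (\<lambda>x. inner (rep_l2 f x) (rep_l2 g x))"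
  by (simp add: inner_l2_def map_fun_def)

lemma norm_l2_eq: "(norm f)\<^sup>2 = integral\<^sup>L lebesgue (\<lambda>x. (norm (rep_l2 f x))\<^sup>2)"
  for f :: "('a::euclidean_space, 'b::euclidean_space) l2"
  unfolding power2_norm_eq_inner by (rule inner_l2_eq)

lemma inner_l2_AE:
  assumes "AE x in lebesgue. rep_l2 f x = u x" "AE x in lebesgue. rep_l2 g x = w x"
    and "u \<in> borel_measurable lebesgue" "w \<in> borel_measurable lebesgue"
  shows "inner f g = integral\<^sup>L lebesgue (\<lambda>x. inner (u x) (w x))"
  unfolding inner_l2_eq
proof (rule integral_cong_AE)
  show "AE x in lebesgue. inner (rep_l2 f x) (rep_l2 g x) = inner (u x) (w x)"
    using assms(1,2) by eventually_elim simp
qed (use assms(3,4) in measurable)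

lemma square_integrable_dominated:
  fixes f :: "'a::euclidean_space \<Rightarrow> 'b::euclidean_space" and g :: "'a \<Rightarrow> 'c::euclidean_space"
  assumes g: "square_integrable g" and f: "f \<in> borel_measurable lebesgue"
    and le: "AE x in lebesgue. norm (f x) \<le> C * norm (g x)"
  shows "square_integrable f"
  unfolding square_integrable_def
proof
  show "integrable lebesgue (\<lambda>x. (norm (f x))\<^sup>2)"
  proof (rule Bochner_Integration.integrable_bound)
    show "integrable lebesgue (\<lambda>x. C\<^sup>2 * (norm (g x))\<^sup>2)"
      using g by (simp add: square_integrable_def)
    show "(\<lambda>x. (norm (f x))\<^sup>2) \<in> borel_measurable lebesgue"
      using f by measurable
    show "AE x in lebesgue. norm ((norm (f x))\<^sup>2) \<le> norm (C\<^sup>2 * (norm (g x))\<^sup>2)"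
      using le
    proof eventually_elim
      case (elim x)
      from power_mono[OF elim norm_ge_zero, of 2] show ?case
        by (simp add: power_mult_distrib)
    qed
  qed
qed (rule f)

lemma norm_l2_le:
  fixes f :: "('a::euclidean_space, 'b::euclidean_space) l2" and g :: "('a, 'c::euclidean_space) l2"
  assumes "C \<ge> 0" and le: "AE x in lebesgue. norm (rep_l2 f x) \<le> C * norm (rep_l2 g x)"
  shows "norm f \<le> C * norm g"
proof -
  have "(norm f)\<^sup>2 \<le> integral\<^sup>L lebesgue (\<lambda>x. C\<^sup>2 * (norm (rep_l2 g x))\<^sup>2)"
    unfolding norm_l2_eq
  proof (rule integral_mono_AE)
    show "AE x in lebesgue. (norm (rep_l2 f x))\<^sup>2 \<le> C\<^sup>2 * (norm (rep_l2 g x))\<^sup>2"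
      using le
    proof eventually_elim
      case (elim x)
      from power_mono[OF elim norm_ge_zero, of 2] show ?case
        by (simp add: power_mult_distrib)
    qed
    show "integrable lebesgue (\<lambda>x. (norm (rep_l2 f x))\<^sup>2)"
      "integrable lebesgue (\<lambda>x. C\<^sup>2 * (norm (rep_l2 g x))\<^sup>2)"
      by (simp_all add: integrable_norm_rep_l2)
  qed
  also have "\<dots> = (C * norm g)\<^sup>2"
    by (simp add: norm_l2_eq power_mult_distrib)
  finally show ?thesis
    by (rule power2_le_imp_le) (simp add: \<open>C \<ge> 0\<close>)
qed

text \<open>Fatou's lemma along the pointwise limit. The limit is a plain function not yet known to
  be square integrable, hence the nonnegative integral on the left.\<close>

lemma fatou_square_norm:
  fixes g :: "'a::euclidean_space \<Rightarrow> 'b::euclidean_space"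
  assumes g: "g \<in> borel_measurable lebesgue"
    and lim: "AE x in lebesgue. (\<lambda>n. rep_l2 (h n) x) \<longlonglongrightarrow> g x"
    and bound: "eventually (\<lambda>n. norm (h n) \<le> e) sequentially"
  shows "(\<integral>\<^sup>+x. ennreal ((norm (g x))\<^sup>2) \<partial>lebesgue) \<le> ennreal (e\<^sup>2)"
proof -
  have "(\<integral>\<^sup>+x. ennreal ((norm (g x))\<^sup>2) \<partial>lebesgue)
      = (\<integral>\<^sup>+x. liminf (\<lambda>n. ennreal ((norm (rep_l2 (h n) x))\<^sup>2)) \<partial>lebesgue)"
  proof (rule nn_integral_cong_AE)
    show "AE x in lebesgue. ennreal ((norm (g x))\<^sup>2)
        = liminf (\<lambda>n. ennreal ((norm (rep_l2 (h n) x))\<^sup>2))"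
      using lim
    proof eventually_elim
      case (elim x)
      have "(\<lambda>n. ennreal ((norm (rep_l2 (h n) x))\<^sup>2)) \<longlonglongrightarrow> ennreal ((norm (g x))\<^sup>2)"
        by (intro tendsto_intros elim tendsto_ennrealI)
      then show ?case
        by (intro lim_imp_Liminf[symmetric]) auto
    qed
  qed
  also have "\<dots> \<le> liminf (\<lambda>n. \<integral>\<^sup>+x. ennreal ((norm (rep_l2 (h n) x))\<^sup>2) \<partial>lebesgue)"
    by (rule nn_integral_liminf) measurable
  also have "\<dots> = liminf (\<lambda>n. ennreal ((norm (h n))\<^sup>2))"
    unfolding norm_l2_eq
    by (subst nn_integral_eq_integral) (auto simp: integrable_norm_rep_l2)
  also have "\<dots> \<le> liminf (\<lambda>n::nat. ennreal (e\<^sup>2))"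
    by (rule Liminf_mono, rule eventually_mono[OF bound])
      (auto intro!: ennreal_leI power_mono)
  also have "\<dots> = ennreal (e\<^sup>2)"
    by (rule lim_imp_Liminf) auto
  finally show ?thesis .
qed

text \<open>The Riesz-Fischer argument. With the weights \<open>4 ^ n\<close>, the sum of the
  squared increments still has a finite integral, because the squared norms decay like
  \<open>16 ^ -n\<close>. So at almost every point the increments are bounded by a multiple of
  \<open>(1/2) ^ n\<close>, and the representatives converge. Fatou's lemma then turns the pointwise
  limit into a limit in norm.\<close>

lemma l2_limit_from_fast_Cauchy:
  fixes f :: "nat \<Rightarrow> ('a::euclidean_space, 'b::euclidean_space) l2"
  assumes "Cauchy f" and fast: "\<And>n. norm (f (Suc n) - f n) \<le> (1/4) ^ n"
  shows "convergent f"
proof -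
  let ?d = "\<lambda>n x. rep_l2 (f (Suc n) - f n) x"
  have d_int: "(\<integral>\<^sup>+x. ennreal ((norm (?d n x))\<^sup>2) \<partial>lebesgue) = ennreal ((norm (f (Suc n) - f n))\<^sup>2)" for n
    unfolding norm_l2_eq
    by (subst nn_integral_eq_integral) (auto simp: integrable_norm_rep_l2)
  have "(\<integral>\<^sup>+x. (\<Sum>n. ennreal (4 ^ n * (norm (?d n x))\<^sup>2)) \<partial>lebesgue)
      = (\<Sum>n. \<integral>\<^sup>+x. ennreal (4 ^ n * (norm (?d n x))\<^sup>2) \<partial>lebesgue)"
    by (rule nn_integral_suminf) measurable
  also have "\<dots> = (\<Sum>n. ennreal (4 ^ n * (norm (f (Suc n) - f n))\<^sup>2))"
    by (simp add: ennreal_mult nn_integral_cmult d_int)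
  also have "\<dots> \<le> (\<Sum>n. ennreal ((1/4) ^ n))"
  proof (intro suminf_le ennreal_leI)
    show "4 ^ n * (norm (f (Suc n) - f n))\<^sup>2 \<le> (1/4) ^ n" for n
    proof -
      have "4 ^ n * (norm (f (Suc n) - f n))\<^sup>2 \<le> 4 ^ n * ((1/4) ^ n)\<^sup>2"
        by (intro mult_left_mono power_mono fast) auto
      also have "\<dots> = (1/4) ^ n"
        by (simp add: power2_eq_square power_mult_distrib[symmetric] flip: mult.assoc)
      finally show ?thesis .
    qed
  qed auto
  also have "\<dots> = ennreal (\<Sum>n. (1/4) ^ n)"
    by (rule suminf_ennreal2) (auto intro: summable_geometric)
  also have "\<dots> < \<infinity>"
    by simp
  finally have "AE x in lebesgue. (\<Sum>n. ennreal (4 ^ n * (norm (?d n x))\<^sup>2)) \<noteq> \<infinity>"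
    by (intro nn_integral_noteq_infinite) auto
  moreover have "AE x in lebesgue. \<forall>n. ?d n x = rep_l2 (f (Suc n)) x - rep_l2 (f n) x"
    by (simp add: AE_all_countable rep_l2_diff)
  ultimately have conv: "AE x in lebesgue. convergent (\<lambda>n. rep_l2 (f n) x)"
  proof eventually_elim
    case (elim x)
    then obtain K where K: "(\<Sum>n. ennreal (4 ^ n * (norm (?d n x))\<^sup>2)) = ennreal K" "K \<ge> 0"
      by (cases "\<Sum>n. ennreal (4 ^ n * (norm (?d n x))\<^sup>2)" rule: ennreal_cases) auto
    have d_le: "norm (?d n x) \<le> sqrt K * (1/2) ^ n" for n
    proof -
      have "ennreal (4 ^ n * (norm (?d n x))\<^sup>2) \<le> (\<Sum>n. ennreal (4 ^ n * (norm (?d n x))\<^sup>2))"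
        (is "?F n \<le> _")
      proof -
        have "sum ?F {n} \<le> suminf ?F"
          by (rule sum_le_suminf) (auto intro: summableI)
        then show ?thesis
          by (simp only: sum.insert[OF finite.emptyI] sum.empty empty_iff not_False_eq_True add_0_right)
      qed
      then have "4 ^ n * (norm (?d n x))\<^sup>2 \<le> K"
        unfolding K(1) by (simp only: ennreal_le_iff[OF K(2)])
      moreover have four: "(2 ^ n)\<^sup>2 = (4::real) ^ n"
        by (simp add: power2_eq_square flip: power_mult_distrib)
      ultimately have "(2 ^ n * norm (?d n x))\<^sup>2 \<le> K"
        by (simp add: power_mult_distrib[of _ _ 2] four)
      then have "2 ^ n * norm (?d n x) \<le> sqrt K"
        by (rule real_le_rsqrt)
      then show ?thesis
        by (simp add: field_simps power_one_over)
    qed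
    have "summable (\<lambda>n. ?d n x)"
      by (rule summable_comparison_test'[where g = "\<lambda>n. sqrt K * (1/2) ^ n" and N = 0])
        (auto intro!: summable_mult summable_geometric d_le)
    then have "convergent (\<lambda>n. \<Sum>k<n. rep_l2 (f (Suc k)) x - rep_l2 (f k) x)"
      using elim(2) by (simp add: summable_iff_convergent)
    then have "convergent (\<lambda>n. rep_l2 (f n) x - rep_l2 (f 0) x)"
      unfolding sum_lessThan_telescope[of "\<lambda>n. rep_l2 (f n) x"] .
    from convergent_add[OF this convergent_const[of "rep_l2 (f 0) x"]] show ?case
      by simp
  qed
  \<comment> \<open>\<open>lim\<close> has an unspecified value where the sequence diverges; this is
    a null set, and \<open>g\<close> is measurable all the same.\<close>
  define g where "g x = lim (\<lambda>n. rep_l2 (f n) x)" for x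
  have g_meas [measurable]: "g \<in> borel_measurable lebesgue"
    unfolding g_def by (rule borel_measurable_lim_metric) measurable
  have lim: "AE x in lebesgue. (\<lambda>n. rep_l2 (f n) x) \<longlonglongrightarrow> g x"
    using conv by eventually_elim (simp add: g_def convergent_LIMSEQ_iff)
  have diff: "(\<integral>\<^sup>+x. ennreal ((norm (g x - rep_l2 (f n) x))\<^sup>2) \<partial>lebesgue) \<le> ennreal (e\<^sup>2)"
    if "\<And>m. m \<ge> N \<Longrightarrow> norm (f m - f n) \<le> e" for n N e
  proof (rule fatou_square_norm)
    show "AE x in lebesgue. (\<lambda>m. rep_l2 (f m - f n) x) \<longlonglongrightarrow> g x - rep_l2 (f n) x"
    proof -
      have "AE x in lebesgue. \<forall>m. rep_l2 (f m - f n) x = rep_l2 (f m) x - rep_l2 (f n) x"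
        by (simp add: AE_all_countable rep_l2_diff)
      with lim show ?thesis
        by eventually_elim (auto intro: tendsto_diff)
    qed
    show "\<forall>\<^sub>F m in sequentially. norm (f m - f n) \<le> e"
      using that eventually_sequentially by blast
  qed measurable
  have si: "square_integrable (\<lambda>x. g x - rep_l2 (f n) x)"
    if "\<And>m. m \<ge> N \<Longrightarrow> norm (f m - f n) \<le> e" for n N e
    unfolding square_integrable_def
  proof
    show "integrable lebesgue (\<lambda>x. (norm (g x - rep_l2 (f n) x))\<^sup>2)"
      using le_less_trans[OF diff[of N n e, OF that], of \<infinity>]
      by (intro integrableI_nonneg) auto
  qed measurable
  have Cauchy: "\<exists>N. \<forall>m\<ge>N. \<forall>n\<ge>N. norm (f m - f n) \<le> e" if "e > 0" for e
    using metric_CauchyD[OF \<open>Cauchy f\<close> that] by (auto simp: dist_norm intro: less_imp_le)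
  obtain N1 where "\<And>m n. m \<ge> N1 \<Longrightarrow> n \<ge> N1 \<Longrightarrow> norm (f m - f n) \<le> 1"
    using Cauchy[of 1] by auto
  then have "square_integrable (\<lambda>x. g x - rep_l2 (f N1) x)"
    by (intro si[of N1 N1 1]) auto
  from square_integrable_add[OF this square_integrable_rep_l2[of "f N1"]]
  have g: "square_integrable g"
    by simp
  have "f \<longlonglongrightarrow> abs_l2 g"
    unfolding LIMSEQ_def
  proof (intro allI impI)
    fix e :: real assume "e > 0"
    then obtain N where N: "\<And>m n. m \<ge> N \<Longrightarrow> n \<ge> N \<Longrightarrow> norm (f m - f n) \<le> e / 2"
      using Cauchy[of "e / 2"] by auto
    have "dist (f n) (abs_l2 g) < e" if "n \<ge> N" for n
    proof -
      have "AE x in lebesgue. rep_l2 (abs_l2 g - f n) x = g x - rep_l2 (f n) x"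
        using rep_abs_l2[OF g] rep_l2_diff[of "abs_l2 g" "f n"] by eventually_elim simp
      then have "(\<integral>\<^sup>+x. ennreal ((norm (g x - rep_l2 (f n) x))\<^sup>2) \<partial>lebesgue)
          = (\<integral>\<^sup>+x. ennreal ((norm (rep_l2 (abs_l2 g - f n) x))\<^sup>2) \<partial>lebesgue)"
        by (intro nn_integral_cong_AE) (auto elim: eventually_mono)
      also have "\<dots> = ennreal ((norm (abs_l2 g - f n))\<^sup>2)"
        unfolding norm_l2_eq
        by (subst nn_integral_eq_integral) (auto simp: integrable_norm_rep_l2)
      finally have "(norm (abs_l2 g - f n))\<^sup>2 \<le> (e / 2)\<^sup>2"
        using diff[of N n "e / 2"] N that by (simp add: ennreal_le_iff)
      then have "norm (abs_l2 g - f n) \<le> e / 2"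
        by (rule power2_le_imp_le) (use \<open>e > 0\<close> in simp)
      then show ?thesis
        using \<open>e > 0\<close> by (simp add: dist_norm norm_minus_commute)
    qed
    then show "\<exists>N. \<forall>n\<ge>N. dist (f n) (abs_l2 g) < e"
      by blast
  qed
  then show ?thesis
    by (auto simp: convergent_def)
qed

instance l2 :: (euclidean_space, euclidean_space) complete_space
proof
  fix f :: "nat \<Rightarrow> ('a, 'b) l2"
  assume f: "Cauchy f"
  have "\<exists>N. \<forall>m\<ge>N. \<forall>n\<ge>N. dist (f m) (f n) < (1/4) ^ k" for k
    by (rule metric_CauchyD[OF f]) simp
  then obtain N where N: "\<And>k m n. m \<ge> N k \<Longrightarrow> n \<ge> N k \<Longrightarrow> dist (f m) (f n) < (1/4) ^ k"
    by metis
  \<comment> \<open>The sum dominates every \<open>N i\<close> with \<open>i \<le> k\<close>; the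
    summand \<open>k\<close> makes \<open>r\<close> strictly increasing even where \<open>N\<close>
    vanishes.\<close>
  define r where "r k = (\<Sum>i\<le>k. N i) + k" for k
  have r: "strict_mono r"
    by (rule strict_monoI_Suc) (simp add: r_def)
  have rN: "N k \<le> r k" for k
    using member_le_sum[of k "{..k}" N] by (simp add: r_def trans_le_add1)
  have "Cauchy (f \<circ> r)"
    by (rule Cauchy_subseq_Cauchy[OF f r])
  moreover have "norm ((f \<circ> r) (Suc k) - (f \<circ> r) k) \<le> (1/4) ^ k" for k
  proof -
    have "N k \<le> r (Suc k)"
      using rN[of k] strict_monoD[OF r, of k "Suc k"] by simp
    then show ?thesis
      using N[OF _ rN[of k], of "r (Suc k)"] by (simp add: dist_norm)
  qed
  ultimately have "convergent (f \<circ> r)"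
    by (rule l2_limit_from_fast_Cauchy)
  then obtain l where "(f \<circ> r) \<longlonglongrightarrow> l"
    by (auto simp: convergent_def)
  from Cauchy_converges_subseq[OF f r this] show "convergent f"
    by (auto simp: convergent_def)
qed

subsection \<open>Pointwise operators on \<open>L\<^sup>2\<close>\<close>

lemma square_integrable_restrict:
  assumes "square_integrable f" "\<Omega> \<in> sets lebesgue"
  shows "square_integrable (\<lambda>x. indicator \<Omega> x *\<^sub>R f x)"
proof (rule square_integrable_dominated[OF assms(1)])
  have "f \<in> borel_measurable lebesgue"
    using assms(1) by (simp add: square_integrable_def)
  then show "(\<lambda>x. indicator \<Omega> x *\<^sub>R f x) \<in> borel_measurable lebesgue"
    using assms(2) by measurable
  show "AE x in lebesgue. norm (indicator \<Omega> x *\<^sub>R f x) \<le> 1 * norm (f x)"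
    by (auto simp: indicator_def)
qed

lemma rep_L2_of:
  assumes "square_integrable (\<lambda>x. indicator \<Omega> x *\<^sub>R f x)"
  shows "AE x in lebesgue. rep_l2 (L2_of \<Omega> f) x = indicator \<Omega> x *\<^sub>R f x"
  unfolding L2_of_def by (rule rep_abs_l2[OF assms])

lemma L2_of_in_L2:
  assumes "square_integrable (\<lambda>x. indicator \<Omega> x *\<^sub>R f x)"
  shows "L2_of \<Omega> f \<in> L2 \<Omega>"
  unfolding L2_def using rep_L2_of[OF assms] by (auto elim: eventually_mono)

text \<open>Common pattern of restriction to \<Omega>, viscous stress, advection, divergence and
  pressure: a linear map applied to the values of a class, cut off outside \<Omega>. The bound and
  the measurability are asked on \<Omega> only, since the coefficient \<open>b\<close> is controlled
  only there. \<open>C\<close> carries no sign, hence the absolute values below.\<close>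

locale pointwise_operator =
  fixes \<Omega> :: "'a::euclidean_space set" and h :: "'a \<Rightarrow> 'b::euclidean_space \<Rightarrow> 'c::euclidean_space"
    and C :: real
  assumes linear: "\<And>x. linear (h x)"
    and bound: "AE x in lebesgue. x \<in> \<Omega> \<longrightarrow> (\<forall>y. norm (h x y) \<le> C * norm y)"
    and measurable: "\<And>f. f \<in> borel_measurable lebesgue \<Longrightarrow>
          (\<lambda>x. indicator \<Omega> x *\<^sub>R h x (f x)) \<in> borel_measurable lebesgue"
begin

definition lifted :: "('a, 'b) l2 \<Rightarrow> ('a, 'c) l2" where
  "lifted G = L2_of \<Omega> (\<lambda>x. h x (rep_l2 G x))"

lemma norm_le: "AE x in lebesgue. norm (indicator \<Omega> x *\<^sub>R h x (rep_l2 G x)) \<le> \<bar>C\<bar> * norm (rep_l2 G x)"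
  using bound
proof eventually_elim
  case (elim x)
  have "C * norm (rep_l2 G x) \<le> \<bar>C\<bar> * norm (rep_l2 G x)"
    by (intro mult_right_mono) auto
  then show ?case
    using elim[rule_format, of "rep_l2 G x"] by (cases "x \<in> \<Omega>") auto
qed

lemma square_integrable: "square_integrable (\<lambda>x. indicator \<Omega> x *\<^sub>R h x (rep_l2 G x))"
  by (rule square_integrable_dominated[OF square_integrable_rep_l2 measurable norm_le]) measurable

lemma rep_lifted: "AE x in lebesgue. rep_l2 (lifted G) x = indicator \<Omega> x *\<^sub>R h x (rep_l2 G x)"
  unfolding lifted_def by (rule rep_L2_of[OF square_integrable])

lemma lifted_in_L2: "lifted G \<in> L2 \<Omega>"
  unfolding lifted_def by (rule L2_of_in_L2[OF square_integrable])

lemma norm_lifted_le: "norm (lifted G) \<le> \<bar>C\<bar> * norm G"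
proof (rule norm_l2_le)
  show "AE x in lebesgue. norm (rep_l2 (lifted G) x) \<le> \<bar>C\<bar> * norm (rep_l2 G x)"
    using norm_le[of G] rep_lifted[of G] by eventually_elim simp
qed simp

lemma bounded_linear_lifted: "bounded_linear lifted"
proof (rule bounded_linear_intro)
  fix F G :: "('a, 'b) l2" and c :: real
  show "lifted (F + G) = lifted F + lifted G"
  proof (rule l2_eqI)
    show "AE x in lebesgue. rep_l2 (lifted (F + G)) x = rep_l2 (lifted F + lifted G) x"
      using rep_lifted[of "F + G"] rep_lifted[of F] rep_lifted[of G] rep_l2_plus[of F G]
        rep_l2_plus[of "lifted F" "lifted G"]
      by eventually_elim (simp add: linear_add[OF linear] scaleR_add_right)
  qed
  show "lifted (c *\<^sub>R F) = c *\<^sub>R lifted F"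
  proof (rule l2_eqI)
    show "AE x in lebesgue. rep_l2 (lifted (c *\<^sub>R F)) x = rep_l2 (c *\<^sub>R lifted F) x"
      using rep_lifted[of "c *\<^sub>R F"] rep_lifted[of F] rep_l2_scaleR[of c F]
        rep_l2_scaleR[of c "lifted F"]
      by eventually_elim (simp add: linear_cmul[OF linear])
  qed
  show "norm (lifted F) \<le> norm F * \<bar>C\<bar>"
    using norm_lifted_le[of F] by (simp add: mult.commute)
qed

end

lemma pointwise_operator_const:
  fixes L :: "'b::euclidean_space \<Rightarrow> 'c::euclidean_space" and \<Omega> :: "'a::euclidean_space set"
  assumes "linear L" "\<Omega> \<in> sets lebesgue"
  shows "pointwise_operator \<Omega> (\<lambda>_. L) (onorm L)"
proof (rule pointwise_operator.intro)
  have L: "bounded_linear L"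
    using assms(1) by (simp add: linear_conv_bounded_linear)
  show "AE x in lebesgue. x \<in> \<Omega> \<longrightarrow> (\<forall>y. norm (L y) \<le> onorm L * norm y)"
    by (simp add: onorm[OF L])
  fix f :: "'a \<Rightarrow> 'b" assume "f \<in> borel_measurable lebesgue"
  then have "(\<lambda>x. L (f x)) \<in> borel_measurable lebesgue"
    by (rule borel_measurable_continuous_on[OF bounded_linear.continuous_on[OF L continuous_on_id]])
  then show "(\<lambda>x. indicator \<Omega> x *\<^sub>R L (f x)) \<in> borel_measurable lebesgue"
    using assms(2) by measurable
qed (rule assms(1))

lemma L2_iff_restrict:
  assumes "\<Omega> \<in> sets lebesgue"
  shows "f \<in> L2 \<Omega> \<longleftrightarrow> L2_of \<Omega> (rep_l2 f) = f"
proof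
  have si: "square_integrable (\<lambda>x. indicator \<Omega> x *\<^sub>R rep_l2 f x)"
    by (rule square_integrable_restrict[OF square_integrable_rep_l2 assms])
  show "L2_of \<Omega> (rep_l2 f) = f \<Longrightarrow> f \<in> L2 \<Omega>"
    using L2_of_in_L2[OF si] by simp
  assume f: "f \<in> L2 \<Omega>"
  show "L2_of \<Omega> (rep_l2 f) = f"
  proof (rule l2_eqI)
    have "AE x in lebesgue. x \<notin> \<Omega> \<longrightarrow> rep_l2 f x = 0"
      using f by (simp add: L2_def)
    with rep_L2_of[OF si] show "AE x in lebesgue. rep_l2 (L2_of \<Omega> (rep_l2 f)) x = rep_l2 f x"
      by eventually_elim (auto simp: indicator_def)
  qed
qed

text \<open>\<open>L2 \<Omega>\<close> is the kernel of the bounded linear map "restriction to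
  \<Omega> minus identity".\<close>

lemma
  fixes \<Omega> :: "'a::euclidean_space set"
  assumes "\<Omega> \<in> sets lebesgue"
  shows subspace_L2: "subspace (L2 \<Omega> :: ('a, 'b::euclidean_space) l2 set)"
    and closed_L2: "closed (L2 \<Omega> :: ('a, 'b) l2 set)"
proof -
  interpret pointwise_operator \<Omega> "\<lambda>_ y :: 'b. y" "onorm (\<lambda>y::'b. y)"
    by (rule pointwise_operator_const[OF linear_id[unfolded id_def] assms])
  have eq: "L2 \<Omega> = {f. lifted f - f = 0}"
    using L2_iff_restrict[OF assms] by (auto simp: lifted_def)
  have bl: "bounded_linear (\<lambda>f. lifted f - f)"
    by (intro bounded_linear_sub bounded_linear_lifted bounded_linear_ident)
  show "subspace (L2 \<Omega> :: ('a, 'b) l2 set)"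
    unfolding eq by (rule linear_subspace_kernel[OF bounded_linear.linear[OF bl]])
  show "closed (L2 \<Omega> :: ('a, 'b) l2 set)"
    unfolding eq by (intro closed_Collect_eq continuous_on_const bounded_linear.continuous_on[OF bl] continuous_on_id)
qed

subsection \<open>Smooth functions\<close>

lemma partial_deriv_eq:
  "(f has_derivative f') (at x) \<Longrightarrow> partial_deriv j f x = f' (axis j 1)"
  unfolding partial_deriv_def using frechet_derivative_at by metis

lemma Ck_Suc_imp_Ck: "Ck (Suc k) f \<Longrightarrow> Ck k f"
proof (induction k arbitrary: f)
  case 0
  then show ?case
    by (auto simp: differentiable_on_def intro!: differentiable_imp_continuous_on differentiable_at_withinI)
next
  case (Suc k)
  from Suc.prems[unfolded Ck.simps(2)[of "Suc k" f]] Suc.IH show ?case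
    unfolding Ck.simps(2)[of k f] by blast
qed

lemma partial_deriv_const: "partial_deriv j (\<lambda>x. c) = (\<lambda>x. 0)"
  by (rule ext, subst partial_deriv_eq[OF has_derivative_const]) simp

lemma Ck_const: "Ck k (\<lambda>x. c)"
  by (induction k arbitrary: c) (simp_all add: partial_deriv_const)

lemma Ck_add:
  assumes "Ck k f" "Ck k g"
  shows "Ck k (\<lambda>x. f x + g x)"
  using assms
proof (induction k arbitrary: f g)
  case (Suc k)
  then have d: "(f has_derivative frechet_derivative f (at x)) (at x)"
    "(g has_derivative frechet_derivative g (at x)) (at x)" for x
    by (simp_all flip: frechet_derivative_works)
  have "partial_deriv j (\<lambda>x. f x + g x) = (\<lambda>x. partial_deriv j f x + partial_deriv j g x)" for j
    by (rule ext, subst partial_deriv_eq[OF has_derivative_add[OF d]]) (simp add: partial_deriv_def)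
  with Suc show ?case
    by (auto intro: differentiable_add)
qed (auto intro: continuous_intros)

lemma Ck_mult:
  fixes f g :: "real^'n \<Rightarrow> real"
  assumes "Ck k f" "Ck k g"
  shows "Ck k (\<lambda>x. f x * g x)"
  using assms
proof (induction k arbitrary: f g)
  case (Suc k)
  then have d: "(f has_derivative frechet_derivative f (at x)) (at x)"
    "(g has_derivative frechet_derivative g (at x)) (at x)" for x
    by (simp_all flip: frechet_derivative_works)
  have "partial_deriv j (\<lambda>x. f x * g x) = (\<lambda>x. f x * partial_deriv j g x + partial_deriv j f x * g x)" for j
    by (rule ext, subst partial_deriv_eq[OF has_derivative_mult[OF d]]) (simp add: partial_deriv_def)
  moreover have "Ck k f" "Ck k g"
    using Suc.prems Ck_Suc_imp_Ck by auto
  ultimately show ?case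
    using Suc by (auto intro!: Ck_add)
qed (auto intro: continuous_intros)

lemma partial_deriv_bounded_linear:
  assumes "f differentiable (at x)" "bounded_linear L"
  shows "partial_deriv j (\<lambda>x. L (f x)) x = L (partial_deriv j f x)"
proof -
  have "(f has_derivative frechet_derivative f (at x)) (at x)"
    using assms(1) by (simp flip: frechet_derivative_works)
  from partial_deriv_eq[OF bounded_linear.has_derivative[OF assms(2) this]] show ?thesis
    by (simp add: partial_deriv_def)
qed

lemma Ck_bounded_linear:
  assumes "Ck k f" "bounded_linear L"
  shows "Ck k (\<lambda>x. L (f x))"
  using assms(1)
proof (induction k arbitrary: f)
  case 0
  then show ?case
    by (simp add: bounded_linear.continuous_on[OF assms(2)])
next
  case (Suc k)
  then have d: "f differentiable (at x)" for x
    by simp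
  have "(\<lambda>x. L (f x)) differentiable (at x)" for x
    using bounded_linear.has_derivative[OF assms(2)] d[of x] unfolding differentiable_def by blast
  moreover have "partial_deriv j (\<lambda>x. L (f x)) = (\<lambda>x. L (partial_deriv j f x))" for j
    using partial_deriv_bounded_linear[OF d assms(2)] by auto
  ultimately show ?case
    using Suc by auto
qed

lemma Ck_prod:
  fixes f :: "'i \<Rightarrow> real^'n \<Rightarrow> real"
  assumes "\<And>i. i \<in> I \<Longrightarrow> Ck k (f i)"
  shows "Ck k (\<lambda>x. \<Prod>i\<in>I. f i x)"
  using assms
  by (induction I rule: infinite_finite_induct) (auto intro: Ck_const Ck_mult)

subsection \<open>Bump functions\<close>

text \<open>The functions \<open>t \<mapsto> p(1/t) e\<^sup>-\<^sup>1\<^sup>/\<^sup>t\<close>, \<open>t > 0\<close>, extended by \<open>0\<close>; this family is closed under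
  differentiation.\<close>

definition exp_tail :: "real poly \<Rightarrow> real \<Rightarrow> real" where
  "exp_tail p t = (if t > 0 then poly p (inverse t) * exp (- inverse t) else 0)"

lemma poly_times_exp_tendsto_0: "((\<lambda>s::real. poly p s * exp (- s)) \<longlongrightarrow> 0) at_top"
proof -
  have "((\<lambda>s::real. \<Sum>i\<le>degree p. coeff p i * (s ^ i / exp s)) \<longlongrightarrow> (\<Sum>i\<le>degree p. coeff p i * 0)) at_top"
    by (intro tendsto_intros tendsto_power_div_exp_0)
  then show ?thesis
    by (simp add: poly_altdef sum_distrib_right sum_divide_distrib exp_minus field_simps)
qed

text \<open>With \<open>s = 1/t\<close> one has \<open>ds/dt = - s^2\<close>, so the derivative of
  \<open>p(s) exp(-s)\<close> is \<open>s^2 (p(s) - p'(s)) exp(-s)\<close>; the factor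
  \<open>[:0, 0, 1:]\<close> is \<open>s^2\<close>.\<close>

lemma exp_tail_has_derivative:
  "(exp_tail p has_real_derivative exp_tail ([:0, 0, 1:] * (p - pderiv p)) t) (at t)"
proof (cases t "0 :: real" rule: linorder_cases)
  case less
  have "((\<lambda>t. 0) has_real_derivative 0) (at t)"
    by simp
  then show ?thesis
    using less by (subst DERIV_cong_ev[OF refl _ refl, of _ "\<lambda>t. 0"])
      (auto simp: exp_tail_def eventually_nhds intro!: exI[of _ "{..<0}"])
next
  case greater
  have "((\<lambda>t. poly p (inverse t) * exp (- inverse t)) has_real_derivative
      exp_tail ([:0, 0, 1:] * (p - pderiv p)) t) (at t)"
    using greater
    by (auto intro!: derivative_eq_intros poly_DERIV[THEN DERIV_chain2]
        simp: exp_tail_def algebra_simps power2_eq_square)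
  then show ?thesis
    using greater by (subst DERIV_cong_ev[OF refl _ refl, of _ "\<lambda>t. poly p (inverse t) * exp (- inverse t)"])
      (auto simp: exp_tail_def eventually_nhds intro!: exI[of _ "{0<..}"])
next
  case equal
  have "((\<lambda>h. exp_tail p h / h) \<longlongrightarrow> 0) (at_left 0)"
    by (rule tendsto_eventually) (auto simp: eventually_at_filter exp_tail_def)
  moreover have "((\<lambda>h. exp_tail p h / h) \<longlongrightarrow> 0) (at_right 0)"
  proof -
    \<comment> \<open>Dividing by \<open>h\<close> multiplies the polynomial in \<open>1/h\<close>
      by its variable, and the exponential still dominates.\<close>
    have "((\<lambda>h::real. poly ([:0, 1:] * p) (inverse h) * exp (- inverse h)) \<longlongrightarrow> 0) (at_right 0)"
      by (rule filterlim_compose[OF poly_times_exp_tendsto_0 filterlim_inverse_at_top_right])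
    then show ?thesis
      by (rule Lim_transform_eventually)
        (auto simp: eventually_at_filter exp_tail_def field_simps)
  qed
  ultimately have "((\<lambda>h. exp_tail p h / h) \<longlongrightarrow> 0) (at 0)"
    by (simp add: filterlim_split_at)
  then show ?thesis
    using equal by (simp add: has_field_derivative_iff exp_tail_def)
qed

text \<open>The induction is over all \<open>p\<close>, as differentiating changes the polynomial.
  The affine argument serves both the lower and the upper face of a box.\<close>

lemma Ck_exp_tail: "Ck k (\<lambda>x::real^'n. exp_tail p (\<alpha> * (x $ j) + \<beta>))"
proof (induction k arbitrary: p)
  case 0
  have "continuous_on UNIV (exp_tail p)"
    by (intro continuous_at_imp_continuous_on ballI DERIV_isCont[OF exp_tail_has_derivative])
  then show ?case
    by (auto intro!: continuous_intros continuous_on_compose2[of UNIV "exp_tail p"])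
next
  case (Suc k)
  let ?q = "[:0, 0, 1:] * (p - pderiv p)"
  have d: "((\<lambda>x::real^'n. exp_tail p (\<alpha> * (x $ j) + \<beta>)) has_derivative
      (\<lambda>h. (\<alpha> * (h $ j)) * exp_tail ?q (\<alpha> * (x $ j) + \<beta>))) (at x)" for x
    by (rule DERIV_compose_FDERIV[OF exp_tail_has_derivative])
      (intro has_derivative_add_const bounded_linear_imp_has_derivative bounded_linear_const_mult
        bounded_linear_vec_nth)
  have "partial_deriv i (\<lambda>x::real^'n. exp_tail p (\<alpha> * (x $ j) + \<beta>)) =
      (\<lambda>x. (\<alpha> * (axis i 1 $ j)) * exp_tail ?q (\<alpha> * (x $ j) + \<beta>))" for i
    by (rule ext, subst partial_deriv_eq[OF d]) simp
  moreover have "(\<lambda>x::real^'n. exp_tail p (\<alpha> * (x $ j) + \<beta>)) differentiable (at x)" for x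
    using d by (rule differentiableI)
  ultimately show ?case
    by (auto simp only: Ck.simps intro!: Ck_mult Ck_const Suc.IH)
qed

text \<open>One factor for each face of the box. The slope \<open>Suc n\<close> sharpens the bump
  towards the indicator of the open box while its nonzero set stays equal to that box for every
  \<open>n\<close>.\<close>

definition box_bump :: "real^'n \<Rightarrow> real^'n \<Rightarrow> nat \<Rightarrow> real^'n \<Rightarrow> real" where
  "box_bump a b n x = (\<Prod>j\<in>UNIV.
     exp_tail 1 (real (Suc n) * (x $ j) + (- real (Suc n) * (a $ j))) *
     exp_tail 1 (- real (Suc n) * (x $ j) + real (Suc n) * (b $ j)))"

lemma exp_tail_1_pos_iff: "exp_tail 1 t \<noteq> 0 \<longleftrightarrow> t > 0"
  by (simp add: exp_tail_def)

lemma exp_tail_1_bounds: "0 \<le> exp_tail 1 t" "exp_tail 1 t \<le> 1"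
  by (auto simp: exp_tail_def)

lemma box_bump_nonzero_iff: "box_bump a b n x \<noteq> 0 \<longleftrightarrow> x \<in> box a b"
proof -
  have "real (Suc n) * (x $ j) + (- real (Suc n) * (a $ j)) > 0 \<longleftrightarrow> a $ j < x $ j"
    "- real (Suc n) * (x $ j) + real (Suc n) * (b $ j) > 0 \<longleftrightarrow> x $ j < b $ j" for j
    by (simp_all del: of_nat_Suc)
  then show ?thesis
    unfolding box_bump_def mem_box_cart by (auto simp: exp_tail_1_pos_iff simp del: of_nat_Suc)
qed

lemma box_bump_bounds: "0 \<le> box_bump a b n x" "box_bump a b n x \<le> 1"
  unfolding box_bump_def
  by (auto intro!: prod_nonneg prod_le_1 mult_le_one exp_tail_1_bounds mult_nonneg_nonneg)

lemma box_bump_tendsto: "(\<lambda>n. box_bump a b n x) \<longlonglongrightarrow> indicator (box a b) x"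
proof (cases "x \<in> box a b")
  case False
  then have "box_bump a b n x = 0" for n
    using box_bump_nonzero_iff by blast
  with False show ?thesis
    by simp
next
  case True
  have *: "(\<lambda>n. exp_tail 1 (real (Suc n) * s)) \<longlonglongrightarrow> 1" if "s > 0" for s
  proof -
    have "(\<lambda>n. exp (- (inverse (real (Suc n)) * inverse s))) \<longlonglongrightarrow> exp (- (0 * inverse s))"
      by (intro tendsto_intros LIMSEQ_inverse_real_of_nat)
    then show ?thesis
      using that by (simp add: exp_tail_def zero_less_mult_iff del: of_nat_Suc)
  qed
  have "(\<lambda>n. \<Prod>j\<in>UNIV. exp_tail 1 (real (Suc n) * (x $ j - a $ j)) *
      exp_tail 1 (real (Suc n) * (b $ j - x $ j))) \<longlonglongrightarrow> (\<Prod>j\<in>(UNIV::'a set). 1 * 1)"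
    using True by (intro tendsto_prod tendsto_mult *) (auto simp: mem_box_cart)
  then show ?thesis
    using True by (simp add: box_bump_def algebra_simps)
qed

lemma box_bump_test_function:
  assumes "cbox a b \<subseteq> \<Omega>"
  shows "box_bump a b n \<in> test_functions \<Omega>"
proof -
  have eq: "{x. box_bump a b n x \<noteq> 0} = box a b"
    by (auto simp: box_bump_nonzero_iff)
  have sub: "closure (box a b) \<subseteq> cbox a b"
    by (rule closure_minimal[OF box_subset_cbox closed_cbox])
  have "Ck k (box_bump a b n)" for k
    unfolding box_bump_def by (intro Ck_prod Ck_mult Ck_exp_tail)
  then show ?thesis
    using assms sub by (auto simp: test_functions_def eq compact_eq_bounded_closed bounded_closure bounded_box)
qed

subsection \<open>The fundamental lemma of the calculus of variations\<close>

text \<open>Open boxes form an intersection-stable generator of the Borel sets, so the integral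
  vanishes over every Borel set by Dynkin's argument. The premise \<open>total\<close> provides the
  step to complements.\<close>

lemma box_integral_eq_0_imp_AE_eq_0:
  fixes v :: "'a::euclidean_space \<Rightarrow> real"
  assumes v: "integrable lborel v"
    and box: "\<And>a b. (LINT x:box a b|lborel. v x) = 0" and total: "(\<integral>x. v x \<partial>lborel) = 0"
  shows "AE x in lborel. v x = 0"
proof -
  have [measurable]: "v \<in> borel_measurable borel"
    using v by simp
  have int: "integrable lborel (\<lambda>x. indicator A x *\<^sub>R v x)" if "A \<in> sets borel" for A
    using that v by (intro integrable_mult_indicator) auto
  have borel: "sets borel = sigma_sets UNIV (range (\<lambda>(a, b). box a b :: 'a set))"
    by (simp add: borel_eq_box)
  have Int_stable: "Int_stable (range (\<lambda>(a, b). box a b :: 'a set))"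
    by (auto simp: Int_stable_def box_Int_box)
  have Pow: "range (\<lambda>(a, b). box a b :: 'a set) \<subseteq> Pow UNIV"
    by simp
  have "(LINT x:A|lborel. v x) = 0" if "A \<in> sigma_sets UNIV (range (\<lambda>(a, b). box a b))" for A
    using Int_stable Pow that
  proof (induction rule: sigma_sets_induct_disjoint)
    case (basic A)
    then show ?case
      using box by auto
  next
    case empty
    show ?case
      by (simp add: set_lebesgue_integral_def)
  next
    case (compl A)
    then have A: "A \<in> sets borel"
      by (simp add: borel)
    have "(LINT x:UNIV - A|lborel. v x) = (\<integral>x. v x - indicator A x *\<^sub>R v x \<partial>lborel)"
      unfolding set_lebesgue_integral_def by (intro Bochner_Integration.integral_cong) (auto simp: indicator_def)
    also have "\<dots> = 0"
      using v int[OF A] compl.IH total by (simp add: set_lebesgue_integral_def)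
    finally show ?case .
  next
    case (union A)
    then have A: "\<And>i. A i \<in> sets borel" "(\<Union>i. A i) \<in> sets borel"
      unfolding borel by (auto intro: sigma_sets.Union)
    have "(LINT x:(\<Union>i. A i)|lborel. v x) = (\<Sum>i. LINT x:A i|lborel. v x)"
    proof (rule lebesgue_integral_countable_add)
      show "set_integrable lborel (\<Union>i. A i) v"
        using int[OF A(2)] by (simp add: set_integrable_def)
      show "A i \<inter> A j = {}" if "i \<noteq> j" for i j
        using union(1) that by (auto simp: disjoint_family_on_def)
    qed (use A in auto)
    also have "\<dots> = 0"
      using union by simp
    finally show ?case .
  qed
  then have "(LINT x:A|lborel. v x) = (LINT x:A|lborel. (\<lambda>x. 0) x)" if "A \<in> sets lborel" for A
    using that by (simp add: borel set_lebesgue_integral_def)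
  then show ?thesis
    by (intro density_unique_real v) auto
qed

lemma indicator_box_measurable:
  "(indicator (box a b) :: _ \<Rightarrow> real) \<in> borel_measurable lebesgue"
  "(indicator (cbox a b) :: _ \<Rightarrow> real) \<in> borel_measurable lebesgue"
  by (intro borel_measurable_indicator fmeasurableD lmeasurable_box lmeasurable_cbox)+

lemma square_integrable_indicator_box:
  "square_integrable (indicator (box a b) :: _ \<Rightarrow> real)"
  "square_integrable (indicator (cbox a b) :: _ \<Rightarrow> real)"
proof -
  have sq: "(norm (indicator A x :: real))\<^sup>2 = indicator A x" for A and x :: 'a
    by (simp add: indicator_def)
  show "square_integrable (indicator (box a b) :: _ \<Rightarrow> real)"
    "square_integrable (indicator (cbox a b) :: _ \<Rightarrow> real)"
    unfolding square_integrable_def sq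
    by (auto intro: indicator_box_measurable simp flip: lmeasurable_iff_integrable)
qed

text \<open>Dominated convergence along the bumps of the box. The dominating function is
  \<open>u\<close> cut off to the closed box, integrable as a product of two square integrable
  functions.\<close>

lemma fundamental_lemma_box:
  fixes u :: "real^'n \<Rightarrow> real"
  assumes u: "square_integrable u" and ab: "cbox a b \<subseteq> \<Omega>"
    and orth: "\<And>\<phi>. \<phi> \<in> test_functions \<Omega> \<Longrightarrow> (LINT x:\<Omega>|lebesgue. u x * \<phi> x) = 0"
  shows "(LINT x:box a b|lebesgue. u x) = 0"
proof -
  have um: "u \<in> borel_measurable lebesgue"
    using u by (simp add: square_integrable_def)
  from integrable_inner_square_integrable[OF square_integrable_indicator_box(2) u]
  have dom: "integrable lebesgue (\<lambda>x. \<bar>indicator (cbox a b) x * u x\<bar>)"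
    by simp
  have bump: "box_bump a b n \<in> borel_measurable lebesgue" for n
  proof -
    have "Ck 0 (box_bump a b n)"
      using box_bump_test_function[OF ab, of n] unfolding test_functions_def by blast
    then have "box_bump a b n \<in> borel_measurable borel"
      by (simp add: borel_measurable_continuous_onI)
    then show ?thesis
      by (simp add: measurable_completion)
  qed
  have "(\<lambda>n. \<integral>x. u x * box_bump a b n x \<partial>lebesgue) \<longlonglongrightarrow> (\<integral>x. indicator (box a b) x *\<^sub>R u x \<partial>lebesgue)"
  proof (rule integral_dominated_convergence[OF _ _ dom])
    have "(\<lambda>n. u x * box_bump a b n x) \<longlonglongrightarrow> indicator (box a b) x *\<^sub>R u x" for x
      using tendsto_mult[OF tendsto_const box_bump_tendsto, of "u x" a b x] by (simp add: mult.commute)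
    then show "AE x in lebesgue. (\<lambda>n. u x * box_bump a b n x) \<longlonglongrightarrow> indicator (box a b) x *\<^sub>R u x"
      by simp
    have "norm (u x * box_bump a b n x) \<le> \<bar>indicator (cbox a b) x * u x\<bar>" for n x
    proof (cases "x \<in> box a b")
      case True
      then show ?thesis
        using box_subset_cbox[of a b] box_bump_bounds[of a b n x] mult_left_le[of "box_bump a b n x" "\<bar>u x\<bar>"]
        by (auto simp: abs_mult)
    next
      case False
      then have "box_bump a b n x = 0"
        using box_bump_nonzero_iff by blast
      then show ?thesis
        by simp
    qed
    then show "AE x in lebesgue. norm (u x * box_bump a b n x) \<le> \<bar>indicator (cbox a b) x * u x\<bar>" for n
      by simp
  qed (intro borel_measurable_scaleR borel_measurable_times indicator_box_measurable um bump)+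
  moreover have "(\<integral>x. u x * box_bump a b n x \<partial>lebesgue) = 0" for n
  proof -
    have "(\<integral>x. u x * box_bump a b n x \<partial>lebesgue) = (LINT x:\<Omega>|lebesgue. u x * box_bump a b n x)"
      unfolding set_lebesgue_integral_def
    proof (rule Bochner_Integration.integral_cong[OF refl])
      fix x
      show "u x * box_bump a b n x = indicator \<Omega> x *\<^sub>R (u x * box_bump a b n x)"
        using ab box_subset_cbox[of a b] box_bump_nonzero_iff[of a b n x]
        by (cases "box_bump a b n x = 0") (auto simp: indicator_def)
    qed
    then show ?thesis
      using orth[OF box_bump_test_function[OF ab]] by simp
  qed
  ultimately show ?thesis
    by (simp add: LIMSEQ_const_iff set_lebesgue_integral_def)
qed

text \<open>It suffices to argue on closed boxes inside \<Omega>, because countably many of them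
  cover \<Omega>. On each one the statement reduces to vanishing integrals over all boxes.\<close>

lemma fundamental_lemma:
  fixes u :: "real^'n \<Rightarrow> real"
  assumes "open \<Omega>" and u: "square_integrable u"
    and orth: "\<And>\<phi>. \<phi> \<in> test_functions \<Omega> \<Longrightarrow> (LINT x:\<Omega>|lebesgue. u x * \<phi> x) = 0"
  shows "AE x in lebesgue. x \<in> \<Omega> \<longrightarrow> u x = 0"
proof -
  have um: "u \<in> borel_measurable lebesgue"
    using u by (simp add: square_integrable_def)
  \<comment> \<open>The Dynkin argument concerns Borel sets and \<open>lborel\<close>, whereas
    \<open>u\<close> is only Lebesgue measurable; a Borel representative connects the two.\<close>
  obtain g where g [measurable]: "g \<in> borel_measurable lborel" and ug: "AE x in lborel. u x = g x"
    using completion_ex_borel_measurable_real[OF um] by blast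
  have gm: "g \<in> borel_measurable lebesgue"
    using g by (simp add: measurable_completion)
  have ug': "AE x in lebesgue. u x = g x"
    using ug by (rule AE_completion)
  have local: "AE x in lebesgue. x \<in> cbox a b \<longrightarrow> u x = 0" if ab: "cbox a b \<subseteq> \<Omega>" for a b
  proof -
    \<comment> \<open>The cut-off makes the function integrable, since square integrability alone
      gives this only on bounded sets, and confines it to a region where \<open>orth\<close> gives
      information.\<close>
    let ?v = "\<lambda>x. indicator (box a b) x * g x"
    have box_g: "(LINT x:box c d|lborel. g x) = 0" if "cbox c d \<subseteq> \<Omega>" for c d
    proof -
      have "(LINT x:box c d|lborel. g x) = (LINT x:box c d|lebesgue. g x)"
        unfolding set_lebesgue_integral_def by (rule integral_completion[symmetric]) measurable
      also have "\<dots> = (LINT x:box c d|lebesgue. u x)"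
        unfolding set_lebesgue_integral_def
      proof (rule integral_cong_AE)
        show "AE x in lebesgue. indicator (box c d) x *\<^sub>R g x = indicator (box c d) x *\<^sub>R u x"
          using ug' by eventually_elim simp
      qed (intro borel_measurable_scaleR indicator_box_measurable um gm)+
      also have "\<dots> = 0"
        by (rule fundamental_lemma_box[OF u that orth])
      finally show ?thesis .
    qed
    have "integrable lebesgue (\<lambda>x. inner (indicator (box a b) x :: real) (u x))"
      by (intro integrable_inner_square_integrable square_integrable_indicator_box u)
    moreover have "AE x in lebesgue. inner (indicator (box a b) x :: real) (u x) = ?v x"
      using ug' by eventually_elim simp
    ultimately have "integrable lebesgue ?v"
      by (subst (asm) integrable_cong_AE[where g = ?v]) (simp_all add: indicator_box_measurable borel_measurable_times um gm)
    then have v: "integrable lborel ?v"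
      by (simp add: integrable_completion)
    have "(LINT x:box c d|lborel. ?v x) = 0" for c d
    proof (cases "box c d \<inter> box a b = {}")
      case True
      then have "indicator (box c d) x *\<^sub>R ?v x = 0" for x
        by (auto simp: indicator_def)
      then show ?thesis
        by (simp only: set_lebesgue_integral_def Bochner_Integration.integral_zero)
    next
      case False
      obtain c' d' where eq: "box c d \<inter> box a b = box c' d'"
        by (rule that[OF box_Int_box])
      \<comment> \<open>Nonemptiness of the intersection identifies the closure of
        \<open>box c' d'\<close> with \<open>cbox c' d'\<close>, which is thus seen to lie in
        \<Omega>.\<close>
      have "closure (box c' d') \<subseteq> cbox a b"
        unfolding eq[symmetric] by (rule closure_minimal) (use box_subset_cbox[of a b] in auto)
      then have "cbox c' d' \<subseteq> \<Omega>"
        using closure_box[of c' d'] False ab unfolding eq by auto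
      from box_g[OF this] show ?thesis
        unfolding eq[symmetric] by (simp add: set_lebesgue_integral_def indicator_inter_arith mult.assoc)
    qed
    moreover have "(\<integral>x. ?v x \<partial>lborel) = 0"
      using box_g[OF ab] by (simp add: set_lebesgue_integral_def)
    ultimately have "AE x in lborel. ?v x = 0"
      by (intro box_integral_eq_0_imp_AE_eq_0 v) auto
    then have "AE x in lebesgue. ?v x = 0"
      by (rule AE_completion)
    \<comment> \<open>The boundary of the box is null, so the conclusion extends from the open box
      to the closed ones that cover \<Omega>.\<close>
    moreover have "AE x in lebesgue. x \<notin> cbox a b - box a b"
      using negligible_frontier_interval[of a b] by (intro AE_not_in) (simp add: negligible_iff_null_sets)
    ultimately show ?thesis
      using ug' by eventually_elim (auto simp: indicator_def split: if_splits)
  qed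
  obtain D where D: "countable D" "D \<subseteq> Pow \<Omega>" "\<And>X. X \<in> D \<Longrightarrow> \<exists>a b. X = cbox a b" "\<Union>D = \<Omega>"
    by (rule open_countable_Union_open_cbox[OF \<open>open \<Omega>\<close>]) (rule that)
  have "AE x in lebesgue. \<forall>X\<in>D. x \<in> X \<longrightarrow> u x = 0"
    unfolding AE_ball_countable[OF D(1)] using D(2,3) local by blast
  then show ?thesis
    using D(4) by (auto elim: eventually_mono)
qed

subsection \<open>Integrals of directional derivatives\<close>

text \<open>The derivative \<open>d\<close> is an argument and \<open>e\<close> any vector, so that
  the same facts apply to backward differences, that is, to \<open>- e\<close>. Continuity and
  bounded support are included because they give the domination of difference quotients.\<close>

definition directional_deriv ::
    "'a::euclidean_space \<Rightarrow> ('a \<Rightarrow> real) \<Rightarrow> ('a \<Rightarrow> real) \<Rightarrow> bool" where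
  "directional_deriv e u d \<longleftrightarrow>
     continuous_on UNIV u \<and> continuous_on UNIV d \<and> bounded {x. u x \<noteq> 0} \<and>
     (\<forall>x. ((\<lambda>t. u (x + t *\<^sub>R e)) has_real_derivative d x) (at 0))"

lemma directional_deriv_uminus:
  assumes "directional_deriv e u d"
  shows "directional_deriv (- e) u (\<lambda>x. - d x)"
proof -
  have "((\<lambda>t. u (x + t *\<^sub>R (- e))) has_real_derivative - d x) (at 0)" for x
  proof -
    have "((\<lambda>t. u (x + t *\<^sub>R e)) has_real_derivative d x) (at (- 0))"
      using assms by (simp add: directional_deriv_def)
    from DERIV_mirror[THEN iffD1, OF this] show ?thesis
      by simp
  qed
  then show ?thesis
    using assms by (auto simp: directional_deriv_def intro: continuous_on_minus)
qed

lemma integrable_continuous_bounded_support: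
  fixes u :: "'a::euclidean_space \<Rightarrow> real"
  assumes "continuous_on UNIV u" "bounded {x. u x \<noteq> 0}"
  shows "integrable lborel u"
proof -
  obtain a :: 'a where a: "{x. u x \<noteq> 0} \<subseteq> cbox (- a) a"
    using bounded_subset_cbox_symmetric[OF assms(2)] by blast
  have "integrable lborel (\<lambda>x. indicator (cbox (- a) a) x *\<^sub>R u x)"
    by (intro borel_integrable_compact compact_cbox continuous_on_subset[OF assms(1)]) auto
  moreover have "(\<lambda>x. indicator (cbox (- a) a) x *\<^sub>R u x) = u"
    using a by (auto simp: indicator_def fun_eq_iff)
  ultimately show ?thesis
    by simp
qed

lemma lborel_integral_translate:
  fixes u :: "'a::euclidean_space \<Rightarrow> real"
  assumes [measurable]: "u \<in> borel_measurable borel"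
  shows "(\<integral>x. u (x + c) \<partial>lborel) = (\<integral>x. u x \<partial>lborel)"
proof -
  have "(\<integral>x. u x \<partial>lborel) = (\<integral>x. u x \<partial>(distr lborel borel ((+) c)))"
    by (simp add: lborel_distr_plus)
  also have "\<dots> = (\<integral>x. u (c + x) \<partial>lborel)"
    by (rule integral_distr) auto
  finally show ?thesis
    by (simp add: add.commute)
qed

lemma lborel_integrable_translate:
  fixes u :: "'a::euclidean_space \<Rightarrow> real"
  assumes "integrable lborel u"
  shows "integrable lborel (\<lambda>x. u (x + c))"
proof -
  have "integrable (distr lborel borel ((+) c)) u"
    using assms by (simp add: lborel_distr_plus)
  then have "integrable lborel (\<lambda>x. u (c + x))"
    using borel_measurable_integrable[OF assms] by (subst (asm) integrable_distr_eq) auto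
  then show ?thesis
    by (simp add: add.commute)
qed

abbreviation step :: "nat \<Rightarrow> real" where
  "step n \<equiv> inverse (real (Suc n))"

lemma directional_deriv_quotient_tendsto:
  assumes "directional_deriv e u d"
  shows "(\<lambda>n. (u (x + step n *\<^sub>R e) - u x) / step n) \<longlonglongrightarrow> d x"
proof -
  have "((\<lambda>h. (u (x + h *\<^sub>R e) - u x) / h) \<longlongrightarrow> d x) (at 0)"
    using assms by (auto simp: directional_deriv_def DERIV_def)
  moreover have "filterlim step (at 0) sequentially"
    unfolding filterlim_at by (auto intro: LIMSEQ_inverse_real_of_nat simp del: of_nat_Suc)
  ultimately show ?thesis
    by (rule filterlim_compose)
qed

text \<open>A dominating function independent of \<open>n\<close>: the mean value theorem bounds the
  quotients, and as \<open>step n \<le> 1\<close> they vanish outside a ball slightly larger than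
  the support.\<close>

lemma directional_deriv_quotient_bound:
  fixes e :: "'a::euclidean_space"
  assumes "directional_deriv e u d"
  obtains M R where "\<And>n x. \<bar>(u (x + step n *\<^sub>R e) - u x) / step n\<bar> \<le> M * indicator (cball 0 R) x" "M \<ge> 0"
proof -
  have u: "continuous_on UNIV u" and d: "continuous_on UNIV d" and supp: "bounded {x. u x \<noteq> 0}"
    and der: "\<And>x. ((\<lambda>t. u (x + t *\<^sub>R e)) has_real_derivative d x) (at 0)"
    using assms by (auto simp: directional_deriv_def)
  have der': "((\<lambda>t. u (x + t *\<^sub>R e)) has_real_derivative d (x + t *\<^sub>R e)) (at t)" for x t
  proof -
    have "((\<lambda>s. u (x + t *\<^sub>R e + s *\<^sub>R e)) has_real_derivative d (x + t *\<^sub>R e)) (at 0)"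
      by (rule der)
    then have "((\<lambda>s. u (x + (s + t) *\<^sub>R e)) has_real_derivative d (x + t *\<^sub>R e)) (at 0)"
      by (simp add: algebra_simps)
    then show ?thesis
      using DERIV_shift[of "\<lambda>t. u (x + t *\<^sub>R e)" "d (x + t *\<^sub>R e)" 0 t] by simp
  qed
  obtain R where R: "\<And>x. u x \<noteq> 0 \<Longrightarrow> norm x \<le> R"
    using supp by (auto simp: bounded_iff)
  \<comment> \<open>One \<open>norm e\<close> accounts for points \<open>x\<close> outside the
    support whose translate lies in it, the other for the intermediate point of the mean value
    theorem.\<close>
  have "bounded (d ` cball 0 (R + norm e + norm e))"
    by (intro compact_imp_bounded compact_continuous_image continuous_on_subset[OF d]) auto
  then obtain M where M: "M > 0" "\<And>x. norm x \<le> R + norm e + norm e \<Longrightarrow> \<bar>d x\<bar> \<le> M"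
    by (auto simp: bounded_pos)
  have "\<bar>(u (x + step n *\<^sub>R e) - u x) / step n\<bar> \<le> M * indicator (cball 0 (R + norm e)) x" for n x
  proof (cases "norm x \<le> R + norm e")
    case True
    obtain z where z: "0 < z" "z < step n"
      and eq: "u (x + step n *\<^sub>R e) - u (x + 0 *\<^sub>R e) = (step n - 0) * d (x + z *\<^sub>R e)"
      using MVT2[of 0 "step n" "\<lambda>t. u (x + t *\<^sub>R e)" "\<lambda>t. d (x + t *\<^sub>R e)"] der' by auto
    have "z \<le> 1"
      using z(2) by (rule less_imp_le[THEN order_trans]) (simp add: field_simps)
    then have "norm (x + z *\<^sub>R e) \<le> R + norm e + norm e"
      using norm_triangle_ineq[of x "z *\<^sub>R e"] True z(1) mult_right_mono[of z 1 "norm e"] by simp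
    then have "\<bar>d (x + z *\<^sub>R e)\<bar> \<le> M"
      by (rule M)
    then show ?thesis
      using True eq by (simp del: of_nat_Suc)
  next
    case False
    have "norm (step n *\<^sub>R e) \<le> norm e"
      by (simp add: field_simps)
    moreover have "norm x \<le> norm (x + step n *\<^sub>R e) + norm (step n *\<^sub>R e)"
      using norm_triangle_ineq4[of "x + step n *\<^sub>R e" "step n *\<^sub>R e"] by simp
    ultimately have "\<not> norm (x + step n *\<^sub>R e) \<le> R" "\<not> norm x \<le> R"
      using False norm_ge_zero[of e] by linarith+
    then have "u (x + step n *\<^sub>R e) = 0" "u x = 0"
      using R by blast+
    then show ?thesis
      using False by simp
  qed
  then show ?thesis
    using M(1) that[of M "R + norm e"] by simp
qed

text \<open>Difference quotients have integral 0 by translation invariance, and dominated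
  convergence passes this to the derivative.\<close>

lemma integral_directional_deriv:
  assumes "directional_deriv e u d"
  shows "(\<integral>x. d x \<partial>lborel) = 0"
proof -
  have cu: "continuous_on UNIV u" and cd: "continuous_on UNIV d" and supp: "bounded {x. u x \<noteq> 0}"
    using assms by (auto simp: directional_deriv_def)
  have [measurable]: "u \<in> borel_measurable borel" "d \<in> borel_measurable borel"
    using cu cd by (auto intro: borel_measurable_continuous_onI)
  have u: "integrable lborel u"
    by (rule integrable_continuous_bounded_support[OF cu supp])
  obtain M R where MR: "\<And>n x. \<bar>(u (x + step n *\<^sub>R e) - u x) / step n\<bar> \<le> M * indicator (cball 0 R) x"
    using directional_deriv_quotient_bound[OF assms] by metis
  have "(\<lambda>n. \<integral>x. (u (x + step n *\<^sub>R e) - u x) / step n \<partial>lborel) \<longlonglongrightarrow> (\<integral>x. d x \<partial>lborel)"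
  proof (rule integral_dominated_convergence)
    show "integrable lborel (\<lambda>x::'a. M * indicator (cball 0 R) x)"
      by (intro integrable_mult_right integrable_real_indicator) (auto simp: emeasure_lborel_cball_finite[unfolded infinity_ennreal_def])
    show "AE x in lborel. (\<lambda>n. (u (x + step n *\<^sub>R e) - u x) / step n) \<longlonglongrightarrow> d x"
      by (intro AE_I2 directional_deriv_quotient_tendsto[OF assms])
    show "AE x in lborel. norm ((u (x + step n *\<^sub>R e) - u x) / step n) \<le> M * indicator (cball 0 R) x" for n
      using MR[of _ n] by (simp del: of_nat_Suc)
  qed measurable
  moreover have "(\<integral>x. (u (x + c) - u x) / k \<partial>lborel) = 0" for c k
  proof -
    have "integrable lborel (\<lambda>x. u (x + c))"
      by (rule lborel_integrable_translate[OF u])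
    then show ?thesis
      using u by (simp add: lborel_integral_translate)
  qed
  ultimately have "(\<lambda>n::nat. 0::real) \<longlonglongrightarrow> (\<integral>x. d x \<partial>lborel)"
    by (simp only:)
  then show ?thesis
    by (simp add: LIMSEQ_const_iff)
qed

text \<open>Two integrations by parts, done on difference quotients by translation invariance; this
  avoids the symmetry of second derivatives.\<close>

lemma integral_directional_deriv_swap:
  assumes u: "directional_deriv e u ue" "directional_deriv e' u ue'"
    and w: "directional_deriv e w we" "directional_deriv e' w we'"
  shows "(\<integral>x. ue x * we' x \<partial>lborel) = (\<integral>x. ue' x * we x \<partial>lborel)"
proof -
  have cont: "continuous_on UNIV u" "continuous_on UNIV w"
    and supp: "bounded {x. u x \<noteq> 0}" "bounded {x. w x \<noteq> 0}"
    and contd: "continuous_on UNIV ue" "continuous_on UNIV ue'" "continuous_on UNIV we" "continuous_on UNIV we'"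
    using u w by (auto simp: directional_deriv_def)
  have [measurable]: "u \<in> borel_measurable borel" "w \<in> borel_measurable borel"
    "ue \<in> borel_measurable borel" "ue' \<in> borel_measurable borel"
    "we \<in> borel_measurable borel" "we' \<in> borel_measurable borel"
    using cont contd by (auto intro: borel_measurable_continuous_onI)
  \<comment> \<open>The directions are arbitrary because the limit is taken twice: once along
    \<open>e\<close> and \<open>e'\<close>, once along \<open>- e'\<close> and
    \<open>- e\<close>.\<close>
  have lim: "(\<lambda>n. \<integral>x. ((u (x + step n *\<^sub>R a) - u x) / step n) * ((w (x + step n *\<^sub>R c) - w x) / step n) \<partial>lborel)
      \<longlonglongrightarrow> (\<integral>x. ua x * wc x \<partial>lborel)"
    if a: "directional_deriv a u ua" and c: "directional_deriv c w wc" for a ua c wc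
  proof -
    have [measurable]: "ua \<in> borel_measurable borel" "wc \<in> borel_measurable borel"
      using a c by (auto simp: directional_deriv_def intro: borel_measurable_continuous_onI)
    obtain M R where MR: "\<And>n x. \<bar>(u (x + step n *\<^sub>R a) - u x) / step n\<bar> \<le> M * indicator (cball 0 R) x" "M \<ge> 0"
      using directional_deriv_quotient_bound[OF a] by metis
    obtain M' R' where MR': "\<And>n x. \<bar>(w (x + step n *\<^sub>R c) - w x) / step n\<bar> \<le> M' * indicator (cball 0 R') x" "M' \<ge> 0"
      using directional_deriv_quotient_bound[OF c] by metis
    show ?thesis
    proof (rule integral_dominated_convergence)
      show "integrable lborel (\<lambda>x::'a. (M * M') * indicator (cball 0 R) x)"
        by (intro integrable_mult_right integrable_real_indicator) (auto simp: emeasure_lborel_cball_finite[unfolded infinity_ennreal_def])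
      show "AE x in lborel. (\<lambda>n. ((u (x + step n *\<^sub>R a) - u x) / step n) * ((w (x + step n *\<^sub>R c) - w x) / step n))
          \<longlonglongrightarrow> ua x * wc x"
        by (intro AE_I2 tendsto_mult directional_deriv_quotient_tendsto a c)
      have "norm (((u (x + step n *\<^sub>R a) - u x) / step n) * ((w (x + step n *\<^sub>R c) - w x) / step n))
          \<le> (M * M') * indicator (cball 0 R) x" for n x
      proof -
        have "norm (((u (x + step n *\<^sub>R a) - u x) / step n) * ((w (x + step n *\<^sub>R c) - w x) / step n))
            \<le> (M * indicator (cball 0 R) x) * (M' * indicator (cball 0 R') x)"
          unfolding real_norm_def abs_mult
          by (intro mult_mono MR MR' mult_nonneg_nonneg) auto
        also have "\<dots> \<le> (M * M') * indicator (cball 0 R) x"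
          using MR(2) MR'(2) by (auto simp: indicator_def)
        finally show ?thesis .
      qed
      then show "AE x in lborel. norm (((u (x + step n *\<^sub>R a) - u x) / step n) * ((w (x + step n *\<^sub>R c) - w x) / step n))
          \<le> (M * M') * indicator (cball 0 R) x" for n
        by (intro AE_I2)
    qed measurable
  qed
  have int: "integrable lborel (\<lambda>x. u (x + a) * w (x + c))" for a c
  proof (rule integrable_continuous_bounded_support)
    show "continuous_on UNIV (\<lambda>x. u (x + a) * w (x + c))"
      by (auto intro!: continuous_intros continuous_on_compose2[OF cont(1)] continuous_on_compose2[OF cont(2)])
    have "bounded ((\<lambda>x. x - a) ` {x. u x \<noteq> 0})"
      by (intro bounded_translation_minus supp)
    moreover have "{x. u (x + a) * w (x + c) \<noteq> 0} \<subseteq> (\<lambda>x. x - a) ` {x. u x \<noteq> 0}"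
      by (force simp: image_iff intro: exI[of _ "_ + a"])
    ultimately show "bounded {x. u (x + a) * w (x + c) \<noteq> 0}"
      by (rule bounded_subset)
  qed
  have shift: "(\<integral>x. u (x + a) * w (x + c) \<partial>lborel) = (\<integral>x. u (x + (a + h)) * w (x + (c + h)) \<partial>lborel)" for a c h
    using lborel_integral_translate[of "\<lambda>x. u (x + a) * w (x + c)" h] by (simp add: ac_simps)
  have expand: "(\<integral>x. (u (x + a) - u x) * (w (x + c) - w x) \<partial>lborel) =
      (\<integral>x. u (x + a) * w (x + c) \<partial>lborel) - (\<integral>x. u (x + a) * w (x + 0) \<partial>lborel)
      - (\<integral>x. u (x + 0) * w (x + c) \<partial>lborel) + (\<integral>x. u (x + 0) * w (x + 0) \<partial>lborel)" for a c
    using int[of a c] int[of a 0] int[of 0 c] int[of 0 0] by (simp add: algebra_simps)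
  \<comment> \<open>Discrete double integration by parts. After expansion each of the four integrals
    depends only on the difference of its two shifts, so the forward differences can be exchanged
    for backward ones with \<open>a\<close> and \<open>c\<close> swapped between \<open>u\<close>
    and \<open>w\<close>.\<close>
  have "(\<integral>x. (u (x + a) - u x) * (w (x + c) - w x) \<partial>lborel)
      = (\<integral>x. (u (x + - c) - u x) * (w (x + - a) - w x) \<partial>lborel)" for a c
    unfolding expand using shift[of "- c" "- a" "a + c"] shift[of "- c" 0 c] shift[of 0 "- a" a]
    by simp
  from this[of "k *\<^sub>R e" "k *\<^sub>R e'" for k]
  have "(\<integral>x. ((u (x + k *\<^sub>R e) - u x) / k) * ((w (x + k *\<^sub>R e') - w x) / k) \<partial>lborel)
      = (\<integral>x. ((u (x + k *\<^sub>R (- e')) - u x) / k) * ((w (x + k *\<^sub>R (- e)) - w x) / k) \<partial>lborel)" for k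
    by (simp add: times_divide_times_eq)
  with lim[OF u(1) w(2)]
  have "(\<lambda>n. \<integral>x. ((u (x + step n *\<^sub>R (- e')) - u x) / step n) * ((w (x + step n *\<^sub>R (- e)) - w x) / step n) \<partial>lborel)
      \<longlonglongrightarrow> (\<integral>x. ue x * we' x \<partial>lborel)"
    by (simp only:)
  \<comment> \<open>The backward quotients tend to \<open>- ue'\<close> and \<open>- we\<close>; the
    two signs cancel in the product.\<close>
  from LIMSEQ_unique[OF this lim[OF directional_deriv_uminus[OF u(2)] directional_deriv_uminus[OF w(1)]]]
  show ?thesis
    by simp
qed

subsection \<open>Test functions\<close>

text \<open>The inclusion is into the closure, since a partial derivative may be nonzero at a zero
  of \<phi>.\<close>

lemma test_functionsI:
  assumes "\<And>k. Ck k f" "\<phi> \<in> test_functions \<Omega>" "{x. f x \<noteq> 0} \<subseteq> closure {x. \<phi> x \<noteq> 0}"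
  shows "f \<in> test_functions \<Omega>"
proof -
  have "closure {x. f x \<noteq> 0} \<subseteq> closure {x. \<phi> x \<noteq> 0}"
    using assms(3) by (intro closure_minimal) auto
  moreover from this have "compact (closure {x. f x \<noteq> 0})"
    using assms(2) by (metis (mono_tags, lifting) Int_absorb1 closed_Int_compact closed_closure mem_Collect_eq
        test_functions_def Int_commute)
  ultimately show ?thesis
    using assms(1,2) by (auto simp: test_functions_def)
qed

lemma test_function_Ck: "\<phi> \<in> test_functions \<Omega> \<Longrightarrow> Ck k \<phi>"
  by (simp add: test_functions_def)

lemma test_function_differentiable: "\<phi> \<in> test_functions \<Omega> \<Longrightarrow> \<phi> differentiable (at x)"
  using test_function_Ck[of \<phi> \<Omega> 1] by simp

lemma test_function_continuous: "\<phi> \<in> test_functions \<Omega> \<Longrightarrow> continuous_on UNIV \<phi>"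
  using test_function_Ck[of \<phi> \<Omega> 0] by simp

lemma test_function_bounded_support: "\<phi> \<in> test_functions \<Omega> \<Longrightarrow> bounded {x. \<phi> x \<noteq> 0}"
  unfolding test_functions_def using bounded_subset[OF compact_imp_bounded closure_subset] by blast

lemma test_function_outside: "\<phi> \<in> test_functions \<Omega> \<Longrightarrow> x \<notin> \<Omega> \<Longrightarrow> \<phi> x = 0"
  unfolding test_functions_def using closure_subset[of "{x. \<phi> x \<noteq> 0}"] by auto

lemma test_function_indicator: "\<phi> \<in> test_functions \<Omega> \<Longrightarrow> indicator \<Omega> x *\<^sub>R \<phi> x = \<phi> x"
  using test_function_outside[of \<phi> \<Omega> x] by (cases "x \<in> \<Omega>") auto

lemma test_function_zero: "(\<lambda>x. 0) \<in> test_functions \<Omega>"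
  by (simp add: test_functions_def Ck_const)

lemma test_function_add:
  assumes f: "f \<in> test_functions \<Omega>" and g: "g \<in> test_functions \<Omega>"
  shows "(\<lambda>x. f x + g x) \<in> test_functions \<Omega>"
proof -
  let ?U = "closure {x. f x \<noteq> 0} \<union> closure {x. g x \<noteq> 0}"
  have sub: "closure {x. f x + g x \<noteq> 0} \<subseteq> ?U"
  proof (intro closure_minimal subsetI)
    fix x assume "x \<in> {x. f x + g x \<noteq> 0}"
    then have "x \<in> {x. f x \<noteq> 0} \<or> x \<in> {x. g x \<noteq> 0}"
      by auto
    then show "x \<in> ?U"
      using closure_subset[of "{x. f x \<noteq> 0}"] closure_subset[of "{x. g x \<noteq> 0}"]
      by (meson UnI1 UnI2 subsetD)
  qed auto
  moreover have "compact ?U" "?U \<subseteq> \<Omega>"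
    using f g by (auto simp: test_functions_def)
  moreover from this have "compact (closure {x. f x + g x \<noteq> 0})"
    using compact_Int_closed[of ?U "closure {x. f x + g x \<noteq> 0}"] sub by (simp add: Int_absorb1)
  ultimately show ?thesis
    using f g by (auto simp: test_functions_def intro: Ck_add)
qed

lemma test_function_bounded_linear:
  assumes "\<phi> \<in> test_functions \<Omega>" "bounded_linear L"
  shows "(\<lambda>x. L (\<phi> x)) \<in> test_functions \<Omega>"
proof (rule test_functionsI[OF _ assms(1)])
  show "Ck k (\<lambda>x. L (\<phi> x))" for k
    by (rule Ck_bounded_linear[OF test_function_Ck[OF assms(1)] assms(2)])
  show "{x. L (\<phi> x) \<noteq> 0} \<subseteq> closure {x. \<phi> x \<noteq> 0}"
    using closure_subset[of "{x. \<phi> x \<noteq> 0}"] linear_0[OF bounded_linear.linear[OF assms(2)]] by fastforce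
qed

lemma test_function_mult:
  fixes f \<phi> :: "real^'n \<Rightarrow> real"
  assumes "\<And>k. Ck k f" "\<phi> \<in> test_functions \<Omega>"
  shows "(\<lambda>x. f x * \<phi> x) \<in> test_functions \<Omega>"
proof (rule test_functionsI[OF Ck_mult[OF assms(1) test_function_Ck[OF assms(2)]] assms(2)])
  show "{x. f x * \<phi> x \<noteq> 0} \<subseteq> closure {x. \<phi> x \<noteq> 0}"
    using closure_subset[of "{x. \<phi> x \<noteq> 0}"] by auto
qed

lemma test_function_sum:
  fixes f :: "'i \<Rightarrow> real^'n \<Rightarrow> 'b::real_normed_vector"
  assumes "\<And>i. i \<in> I \<Longrightarrow> f i \<in> test_functions \<Omega>"
  shows "(\<lambda>x. \<Sum>i\<in>I. f i x) \<in> test_functions \<Omega>"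
  using assms
  by (induction I rule: infinite_finite_induct) (auto intro: test_function_zero test_function_add)

lemma test_function_partial_deriv:
  assumes "\<phi> \<in> test_functions \<Omega>"
  shows "partial_deriv j \<phi> \<in> test_functions \<Omega>"
proof (rule test_functionsI[OF _ assms])
  show "Ck k (partial_deriv j \<phi>)" for k
    using test_function_Ck[OF assms, of "Suc k"] by simp
  have "partial_deriv j \<phi> x = 0" if "x \<notin> closure {x. \<phi> x \<noteq> 0}" for x
  proof -
    \<comment> \<open>Off the closed support \<phi> vanishes in a whole neighbourhood, so its
      derivative there is that of the zero function.\<close>
    have "eventually (\<lambda>y. y \<in> - closure {x. \<phi> x \<noteq> 0}) (nhds x)"
      using that by (intro eventually_nhds_in_open) auto
    then have "eventually (\<lambda>y. (\<lambda>y. 0) y = \<phi> y) (at x)"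
      unfolding eventually_nhds_conv_at
      by (auto elim!: eventually_mono dest: contra_subsetD[OF closure_subset])
    then have "(\<phi> has_derivative (\<lambda>h. 0)) (at x)"
      by (rule has_derivative_transform_eventually[OF has_derivative_const])
        (use that closure_subset[of "{x. \<phi> x \<noteq> 0}"] in auto)
    from partial_deriv_eq[OF this] show ?thesis .
  qed
  then show "{x. partial_deriv j \<phi> x \<noteq> 0} \<subseteq> closure {x. \<phi> x \<noteq> 0}"
    by blast
qed

lemma partial_deriv_mult:
  fixes f g :: "real^'n \<Rightarrow> real"
  assumes "f differentiable (at x)" "g differentiable (at x)"
  shows "partial_deriv j (\<lambda>x. f x * g x) x = f x * partial_deriv j g x + partial_deriv j f x * g x"
proof -
  have d: "(f has_derivative frechet_derivative f (at x)) (at x)"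
    "(g has_derivative frechet_derivative g (at x)) (at x)"
    using assms by (simp_all flip: frechet_derivative_works)
  show ?thesis
    by (subst partial_deriv_eq[OF has_derivative_mult[OF d]]) (simp add: partial_deriv_def)
qed

lemma partial_deriv_sum:
  assumes "\<And>i. i \<in> I \<Longrightarrow> f i differentiable (at x)"
  shows "partial_deriv j (\<lambda>x. \<Sum>i\<in>I. f i x) x = (\<Sum>i\<in>I. partial_deriv j (f i) x)"
proof -
  have d: "(f i has_derivative frechet_derivative (f i) (at x)) (at x)" if "i \<in> I" for i
    using assms[OF that] by (simp flip: frechet_derivative_works)
  show ?thesis
    by (subst partial_deriv_eq[OF has_derivative_sum[OF d]]) (simp_all add: partial_deriv_def)
qed

lemma Ck_nth: "Ck k (\<lambda>x::real^'n. x $ j)"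
proof -
  have "partial_deriv i (\<lambda>x::real^'n. x) = (\<lambda>x. axis i 1)" for i
    by (rule ext, subst partial_deriv_eq[OF has_derivative_ident]) simp
  then have "Ck k (\<lambda>x::real^'n. x)"
    by (cases k) (auto simp: Ck_const)
  then show ?thesis
    by (rule Ck_bounded_linear) (rule bounded_linear_vec_nth)
qed

lemma partial_deriv_nth: "partial_deriv j (\<lambda>x::real^'n. x $ i) x = axis j 1 $ i"
  by (rule partial_deriv_eq) (rule bounded_linear_imp_has_derivative[OF bounded_linear_vec_nth])

lemma test_function_directional_deriv:
  fixes \<phi> :: "real^'n \<Rightarrow> real"
  assumes "\<phi> \<in> test_functions \<Omega>"
  shows "directional_deriv (axis j 1) \<phi> (partial_deriv j \<phi>)"
proof -
  have "((\<lambda>t. \<phi> (x + t *\<^sub>R axis j 1)) has_real_derivative partial_deriv j \<phi> x) (at 0)" for x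
  proof -
    have "(\<phi> has_derivative frechet_derivative \<phi> (at x)) (at (x + 0 *\<^sub>R axis j 1))"
      using test_function_differentiable[OF assms, of x] by (simp flip: frechet_derivative_works)
    moreover have "((\<lambda>t. x + t *\<^sub>R axis j 1) has_derivative (\<lambda>t. t *\<^sub>R axis j 1)) (at 0)"
      by (auto intro!: derivative_eq_intros)
    ultimately have "((\<lambda>t. \<phi> (x + t *\<^sub>R axis j 1)) has_derivative
        (\<lambda>t. frechet_derivative \<phi> (at x) (t *\<^sub>R axis j 1))) (at 0)"
      by (rule has_derivative_compose[rotated])
    moreover have "frechet_derivative \<phi> (at x) (t *\<^sub>R axis j 1) = partial_deriv j \<phi> x * t" for t
      using linear_cmul[OF linear_frechet_derivative[OF test_function_differentiable[OF assms, of x]]]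
      by (simp add: partial_deriv_def mult.commute)
    ultimately show ?thesis
      by (simp add: has_field_derivative_def)
  qed
  then show ?thesis
    using test_function_continuous[OF assms] test_function_bounded_support[OF assms]
      test_function_continuous[OF test_function_partial_deriv[OF assms]]
    by (simp add: directional_deriv_def)
qed

lemma borel_measurable_lebesgue_continuous:
  fixes f :: "'a::euclidean_space \<Rightarrow> 'b::euclidean_space"
  assumes "continuous_on UNIV f"
  shows "f \<in> borel_measurable lebesgue"
proof -
  have "f \<in> borel_measurable lborel"
    using borel_measurable_continuous_onI[OF assms] by simp
  then show ?thesis
    by (rule measurable_completion)
qed

lemma integrable_lebesgue_test_function:
  fixes \<phi> :: "real^'n \<Rightarrow> real"
  assumes "\<phi> \<in> test_functions \<Omega>"
  shows "integrable lebesgue \<phi>"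
  using integrable_continuous_bounded_support[OF test_function_continuous[OF assms]
      test_function_bounded_support[OF assms]]
  by (simp add: integrable_completion)

lemma integral_partial_deriv:
  fixes \<phi> :: "real^'n \<Rightarrow> real"
  assumes "\<phi> \<in> test_functions \<Omega>"
  shows "(\<integral>x. partial_deriv j \<phi> x \<partial>lebesgue) = 0"
  using integral_directional_deriv[OF test_function_directional_deriv[OF assms]]
    borel_measurable_continuous_onI[OF test_function_continuous[OF test_function_partial_deriv[OF assms]]]
  by (subst integral_completion) auto

lemma integral_partial_deriv_swap:
  fixes f g :: "real^'n \<Rightarrow> real"
  assumes f: "f \<in> test_functions \<Omega>" and g: "g \<in> test_functions \<Omega>"
  shows "(\<integral>x. partial_deriv i f x * partial_deriv j g x \<partial>lebesgue)
       = (\<integral>x. partial_deriv j f x * partial_deriv i g x \<partial>lebesgue)"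
proof -
  have m: "partial_deriv k f \<in> borel_measurable borel" "partial_deriv k g \<in> borel_measurable borel" for k
    using f g by (auto intro!: borel_measurable_continuous_onI test_function_continuous
        test_function_partial_deriv)
  show ?thesis
    using integral_directional_deriv_swap[OF test_function_directional_deriv[OF f]
        test_function_directional_deriv[OF f] test_function_directional_deriv[OF g]
        test_function_directional_deriv[OF g], of i j] m
    by (simp add: integral_completion borel_measurable_times)
qed

lemma square_integrable_continuous:
  fixes f :: "'a::euclidean_space \<Rightarrow> 'b::euclidean_space"
  assumes "continuous_on UNIV f" "bounded {x. f x \<noteq> 0}"
  shows "square_integrable f"
  unfolding square_integrable_def
proof
  have "integrable lborel (\<lambda>x. (norm (f x))\<^sup>2)"
    using assms by (intro integrable_continuous_bounded_support continuous_intros) auto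
  then show "integrable lebesgue (\<lambda>x. (norm (f x))\<^sup>2)"
    by (simp add: integrable_completion)
qed (rule borel_measurable_lebesgue_continuous[OF assms(1)])

lemma square_integrable_test_function:
  fixes \<phi> :: "real^'n \<Rightarrow> 'b::euclidean_space"
  shows "\<phi> \<in> test_functions \<Omega> \<Longrightarrow> square_integrable \<phi>"
  by (intro square_integrable_continuous test_function_continuous test_function_bounded_support)

lemma rep_L2_of_test_function:
  fixes \<phi> :: "real^'n \<Rightarrow> 'b::euclidean_space"
  assumes "\<phi> \<in> test_functions \<Omega>"
  shows "AE x in lebesgue. rep_l2 (L2_of \<Omega> \<phi>) x = \<phi> x"
  using rep_L2_of[of \<Omega> \<phi>] square_integrable_test_function[OF assms]
  by (simp add: test_function_indicator[OF assms])

lemma L2_of_test_function_in_L2: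
  fixes \<phi> :: "real^'n \<Rightarrow> 'b::euclidean_space"
  assumes "\<phi> \<in> test_functions \<Omega>"
  shows "L2_of \<Omega> \<phi> \<in> L2 \<Omega>"
  by (rule L2_of_in_L2) (simp add: test_function_indicator[OF assms] square_integrable_test_function[OF assms])

lemma inner_L2_of_test_function:
  fixes \<phi> :: "real^'n \<Rightarrow> 'b::euclidean_space"
  assumes "\<phi> \<in> test_functions \<Omega>"
  shows "inner v (L2_of \<Omega> \<phi>) = (LINT x:\<Omega>|lebesgue. inner (rep_l2 v x) (\<phi> x))"
proof -
  have "inner v (L2_of \<Omega> \<phi>) = (\<integral>x. inner (rep_l2 v x) (\<phi> x) \<partial>lebesgue)"
    by (rule inner_l2_AE[OF _ rep_L2_of_test_function[OF assms]])
      (auto intro: borel_measurable_lebesgue_continuous test_function_continuous[OF assms])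
  also have "\<dots> = (\<integral>x. inner (rep_l2 v x) (indicator \<Omega> x *\<^sub>R \<phi> x) \<partial>lebesgue)"
    by (simp add: test_function_indicator[OF assms])
  finally show ?thesis
    by (simp add: set_lebesgue_integral_def)
qed

lemma L2_of_add:
  assumes "square_integrable (\<lambda>x. indicator \<Omega> x *\<^sub>R f x)" "square_integrable (\<lambda>x. indicator \<Omega> x *\<^sub>R g x)"
  shows "L2_of \<Omega> (\<lambda>x. f x + g x) = L2_of \<Omega> f + L2_of \<Omega> g"
proof (rule l2_eqI)
  have "square_integrable (\<lambda>x. indicator \<Omega> x *\<^sub>R (f x + g x))"
    using square_integrable_add[OF assms] by (simp add: scaleR_add_right)
  from rep_L2_of[OF this] rep_L2_of[OF assms(1)] rep_L2_of[OF assms(2)] rep_l2_plus[of "L2_of \<Omega> f" "L2_of \<Omega> g"]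
  show "AE x in lebesgue. rep_l2 (L2_of \<Omega> (\<lambda>x. f x + g x)) x = rep_l2 (L2_of \<Omega> f + L2_of \<Omega> g) x"
    by eventually_elim (simp add: scaleR_add_right)
qed

lemma L2_of_scaleR:
  assumes "square_integrable (\<lambda>x. indicator \<Omega> x *\<^sub>R f x)"
  shows "L2_of \<Omega> (\<lambda>x. c *\<^sub>R f x) = c *\<^sub>R L2_of \<Omega> f"
proof (rule l2_eqI)
  have "square_integrable (\<lambda>x. indicator \<Omega> x *\<^sub>R (c *\<^sub>R f x))"
    using square_integrable_scaleR[OF assms, of c] by (simp add: mult.commute)
  from rep_L2_of[OF this] rep_L2_of[OF assms] rep_l2_scaleR[of c "L2_of \<Omega> f"]
  show "AE x in lebesgue. rep_l2 (L2_of \<Omega> (\<lambda>x. c *\<^sub>R f x)) x = rep_l2 (c *\<^sub>R L2_of \<Omega> f) x"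
    by eventually_elim simp
qed

subsection \<open>The space of vector fields with zero trace\<close>

text \<open>Each defining equation becomes a condition on inner products of \<open>v\<close> and
  \<open>G\<close> with fixed elements of \<open>l2\<close>. In this form the conditions are visibly
  linear and closed in the pair \<open>(v, G)\<close>.\<close>

lemma is_weak_jacobian_iff:
  "is_weak_jacobian \<Omega> v G \<longleftrightarrow> G \<in> L2 \<Omega> \<and> (\<forall>\<phi>\<in>test_functions \<Omega>. \<forall>i j.
     inner v (L2_of \<Omega> (\<lambda>x. axis i (partial_deriv j \<phi> x))) +
     inner G (L2_of \<Omega> (\<lambda>x. axis i (axis j (\<phi> x)))) = 0)"
proof -
  have ax: "bounded_linear (axis i :: 'b::euclidean_space \<Rightarrow> 'b^'a)" for i
    by (intro linear_conv_bounded_linear[THEN iffD1] linearI)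
      (auto simp: axis_def vec_eq_iff)
  have "inner v (L2_of \<Omega> (\<lambda>x. axis i (partial_deriv j \<phi> x)))
      = (LINT x:\<Omega>|lebesgue. rep_l2 v x $ i * partial_deriv j \<phi> x)"
    and "inner G (L2_of \<Omega> (\<lambda>x. axis i (axis j (\<phi> x))))
      = (LINT x:\<Omega>|lebesgue. rep_l2 G x $ i $ j * \<phi> x)"
    if "\<phi> \<in> test_functions \<Omega>" for \<phi> :: "real^'a \<Rightarrow> real" and i j
    using that
    by (simp_all add: inner_L2_of_test_function test_function_bounded_linear ax
        test_function_bounded_linear[OF test_function_bounded_linear[OF _ ax] ax]
        test_function_partial_deriv inner_axis)
  then show ?thesis
    unfolding is_weak_jacobian_def by (auto simp: eq_neg_iff_add_eq_0)
qed

lemma is_weak_jacobian_diff: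
  assumes "\<Omega> \<in> sets lebesgue" "is_weak_jacobian \<Omega> v G" "is_weak_jacobian \<Omega> w H"
  shows "is_weak_jacobian \<Omega> (v - w) (G - H)"
  unfolding is_weak_jacobian_iff
proof (intro conjI ballI allI)
  show "G - H \<in> L2 \<Omega>"
    using assms subspace_diff[OF subspace_L2[OF assms(1)]] unfolding is_weak_jacobian_iff by blast
  fix \<phi> :: "real^'a \<Rightarrow> real" and i j assume "\<phi> \<in> test_functions \<Omega>"
  then have "inner v (L2_of \<Omega> (\<lambda>x. axis i (partial_deriv j \<phi> x))) + inner G (L2_of \<Omega> (\<lambda>x. axis i (axis j (\<phi> x)))) = 0"
    "inner w (L2_of \<Omega> (\<lambda>x. axis i (partial_deriv j \<phi> x))) + inner H (L2_of \<Omega> (\<lambda>x. axis i (axis j (\<phi> x)))) = 0"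
    using assms(2,3) unfolding is_weak_jacobian_iff by blast+
  then show "inner (v - w) (L2_of \<Omega> (\<lambda>x. axis i (partial_deriv j \<phi> x))) +
      inner (G - H) (L2_of \<Omega> (\<lambda>x. axis i (axis j (\<phi> x)))) = 0"
    unfolding inner_diff_left by linarith
qed

lemma closed_weak_jacobian_graph:
  assumes "\<Omega> \<in> sets lebesgue"
  shows "closed {(v, G). v \<in> L2 \<Omega> \<and> is_weak_jacobian \<Omega> v G}"
proof -
  have "closed {p :: (real^'a, real^'a) l2 \<times> (real^'a, real^'a^'a) l2.
      fst p \<in> L2 \<Omega> \<and> snd p \<in> L2 \<Omega> \<and> (\<forall>\<phi>\<in>test_functions \<Omega>. \<forall>i j.
       inner (fst p) (L2_of \<Omega> (\<lambda>x. axis i (partial_deriv j \<phi> x))) +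
       inner (snd p) (L2_of \<Omega> (\<lambda>x. axis i (axis j (\<phi> x)))) = 0)}"
    unfolding Ball_def
    by (intro closed_Collect_conj closed_Collect_all closed_Collect_imp open_Collect_const
        closed_Collect_eq continuous_intros closed_vimage[of _ fst, unfolded vimage_def]
        closed_vimage[of _ snd, unfolded vimage_def] closed_L2 assms)
  then show ?thesis
    by (rule back_subst[of closed]) (auto simp: is_weak_jacobian_iff)
qed

text \<open>The difference is a weak Jacobian of 0, so its entries are orthogonal to all test
  functions. The fundamental lemma makes them vanish in \<Omega>, and membership in
  \<open>L2 \<Omega>\<close> makes them vanish outside.\<close>

lemma is_weak_jacobian_unique:
  assumes "open \<Omega>" "is_weak_jacobian \<Omega> v G" "is_weak_jacobian \<Omega> v H"
  shows "G = H"
proof -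
  have \<Omega>: "\<Omega> \<in> sets lebesgue"
    using assms(1) by simp
  have D: "is_weak_jacobian \<Omega> 0 (G - H)"
    using is_weak_jacobian_diff[OF \<Omega> assms(2,3)] by simp
  let ?D = "rep_l2 (G - H)"
  have "AE x in lebesgue. x \<in> \<Omega> \<longrightarrow> ?D x $ i $ j = 0" for i j
  proof (rule fundamental_lemma[OF assms(1)])
    have m: "(\<lambda>x. ?D x $ i $ j) \<in> borel_measurable lebesgue"
      by (rule borel_measurable_continuous_on[OF _ borel_measurable_rep_l2]) (intro continuous_intros)
    show "square_integrable (\<lambda>x. ?D x $ i $ j)"
    proof (rule square_integrable_dominated[OF square_integrable_rep_l2 m])
      have "norm (?D x $ i $ j) \<le> 1 * norm (?D x)" for x
        using component_le_norm_cart[of "?D x $ i" j] Finite_Cartesian_Product.norm_nth_le[of "?D x" i] by simp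
      then show "AE x in lebesgue. norm (?D x $ i $ j) \<le> 1 * norm (?D x)"
        by simp
    qed
    have z: "(LINT x:\<Omega>|lebesgue. rep_l2 (0 :: (real^'a, real^'a) l2) x $ i * partial_deriv j \<phi> x) = 0" for \<phi> :: "real^'a \<Rightarrow> real"
      unfolding set_lebesgue_integral_def
      by (rule integral_eq_zero_AE, use rep_l2_zero[where 'a = "real^'a" and 'b = "real^'a"] in eventually_elim) simp
    show "(LINT x:\<Omega>|lebesgue. ?D x $ i $ j * \<phi> x) = 0" if "\<phi> \<in> test_functions \<Omega>" for \<phi>
    proof -
      have "(LINT x:\<Omega>|lebesgue. rep_l2 (0 :: (real^'a, real^'a) l2) x $ i * partial_deriv j \<phi> x)
          = - (LINT x:\<Omega>|lebesgue. ?D x $ i $ j * \<phi> x)"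
        using D that unfolding is_weak_jacobian_def by blast
      then show ?thesis
        using z[of \<phi>] by simp
    qed
  qed
  then have "AE x in lebesgue. \<forall>i j. x \<in> \<Omega> \<longrightarrow> ?D x $ i $ j = 0"
    by (intro AE_all_countable[THEN iffD2] allI)
  moreover have "AE x in lebesgue. x \<notin> \<Omega> \<longrightarrow> ?D x = 0"
    using D by (simp add: is_weak_jacobian_def L2_def)
  ultimately have "AE x in lebesgue. ?D x = rep_l2 0 x"
    using rep_l2_zero[where 'a = "real^'a" and 'b = "real^'a^'a"] by eventually_elim (auto simp: vec_eq_iff)
  then show ?thesis
    using l2_eqI by force
qed

lemma jacobian_eq:
  assumes "open \<Omega>" "is_weak_jacobian \<Omega> v G"
  shows "jacobian \<Omega> v = G"
  unfolding jacobian_def using assms is_weak_jacobian_unique by blast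

definition classical_jacobian :: "(real^'n \<Rightarrow> real^'n) \<Rightarrow> real^'n \<Rightarrow> real^'n^'n" where
  "classical_jacobian \<phi> x = (\<chi> i j. partial_deriv j (\<lambda>x. \<phi> x $ i) x)"

lemma test_function_nth: "\<phi> \<in> test_functions \<Omega> \<Longrightarrow> (\<lambda>x. \<phi> x $ i) \<in> test_functions \<Omega>"
  by (rule test_function_bounded_linear[OF _ bounded_linear_vec_nth])

lemma classical_jacobian_test_function:
  fixes \<phi> :: "real^'n \<Rightarrow> real^'n"
  assumes "\<phi> \<in> test_functions \<Omega>"
  shows "classical_jacobian \<phi> \<in> test_functions \<Omega>"
proof -
  let ?L = "\<lambda>i j y. axis i (axis j y) :: real^'n^'n"
  have L: "bounded_linear (?L i j)" for i j
    by (intro linear_conv_bounded_linear[THEN iffD1] linearI)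
      (auto simp: axis_def vec_eq_iff)
  \<comment> \<open>The matrix is assembled from its scalar entries, each embedded by
    \<open>axis\<close>, so that closure of test functions under linear maps and sums
    applies.\<close>
  have "(\<lambda>x. \<Sum>i\<in>UNIV. \<Sum>j\<in>UNIV. ?L i j (partial_deriv j (\<lambda>x. \<phi> x $ i) x)) \<in> test_functions \<Omega>"
    by (intro test_function_sum test_function_bounded_linear[OF _ L] test_function_partial_deriv
        test_function_nth assms)
  moreover have "(\<lambda>x. \<Sum>i\<in>UNIV. \<Sum>j\<in>UNIV. ?L i j (partial_deriv j (\<lambda>x. \<phi> x $ i) x)) = classical_jacobian \<phi>"
    by (simp add: fun_eq_iff vec_eq_iff classical_jacobian_def axis_def if_distrib[of "\<lambda>f. f $ _"] sum.If_cases
        cong: if_cong)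
  ultimately show ?thesis
    by simp
qed

text \<open>Integration by parts: the product of a component with the test function \<psi> is itself
  a test function, so its derivative integrates to 0. The remaining steps exchange
  representatives.\<close>

lemma classical_jacobian_weak:
  assumes "\<phi> \<in> test_functions \<Omega>"
  shows "is_weak_jacobian \<Omega> (L2_of \<Omega> \<phi>) (L2_of \<Omega> (classical_jacobian \<phi>))"
  unfolding is_weak_jacobian_def
proof (intro conjI ballI allI)
  note J = classical_jacobian_test_function[OF assms]
  show "L2_of \<Omega> (classical_jacobian \<phi>) \<in> L2 \<Omega>"
    by (rule L2_of_test_function_in_L2[OF J])
  fix \<psi> :: "real^'a \<Rightarrow> real" and i j assume \<psi>: "\<psi> \<in> test_functions \<Omega>"
  let ?f = "\<lambda>x. \<phi> x $ i"
  have f: "?f \<in> test_functions \<Omega>"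
    by (rule test_function_nth[OF assms])
  have t1: "(\<lambda>x. ?f x * partial_deriv j \<psi> x) \<in> test_functions \<Omega>"
    and t2: "(\<lambda>x. partial_deriv j ?f x * \<psi> x) \<in> test_functions \<Omega>"
    and t3: "(\<lambda>x. ?f x * \<psi> x) \<in> test_functions \<Omega>"
    using f \<psi> by (auto intro!: test_function_mult test_function_partial_deriv intro: test_function_Ck
        test_function_Ck[OF test_function_partial_deriv])
  have mf: "(\<lambda>x. rep_l2 (L2_of \<Omega> \<phi>) x $ i) \<in> borel_measurable lebesgue"
    by (rule borel_measurable_continuous_on[OF _ borel_measurable_rep_l2]) (intro continuous_intros)
  have mJ: "(\<lambda>x. rep_l2 (L2_of \<Omega> (classical_jacobian \<phi>)) x $ i $ j) \<in> borel_measurable lebesgue"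
    by (rule borel_measurable_continuous_on[OF _ borel_measurable_rep_l2]) (intro continuous_intros)
  have "(LINT x:\<Omega>|lebesgue. rep_l2 (L2_of \<Omega> \<phi>) x $ i * partial_deriv j \<psi> x)
      = (\<integral>x. rep_l2 (L2_of \<Omega> \<phi>) x $ i * partial_deriv j \<psi> x \<partial>lebesgue)"
    unfolding set_lebesgue_integral_def
    using test_function_indicator[OF test_function_partial_deriv[OF \<psi>]]
    by (intro Bochner_Integration.integral_cong) (auto simp: mult.left_commute)
  also have "\<dots> = (\<integral>x. ?f x * partial_deriv j \<psi> x \<partial>lebesgue)"
  proof (rule integral_cong_AE)
    show "AE x in lebesgue. rep_l2 (L2_of \<Omega> \<phi>) x $ i * partial_deriv j \<psi> x = ?f x * partial_deriv j \<psi> x"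
      using rep_L2_of_test_function[OF assms] by eventually_elim simp
  qed (intro borel_measurable_times mf borel_measurable_lebesgue_continuous
      test_function_continuous[OF f] test_function_continuous[OF test_function_partial_deriv[OF \<psi>]])+
  also have "\<dots> = - (\<integral>x. partial_deriv j ?f x * \<psi> x \<partial>lebesgue)"
  proof -
    have "partial_deriv j (\<lambda>x. ?f x * \<psi> x) = (\<lambda>x. ?f x * partial_deriv j \<psi> x + partial_deriv j ?f x * \<psi> x)"
      by (rule ext) (intro partial_deriv_mult test_function_differentiable[OF f] test_function_differentiable[OF \<psi>])
    then show ?thesis
      using integral_partial_deriv[OF t3, of j] integrable_lebesgue_test_function[OF t1]
        integrable_lebesgue_test_function[OF t2] by simp
  qed
  also have "(\<integral>x. partial_deriv j ?f x * \<psi> x \<partial>lebesgue)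
      = (\<integral>x. rep_l2 (L2_of \<Omega> (classical_jacobian \<phi>)) x $ i $ j * \<psi> x \<partial>lebesgue)"
  proof (rule integral_cong_AE)
    show "AE x in lebesgue. partial_deriv j ?f x * \<psi> x
        = rep_l2 (L2_of \<Omega> (classical_jacobian \<phi>)) x $ i $ j * \<psi> x"
      using rep_L2_of_test_function[OF J] by eventually_elim (simp add: classical_jacobian_def)
  qed (intro borel_measurable_times mJ borel_measurable_lebesgue_continuous
      test_function_continuous[OF \<psi>] test_function_continuous[OF test_function_partial_deriv[OF f]])+
  also have "\<dots> = (LINT x:\<Omega>|lebesgue. rep_l2 (L2_of \<Omega> (classical_jacobian \<phi>)) x $ i $ j * \<psi> x)"
    unfolding set_lebesgue_integral_def
    using test_function_indicator[OF \<psi>]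
    by (intro Bochner_Integration.integral_cong) (auto simp: mult.left_commute)
  finally show "(LINT x:\<Omega>|lebesgue. rep_l2 (L2_of \<Omega> \<phi>) x $ i * partial_deriv j \<psi> x)
      = - (LINT x:\<Omega>|lebesgue. rep_l2 (L2_of \<Omega> (classical_jacobian \<phi>)) x $ i $ j * \<psi> x)" .
qed

section \<open>The closure of the test functions in the product space\<close>

definition test_graph :: "(real^'n) set \<Rightarrow> ((real^'n, real^'n) l2 \<times> (real^'n, real^'n^'n) l2) set" where
  "test_graph \<Omega> = (\<lambda>\<phi>. (L2_of \<Omega> \<phi>, L2_of \<Omega> (classical_jacobian \<phi>))) ` test_functions \<Omega>"

lemma classical_jacobian_add:
  assumes "\<phi> \<in> test_functions \<Omega>" "\<psi> \<in> test_functions \<Omega>"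
  shows "classical_jacobian (\<lambda>x. \<phi> x + \<psi> x) = (\<lambda>x. classical_jacobian \<phi> x + classical_jacobian \<psi> x)"
proof -
  \<comment> \<open>The sum of two functions is read as a sum indexed by \<open>bool\<close>, which
    reduces it to \<open>partial_deriv_sum\<close>.\<close>
  have "partial_deriv j (\<lambda>x. \<phi> x $ i + \<psi> x $ i) x
      = partial_deriv j (\<lambda>x. \<phi> x $ i) x + partial_deriv j (\<lambda>x. \<psi> x $ i) x" for i j x
    using partial_deriv_sum[of UNIV "\<lambda>b. if b then (\<lambda>x. \<phi> x $ i) else (\<lambda>x. \<psi> x $ i)" x j]
      test_function_differentiable[OF test_function_nth[OF assms(1)]]
      test_function_differentiable[OF test_function_nth[OF assms(2)]]
    by (simp add: UNIV_bool add.commute)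
  then show ?thesis
    by (simp add: classical_jacobian_def fun_eq_iff vec_eq_iff)
qed

lemma classical_jacobian_scaleR:
  assumes "\<phi> \<in> test_functions \<Omega>"
  shows "classical_jacobian (\<lambda>x. c *\<^sub>R \<phi> x) = (\<lambda>x. c *\<^sub>R classical_jacobian \<phi> x)"
proof -
  have "partial_deriv j (\<lambda>x. c *\<^sub>R (\<phi> x $ i)) x = c *\<^sub>R partial_deriv j (\<lambda>x. \<phi> x $ i) x" for i j x
    by (rule partial_deriv_bounded_linear[OF test_function_differentiable[OF test_function_nth[OF assms]]
        bounded_linear_scaleR_right])
  then show ?thesis
    by (simp add: classical_jacobian_def fun_eq_iff vec_eq_iff)
qed

lemma square_integrable_indicator_test_function:
  fixes f :: "real^'n \<Rightarrow> 'b::euclidean_space"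
  shows "f \<in> test_functions \<Omega> \<Longrightarrow> square_integrable (\<lambda>x. indicator \<Omega> x *\<^sub>R f x)"
  by (simp add: test_function_indicator square_integrable_test_function)

lemma subspace_test_graph: "subspace (test_graph \<Omega>)"
proof (rule subspaceI)
  note si = square_integrable_indicator_test_function
  note J = classical_jacobian_test_function
  show add: "p + q \<in> test_graph \<Omega>" if pq: "p \<in> test_graph \<Omega>" "q \<in> test_graph \<Omega>" for p q
  proof -
    obtain \<phi> \<psi> where t: "\<phi> \<in> test_functions \<Omega>" "\<psi> \<in> test_functions \<Omega>"
      and "p = (L2_of \<Omega> \<phi>, L2_of \<Omega> (classical_jacobian \<phi>))"
      "q = (L2_of \<Omega> \<psi>, L2_of \<Omega> (classical_jacobian \<psi>))"
      using pq unfolding test_graph_def by blast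
    then have "p + q = (L2_of \<Omega> (\<lambda>x. \<phi> x + \<psi> x), L2_of \<Omega> (classical_jacobian (\<lambda>x. \<phi> x + \<psi> x)))"
      by (simp add: classical_jacobian_add[OF t] L2_of_add si J)
    then show ?thesis
      using test_function_add[OF t] by (auto simp: test_graph_def)
  qed
  show scale: "c *\<^sub>R p \<in> test_graph \<Omega>" if p: "p \<in> test_graph \<Omega>" for c p
  proof -
    obtain \<phi> where t: "\<phi> \<in> test_functions \<Omega>"
      and "p = (L2_of \<Omega> \<phi>, L2_of \<Omega> (classical_jacobian \<phi>))"
      using p unfolding test_graph_def by blast
    then have "c *\<^sub>R p = (L2_of \<Omega> (\<lambda>x. c *\<^sub>R \<phi> x), L2_of \<Omega> (classical_jacobian (\<lambda>x. c *\<^sub>R \<phi> x)))"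
      by (simp add: classical_jacobian_scaleR[OF t] L2_of_scaleR si J)
    then show ?thesis
      using test_function_bounded_linear[OF t bounded_linear_scaleR_right] by (auto simp: test_graph_def)
  qed
  have "test_graph \<Omega> \<noteq> {}"
    using test_function_zero by (auto simp: test_graph_def)
  then show "0 \<in> test_graph \<Omega>"
    using scale[of _ 0] by auto
qed

text \<open>The graph of the weak Jacobian is closed, so \<open>H10 \<Omega>\<close> is isometric, by \<open>v \<mapsto> (v, \<nabla>v)\<close>, to the
  following closed subspace of a product of Hilbert spaces.\<close>

definition H10_graph :: "(real^'n) set \<Rightarrow> ((real^'n, real^'n) l2 \<times> (real^'n, real^'n^'n) l2) set" where
  "H10_graph \<Omega> = closure (test_graph \<Omega>)"

lemma subspace_H10_graph: "subspace (H10_graph \<Omega>)"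
  unfolding H10_graph_def by (rule subspace_closure[OF subspace_test_graph])

lemma complete_H10_graph: "complete (H10_graph \<Omega>)"
  unfolding H10_graph_def by (simp add: complete_eq_closed)

text \<open>The graph of the weak Jacobian is closed and contains the test functions with their
  classical Jacobians, hence also the closure of these pairs.\<close>

lemma H10_graph_weak:
  assumes "open \<Omega>" "(v, G) \<in> H10_graph \<Omega>"
  shows "v \<in> L2 \<Omega>" "is_weak_jacobian \<Omega> v G"
proof -
  have "H10_graph \<Omega> \<subseteq> {(v, G). v \<in> L2 \<Omega> \<and> is_weak_jacobian \<Omega> v G}"
    unfolding H10_graph_def
    by (rule closure_minimal)
      (use assms(1) in \<open>auto simp: test_graph_def L2_of_test_function_in_L2 classical_jacobian_weak
        intro!: closed_weak_jacobian_graph\<close>)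
  then show "v \<in> L2 \<Omega>" "is_weak_jacobian \<Omega> v G"
    using assms(2) by auto
qed

lemma H10_graph_jacobian:
  assumes "open \<Omega>" "(v, G) \<in> H10_graph \<Omega>"
  shows "jacobian \<Omega> v = G"
  by (rule jacobian_eq[OF assms(1) H10_graph_weak(2)[OF assms]])

lemma H1_norm_eq: "H1_norm \<Omega> v = norm (v, jacobian \<Omega> v)"
  by (simp add: H1_norm_def norm_Pair)

text \<open>As weak Jacobians are unique and additive, \<open>H1_norm\<close> of \<open>v\<close>
  minus a test function is the product distance of the two graph points. Approximability in
  \<open>H1_norm\<close> is thus membership in the closure.\<close>

lemma mem_H10_iff:
  assumes "open \<Omega>"
  shows "v \<in> H10 \<Omega> \<longleftrightarrow> (v, jacobian \<Omega> v) \<in> H10_graph \<Omega>"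
proof -
  have \<Omega>: "\<Omega> \<in> sets lebesgue"
    using assms by simp
  have norm: "H1_norm \<Omega> (v - L2_of \<Omega> \<phi>) = dist (L2_of \<Omega> \<phi>, L2_of \<Omega> (classical_jacobian \<phi>)) (v, jacobian \<Omega> v)"
    if "is_weak_jacobian \<Omega> v (jacobian \<Omega> v)" "\<phi> \<in> test_functions \<Omega>" for \<phi>
    using jacobian_eq[OF assms is_weak_jacobian_diff[OF \<Omega> that(1) classical_jacobian_weak[OF that(2)]]]
    by (simp add: H1_norm_eq dist_commute dist_norm)
  have "v \<in> H10 \<Omega> \<longleftrightarrow> v \<in> L2 \<Omega> \<and> is_weak_jacobian \<Omega> v (jacobian \<Omega> v) \<and>
      (\<forall>e>0. \<exists>\<phi>\<in>test_functions \<Omega>. H1_norm \<Omega> (v - L2_of \<Omega> \<phi>) < e)"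
    using jacobian_eq[OF assms, of v] by (auto simp: H10_def H1_def)
  also have "\<dots> \<longleftrightarrow> v \<in> L2 \<Omega> \<and> is_weak_jacobian \<Omega> v (jacobian \<Omega> v) \<and> (v, jacobian \<Omega> v) \<in> H10_graph \<Omega>"
    by (simp add: H10_graph_def closure_approachable test_graph_def norm cong: conj_cong)
  also have "\<dots> \<longleftrightarrow> (v, jacobian \<Omega> v) \<in> H10_graph \<Omega>"
    using H10_graph_weak[OF assms, of v] by auto
  finally show ?thesis .
qed

lemma H10_graphD:
  assumes "open \<Omega>" "p \<in> H10_graph \<Omega>"
  shows "fst p \<in> H10 \<Omega>" "jacobian \<Omega> (fst p) = snd p"
  using assms H10_graph_jacobian[of \<Omega> "fst p" "snd p"] mem_H10_iff[of \<Omega> "fst p"] by auto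

text \<open>Adding the pairs inside the subspace yields membership and the formula for the Jacobian
  at once.\<close>

lemma
  assumes "open \<Omega>" "v \<in> H10 \<Omega>" "w \<in> H10 \<Omega>"
  shows H10_add: "v + w \<in> H10 \<Omega>" and jacobian_add: "jacobian \<Omega> (v + w) = jacobian \<Omega> v + jacobian \<Omega> w"
proof -
  have "(v, jacobian \<Omega> v) + (w, jacobian \<Omega> w) \<in> H10_graph \<Omega>"
    using assms by (intro subspace_add[OF subspace_H10_graph]) (simp_all add: mem_H10_iff)
  from H10_graphD[OF assms(1) this]
  show "v + w \<in> H10 \<Omega>" "jacobian \<Omega> (v + w) = jacobian \<Omega> v + jacobian \<Omega> w"
    by simp_all
qed

lemma
  assumes "open \<Omega>" "v \<in> H10 \<Omega>"
  shows H10_scaleR: "c *\<^sub>R v \<in> H10 \<Omega>" and jacobian_scaleR: "jacobian \<Omega> (c *\<^sub>R v) = c *\<^sub>R jacobian \<Omega> v"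
proof -
  have "c *\<^sub>R (v, jacobian \<Omega> v) \<in> H10_graph \<Omega>"
    using assms by (intro subspace_scale[OF subspace_H10_graph]) (simp add: mem_H10_iff)
  from H10_graphD[OF assms(1) this]
  show "c *\<^sub>R v \<in> H10 \<Omega>" "jacobian \<Omega> (c *\<^sub>R v) = c *\<^sub>R jacobian \<Omega> v"
    by simp_all
qed

subsection \<open>The operators of the bilinear form\<close>

lemma norm_sq_vec_eq_sum: "(norm (x :: 'b::real_inner^'n))\<^sup>2 = (\<Sum>i\<in>UNIV. (norm (x $ i))\<^sup>2)"
  by (simp add: power2_norm_eq_inner inner_vec_def)

text \<open>Cauchy-Schwarz row by row; the norm of \<open>real^'n^'m\<close> is the Frobenius
  norm.\<close>

lemma norm_matrix_vector_mult_le: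
  fixes M :: "real^'n^'m"
  shows "norm (M *v y) \<le> norm M * norm y"
proof (rule power2_le_imp_le)
  have "(norm (M *v y))\<^sup>2 = (\<Sum>i\<in>UNIV. (inner (M $ i) y)\<^sup>2)"
    by (simp add: norm_sq_vec_eq_sum matrix_vector_mul_component)
  also have "\<dots> \<le> (\<Sum>i\<in>UNIV. (norm (M $ i))\<^sup>2 * (norm y)\<^sup>2)"
    using Cauchy_Schwarz_ineq[of "M $ i" y for i] by (intro sum_mono) (simp add: power2_norm_eq_inner)
  also have "\<dots> = (norm M * norm y)\<^sup>2"
    by (simp add: norm_sq_vec_eq_sum[of M] sum_distrib_right power_mult_distrib)
  finally show "(norm (M *v y))\<^sup>2 \<le> (norm M * norm y)\<^sup>2" .
qed simp

text \<open>\<open>C\<close> is an essential bound of \<open>b\<close>. For measurability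
  \<open>b\<close> is first extended by 0 outside \<Omega>, which makes it measurable on the whole
  space.\<close>

lemma pointwise_operator_advection:
  fixes \<Omega> :: "(real^'n) set" and b :: "real^'n \<Rightarrow> real^'n"
  assumes \<Omega>: "\<Omega> \<in> sets lebesgue" and b: "b \<in> Linfty \<Omega>"
  obtains C where "pointwise_operator \<Omega> (\<lambda>x M. M *v b x :: real^'n) C"
proof -
  obtain C where C: "AE x in lebesgue_on \<Omega>. norm (b x) \<le> C"
    and m: "b \<in> borel_measurable (lebesgue_on \<Omega>)"
    using b by (auto simp: Linfty_def)
  have "pointwise_operator \<Omega> (\<lambda>x M. M *v b x :: real^'n) C"
  proof (rule pointwise_operator.intro)
    show "linear (\<lambda>M. M *v b x :: real^'n)" for x
      by (rule linearI) (simp_all add: matrix_vector_mult_add_rdistrib scaleR_matrix_vector_assoc)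
    have "AE x in lebesgue. x \<in> \<Omega> \<longrightarrow> norm (b x) \<le> C"
      using C \<Omega> by (simp add: AE_restrict_space_iff)
    then show "AE x in lebesgue. x \<in> \<Omega> \<longrightarrow> (\<forall>M. norm (M *v b x :: real^'n) \<le> C * norm M)"
    proof eventually_elim
      case (elim x)
      have "norm (M *v b x :: real^'n) \<le> C * norm M" if "x \<in> \<Omega>" for M
        using norm_matrix_vector_mult_le[of M "b x"] mult_right_mono[of "norm (b x)" C "norm M"] elim that
        by (simp add: mult.commute)
      then show ?case
        by blast
    qed
    fix f :: "real^'n \<Rightarrow> real^'n^'n" assume f: "f \<in> borel_measurable lebesgue"
    have "(\<lambda>x. indicator \<Omega> x *\<^sub>R b x) \<in> borel_measurable lebesgue"
      using m \<Omega> by (simp add: borel_measurable_restrict_space_iff)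
    then have "(\<lambda>x. f x *v (indicator \<Omega> x *\<^sub>R b x)) \<in> borel_measurable lebesgue"
      by (rule borel_measurable_continuous_Pair[OF f])
        (auto simp: matrix_vector_mult_def intro!: continuous_intros)
    then show "(\<lambda>x. indicator \<Omega> x *\<^sub>R (f x *v b x)) \<in> borel_measurable lebesgue"
      by (simp add: matrix_vector_mult_scaleR)
  qed
  then show ?thesis
    by (rule that)
qed

lemma linear_viscous: "linear (\<lambda>M :: real^'n^'n. \<nu> *\<^sub>R (M + transpose M))"
  by (rule linearI) (auto simp: transpose_def vec_eq_iff algebra_simps)

lemma linear_trace: "linear (trace :: real^'n^'n \<Rightarrow> real)"
  by (rule linearI) (auto simp: trace_def sum.distrib sum_distrib_left)

lemma linear_scaled_mat_1: "linear (\<lambda>y :: real. y *\<^sub>R (mat 1 :: real^'n^'n))"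
  by (rule linearI) (auto simp: algebra_simps)

text \<open>This makes the adjoint of the trace the map from \<open>y\<close> to \<open>y\<close>
  times the identity, and so \<open>pressure\<close> the adjoint of
  \<open>divergence\<close>.\<close>

lemma trace_eq_inner_mat_1: "trace (M :: real^'n^'n) = inner (mat 1) M"
proof -
  have "(\<Sum>j\<in>UNIV. (if i = j then 1 else 0) * M $ i $ j) = M $ i $ i" for i
    by (subst sum.remove[of _ i]) (auto intro: sum.neutral)
  then show ?thesis
    by (simp add: trace_def inner_vec_def mat_def)
qed

subsection \<open>Estimates on test functions\<close>

context
  fixes \<Omega> :: "(real^'n) set" and \<phi> :: "real^'n \<Rightarrow> real^'n"
  assumes \<phi>: "\<phi> \<in> test_functions \<Omega>"
begin

private lemma deriv_test: "partial_deriv j (\<lambda>x. \<phi> x $ i) \<in> test_functions \<Omega>"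
  by (intro test_function_partial_deriv test_function_nth \<phi>)

private lemma deriv_mult_test:
  "(\<lambda>x. partial_deriv j (\<lambda>x. \<phi> x $ i) x * partial_deriv k (\<lambda>x. \<phi> x $ l) x) \<in> test_functions \<Omega>"
  by (intro test_function_mult test_function_Ck[OF deriv_test] deriv_test)

text \<open>In each product of the derivative in direction i of component j and the derivative in
  direction j of component i, the two directions are exchanged under the integral. What results is
  the product of two diagonal entries of the Jacobian.\<close>

lemma korn_identity:
  "(\<integral>x. inner (transpose (classical_jacobian \<phi> x)) (classical_jacobian \<phi> x) \<partial>lebesgue)
     = (\<integral>x. (trace (classical_jacobian \<phi> x))\<^sup>2 \<partial>lebesgue)"
proof -
  let ?D = "\<lambda>i j. partial_deriv j (\<lambda>x. \<phi> x $ i)"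
  have int: "integrable lebesgue (\<lambda>x. ?D i j x * ?D k l x)" for i j k l
    by (rule integrable_lebesgue_test_function[OF deriv_mult_test])
  have "(\<integral>x. inner (transpose (classical_jacobian \<phi> x)) (classical_jacobian \<phi> x) \<partial>lebesgue)
      = (\<integral>x. (\<Sum>i\<in>UNIV. \<Sum>j\<in>UNIV. ?D j i x * ?D i j x) \<partial>lebesgue)"
    by (simp add: inner_vec_def transpose_def classical_jacobian_def)
  also have "\<dots> = (\<Sum>i\<in>UNIV. \<Sum>j\<in>UNIV. \<integral>x. ?D j i x * ?D i j x \<partial>lebesgue)"
    by (simp add: int)
  also have "\<dots> = (\<Sum>i\<in>UNIV. \<Sum>j\<in>UNIV. \<integral>x. ?D i i x * ?D j j x \<partial>lebesgue)"
    by (intro sum.cong refl, subst integral_partial_deriv_swap[OF test_function_nth[OF \<phi>] test_function_nth[OF \<phi>]])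
      (simp add: mult.commute)
  also have "\<dots> = (\<integral>x. (\<Sum>i\<in>UNIV. \<Sum>j\<in>UNIV. ?D i i x * ?D j j x) \<partial>lebesgue)"
    by (simp add: int)
  also have "\<dots> = (\<integral>x. (trace (classical_jacobian \<phi> x))\<^sup>2 \<partial>lebesgue)"
    by (simp add: trace_def classical_jacobian_def power2_eq_square sum_product)
  finally show ?thesis .
qed

text \<open>The squared length is written as a polynomial in the components, which shows that it is
  a test function.\<close>

private abbreviation "sq \<equiv> \<lambda>x. \<Sum>i\<in>UNIV. \<phi> x $ i * \<phi> x $ i"

private lemma sq_eq: "sq x = (norm (\<phi> x))\<^sup>2"
  by (simp add: power2_norm_eq_inner inner_vec_def)

private lemma sq_test: "sq \<in> test_functions \<Omega>"
  by (intro test_function_sum test_function_mult test_function_Ck[OF test_function_nth[OF \<phi>]] test_function_nth[OF \<phi>])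

private lemma partial_deriv_sq:
  "partial_deriv j sq x = 2 * (\<Sum>i\<in>UNIV. \<phi> x $ i * partial_deriv j (\<lambda>x. \<phi> x $ i) x)"
proof -
  have d: "(\<lambda>x. \<phi> x $ i) differentiable (at x)" for i
    by (rule test_function_differentiable[OF test_function_nth[OF \<phi>]])
  have "partial_deriv j sq x = (\<Sum>i\<in>UNIV. partial_deriv j (\<lambda>x. \<phi> x $ i * \<phi> x $ i) x)"
    by (rule partial_deriv_sum) (intro differentiable_mult d)
  also have "\<dots> = 2 * (\<Sum>i\<in>UNIV. \<phi> x $ i * partial_deriv j (\<lambda>x. \<phi> x $ i) x)"
    by (simp add: partial_deriv_mult[OF d d] sum_distrib_left algebra_simps)
  finally show ?thesis .
qed

lemma advection_skew:
  assumes "weakly_divergence_free \<Omega> b"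
  shows "(LINT x:\<Omega>|lebesgue. inner (classical_jacobian \<phi> x *v b x) (\<phi> x)) = 0"
proof -
  have eq: "inner (classical_jacobian \<phi> x *v b x) (\<phi> x) = (\<Sum>j\<in>UNIV. b x $ j * partial_deriv j sq x) / 2" for x
  proof -
    have "inner (classical_jacobian \<phi> x *v b x) (\<phi> x)
        = (\<Sum>i\<in>UNIV. \<Sum>j\<in>UNIV. b x $ j * (\<phi> x $ i * partial_deriv j (\<lambda>x. \<phi> x $ i) x))"
      by (simp add: inner_vec_def matrix_vector_mult_def classical_jacobian_def sum_distrib_left
          sum_distrib_right mult_ac)
    also have "\<dots> = (\<Sum>j\<in>UNIV. \<Sum>i\<in>UNIV. b x $ j * (\<phi> x $ i * partial_deriv j (\<lambda>x. \<phi> x $ i) x))"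
      by (rule sum.swap)
    also have "\<dots> = (\<Sum>j\<in>UNIV. b x $ j * partial_deriv j sq x) / 2"
      by (simp add: partial_deriv_sq sum_distrib_left sum_divide_distrib)
    finally show ?thesis .
  qed
  have "(LINT x:\<Omega>|lebesgue. inner (classical_jacobian \<phi> x *v b x) (\<phi> x))
      = (LINT x:\<Omega>|lebesgue. (\<Sum>j\<in>UNIV. b x $ j * partial_deriv j sq x)) / 2"
    unfolding eq set_lebesgue_integral_def by simp
  also have "\<dots> = 0"
    using assms sq_test unfolding weakly_divergence_free_def by (simp only: div_0)
  finally show ?thesis .
qed

text \<open>Poincare's inequality comes from \<open>\<integral> \<partial>\<^sub>k (x\<^sub>k \<bar>\<phi>\<bar>\<^sup>2) = 0\<close>.\<close>

lemma poincare:
  assumes R: "\<And>x. x \<in> \<Omega> \<Longrightarrow> norm x \<le> R"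
  shows "(\<integral>x. (norm (\<phi> x))\<^sup>2 \<partial>lebesgue) \<le> 4 * R\<^sup>2 * (\<integral>x. (norm (classical_jacobian \<phi> x))\<^sup>2 \<partial>lebesgue)"
proof -
  \<comment> \<open>Any coordinate direction will do.\<close>
  obtain k :: 'n where True
    by simp
  let ?J = "classical_jacobian \<phi>"
  let ?h = "\<lambda>x. x $ k * (2 * (\<Sum>i\<in>UNIV. \<phi> x $ i * partial_deriv k (\<lambda>x. \<phi> x $ i) x))"
  have h_test: "?h \<in> test_functions \<Omega>"
    using test_function_mult[OF Ck_nth test_function_partial_deriv[OF sq_test, of k], of k]
    unfolding partial_deriv_sq .
  have p_test: "(\<lambda>x. x $ k * sq x) \<in> test_functions \<Omega>"
    by (rule test_function_mult[OF Ck_nth sq_test])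
  have "partial_deriv k (\<lambda>x. x $ k * sq x) x = ?h x + sq x" for x
    by (subst partial_deriv_mult)
      (simp_all add: partial_deriv_sq partial_deriv_nth test_function_differentiable[OF sq_test]
        bounded_linear_imp_differentiable bounded_linear_vec_nth)
  with integral_partial_deriv[OF p_test, of k]
  have "(\<integral>x. ?h x + sq x \<partial>lebesgue) = 0"
    by simp
  moreover have sq_int: "integrable lebesgue sq" and h_int: "integrable lebesgue ?h"
    by (rule integrable_lebesgue_test_function[OF sq_test] integrable_lebesgue_test_function[OF h_test])+
  ultimately have 1: "(\<integral>x. sq x \<partial>lebesgue) = (\<integral>x. - ?h x \<partial>lebesgue)"
    by simp
  have J_int: "integrable lebesgue (\<lambda>x. (norm (?J x))\<^sup>2)"
    using square_integrable_test_function[OF classical_jacobian_test_function[OF \<phi>]]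
    by (simp add: square_integrable_def)
  \<comment> \<open>Young's inequality with the weight 1/2 on \<open>sq\<close>: that half is later
    absorbed on the left, which doubles \<open>2 * R\<^sup>2\<close> to the constant 4 of the
    statement. Only column \<open>k\<close> of the Jacobian enters, and it is bounded by the full
    norm.\<close>
  have "- ?h x \<le> sq x / 2 + 2 * R\<^sup>2 * (norm (?J x))\<^sup>2" for x
  proof (cases "x \<in> \<Omega>")
    case False
    show ?thesis
      unfolding test_function_outside[OF h_test False] test_function_outside[OF sq_test False] by simp
  next
    case True
    have xk: "(x $ k)\<^sup>2 \<le> R\<^sup>2"
      using component_le_norm_cart[of x k] R[OF True] by (intro abs_le_square_iff[THEN iffD1]) auto
    have "- ?h x = (\<Sum>i\<in>UNIV. - (2 * x $ k * \<phi> x $ i * (?J x $ i $ k)))"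
      by (simp add: sum_distrib_left sum_negf classical_jacobian_def mult.assoc mult.left_commute)
    also have "\<dots> \<le> (\<Sum>i\<in>UNIV. \<phi> x $ i * \<phi> x $ i / 2 + 2 * R\<^sup>2 * (?J x $ i $ k)\<^sup>2)"
    proof (rule sum_mono)
      fix i
      \<comment> \<open>Expanding this square gives exactly the Young inequality needed for
        component \<open>i\<close>.\<close>
      have "0 \<le> (\<phi> x $ i + 2 * x $ k * (?J x $ i $ k))\<^sup>2 / 2"
        by simp
      then have "- (2 * x $ k * \<phi> x $ i * (?J x $ i $ k)) \<le>
          \<phi> x $ i * \<phi> x $ i / 2 + 2 * ((x $ k)\<^sup>2 * (?J x $ i $ k)\<^sup>2)"
        by (simp add: power2_eq_square algebra_simps)
      also have "\<dots> \<le> \<phi> x $ i * \<phi> x $ i / 2 + 2 * (R\<^sup>2 * (?J x $ i $ k)\<^sup>2)"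
        by (intro add_left_mono mult_left_mono mult_right_mono xk) auto
      finally show "- (2 * x $ k * \<phi> x $ i * (?J x $ i $ k)) \<le>
          \<phi> x $ i * \<phi> x $ i / 2 + 2 * R\<^sup>2 * (?J x $ i $ k)\<^sup>2"
        by simp
    qed
    also have "\<dots> = sq x / 2 + 2 * R\<^sup>2 * (\<Sum>i\<in>UNIV. (?J x $ i $ k)\<^sup>2)"
      by (simp add: sum.distrib sum_distrib_left sum_divide_distrib)
    also have "\<dots> \<le> sq x / 2 + 2 * R\<^sup>2 * (norm (?J x))\<^sup>2"
    proof -
      have "(\<Sum>i\<in>UNIV. (?J x $ i $ k)\<^sup>2) \<le> (\<Sum>i\<in>UNIV. (norm (?J x $ i))\<^sup>2)"
        using component_le_norm_cart[of "?J x $ i" k for i]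
        by (intro sum_mono) (metis abs_norm_cancel abs_le_square_iff)
      then show ?thesis
        by (intro add_left_mono mult_left_mono) (simp_all add: norm_sq_vec_eq_sum[of "?J x"])
    qed
    finally show ?thesis .
  qed
  then have "(\<integral>x. - ?h x \<partial>lebesgue) \<le> (\<integral>x. sq x / 2 + 2 * R\<^sup>2 * (norm (?J x))\<^sup>2 \<partial>lebesgue)"
    by (intro integral_mono Bochner_Integration.integrable_add integrable_mult_right J_int
        integrable_minus h_int integrable_divide sq_int)
  also have "\<dots> = (\<integral>x. sq x \<partial>lebesgue) / 2 + 2 * R\<^sup>2 * (\<integral>x. (norm (?J x))\<^sup>2 \<partial>lebesgue)"
    by (subst Bochner_Integration.integral_add) (simp_all add: sq_int J_int)
  finally have "(\<integral>x. sq x \<partial>lebesgue) \<le> (\<integral>x. sq x \<partial>lebesgue) / 2 + 2 * R\<^sup>2 * (\<integral>x. (norm (?J x))\<^sup>2 \<partial>lebesgue)"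
    using 1 by simp
  then show ?thesis
    unfolding sq_eq by simp
qed

end

subsection \<open>The variational problem\<close>

text \<open>The facts of the locale, restated with \<open>L2_of\<close> in place of
  \<open>lifted\<close>, the form in which \<open>A11\<close> and \<open>A21\<close> contain these
  operators.\<close>

lemma
  assumes "pointwise_operator \<Omega> h C"
  shows bounded_linear_pointwise: "bounded_linear (\<lambda>G. L2_of \<Omega> (\<lambda>x. h x (rep_l2 G x)))"
    and rep_pointwise: "AE x in lebesgue. rep_l2 (L2_of \<Omega> (\<lambda>x. h x (rep_l2 G x))) x = indicator \<Omega> x *\<^sub>R h x (rep_l2 G x)"
    and pointwise_in_L2: "L2_of \<Omega> (\<lambda>x. h x (rep_l2 G x)) \<in> L2 \<Omega>"
    and measurable_pointwise: "(\<lambda>x. indicator \<Omega> x *\<^sub>R h x (rep_l2 G x)) \<in> borel_measurable lebesgue"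
proof -
  interpret pointwise_operator \<Omega> h C
    by (rule assms)
  show "bounded_linear (\<lambda>G. L2_of \<Omega> (\<lambda>x. h x (rep_l2 G x)))"
    using bounded_linear_lifted by (simp add: lifted_def[abs_def])
  show "AE x in lebesgue. rep_l2 (L2_of \<Omega> (\<lambda>x. h x (rep_l2 G x))) x = indicator \<Omega> x *\<^sub>R h x (rep_l2 G x)"
    using rep_lifted by (simp add: lifted_def)
  show "L2_of \<Omega> (\<lambda>x. h x (rep_l2 G x)) \<in> L2 \<Omega>"
    using lifted_in_L2 by (simp add: lifted_def)
  show "(\<lambda>x. indicator \<Omega> x *\<^sub>R h x (rep_l2 G x)) \<in> borel_measurable lebesgue"
    by (rule measurable[OF borel_measurable_rep_l2])
qed

text \<open>The setting of the Oseen problem, the Navier-Stokes equations linearized at the flow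
  field \<open>b\<close>.\<close>

locale oseen =
  fixes \<Omega> :: "(real^'n) set" and \<nu> :: real and b :: "real^'n \<Rightarrow> real^'n"
  assumes open_\<Omega>: "open \<Omega>" and bounded_\<Omega>: "bounded \<Omega>" and \<nu>_pos: "\<nu> > 0"
    and b_Linfty: "b \<in> Linfty \<Omega>" and b_div_free: "weakly_divergence_free \<Omega> b"
begin

lemma sets_\<Omega>: "\<Omega> \<in> sets lebesgue"
  using open_\<Omega> by simp

section \<open>The operators on the product space\<close>

definition viscous :: "(real^'n, real^'n^'n) l2 \<Rightarrow> (real^'n, real^'n^'n) l2" where
  "viscous G = L2_of \<Omega> (\<lambda>x. \<nu> *\<^sub>R (rep_l2 G x + transpose (rep_l2 G x)))"

definition advection :: "(real^'n, real^'n^'n) l2 \<Rightarrow> (real^'n, real^'n) l2" where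
  "advection G = L2_of \<Omega> (\<lambda>x. rep_l2 G x *v b x)"

definition divergence :: "(real^'n, real^'n^'n) l2 \<Rightarrow> (real^'n, real) l2" where
  "divergence G = L2_of \<Omega> (\<lambda>x. trace (rep_l2 G x))"

text \<open>The adjoint of \<open>divergence\<close>; it turns the pairing of \<open>P\<close> with
  a divergence into an inner product with the Jacobian.\<close>

definition pressure :: "(real^'n, real) l2 \<Rightarrow> (real^'n, real^'n^'n) l2" where
  "pressure P = L2_of \<Omega> (\<lambda>x. rep_l2 P x *\<^sub>R mat 1)"

lemmas viscous_op = pointwise_operator_const[OF linear_viscous[of \<nu>] sets_\<Omega>]
lemmas divergence_op = pointwise_operator_const[OF linear_trace sets_\<Omega>]
lemmas pressure_op = pointwise_operator_const[OF linear_scaled_mat_1 sets_\<Omega>]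

lemma bounded_linear_viscous: "bounded_linear viscous"
  unfolding viscous_def[abs_def] by (rule bounded_linear_pointwise[OF viscous_op])

lemma bounded_linear_advection: "bounded_linear advection"
  using pointwise_operator_advection[OF sets_\<Omega> b_Linfty] bounded_linear_pointwise
  unfolding advection_def[abs_def] by blast

lemma bounded_linear_divergence: "bounded_linear divergence"
  unfolding divergence_def[abs_def] by (rule bounded_linear_pointwise[OF divergence_op])

lemma bounded_linear_pressure: "bounded_linear pressure"
  unfolding pressure_def[abs_def] by (rule bounded_linear_pointwise[OF pressure_op])

lemma divergence_in_L2: "divergence G \<in> L2 \<Omega>"
  unfolding divergence_def by (rule pointwise_in_L2[OF divergence_op])

lemma inner_divergence: "inner P (divergence G) = inner (pressure P) G"
proof -
  have "inner P (divergence G) = (\<integral>x. inner (rep_l2 P x) (indicator \<Omega> x *\<^sub>R trace (rep_l2 G x)) \<partial>lebesgue)"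
    unfolding divergence_def
    by (rule inner_l2_AE[OF AE_I2[OF refl] rep_pointwise[OF divergence_op]
          borel_measurable_rep_l2 measurable_pointwise[OF divergence_op]])
  also have "\<dots> = (\<integral>x. inner (indicator \<Omega> x *\<^sub>R (rep_l2 P x *\<^sub>R mat 1)) (rep_l2 G x) \<partial>lebesgue)"
    by (simp add: trace_eq_inner_mat_1 mult_ac)
  also have "\<dots> = inner (pressure P) G"
    unfolding pressure_def
    by (rule inner_l2_AE[OF rep_pointwise[OF pressure_op] AE_I2[OF refl]
          measurable_pointwise[OF pressure_op] borel_measurable_rep_l2, symmetric])
  finally show ?thesis .
qed

text \<open>\<open>A11\<close> represented by an operator on the whole product space: the first
  component is paired with the test field, the second with its Jacobian.\<close>

definition form :: "(real^'n, real^'n) l2 \<times> (real^'n, real^'n^'n) l2 \<Rightarrow> (real^'n, real^'n) l2 \<times> (real^'n, real^'n^'n) l2" where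
  "form p = (advection (snd p), viscous (snd p))"

definition load :: "(real^'n, real) l2 \<Rightarrow> (real^'n, real^'n) l2 \<times> (real^'n, real^'n^'n) l2" where
  "load P = (0, - pressure P)"

lemma bounded_linear_load: "bounded_linear load"
  unfolding load_def[abs_def]
  by (intro bounded_linear_Pair bounded_linear_zero bounded_linear_minus bounded_linear_pressure)

lemma bounded_linear_form: "bounded_linear form"
  unfolding form_def[abs_def]
  by (intro bounded_linear_Pair bounded_linear_compose[OF bounded_linear_advection]
      bounded_linear_compose[OF bounded_linear_viscous] bounded_linear_snd)

lemma A11_eq:
  "v \<in> H10 \<Omega> \<Longrightarrow> w \<in> H10 \<Omega> \<Longrightarrow> A11 \<Omega> \<nu> b v w = inner (form (v, jacobian \<Omega> v)) (w, jacobian \<Omega> w)"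
  by (simp add: A11_def form_def viscous_def advection_def)

lemma A21_eq: "w \<in> H10 \<Omega> \<Longrightarrow> A21 \<Omega> w = divergence (jacobian \<Omega> w)"
  by (simp add: A21_def divergence_def)

lemma A12_eq:
  "P \<in> L2 \<Omega> \<Longrightarrow> w \<in> H10 \<Omega> \<Longrightarrow> A12 \<Omega> P w = inner (load P) (w, jacobian \<Omega> w)"
  by (simp add: A12_def A21_eq inner_divergence load_def)

lemma inner_L2_of_test_functions:
  fixes f g :: "real^'n \<Rightarrow> 'b::euclidean_space"
  assumes "f \<in> test_functions \<Omega>" "g \<in> test_functions \<Omega>"
  shows "inner (L2_of \<Omega> f) (L2_of \<Omega> g) = (\<integral>x. inner (f x) (g x) \<partial>lebesgue)"
  by (rule inner_l2_AE)
    (auto intro: rep_L2_of_test_function assms borel_measurable_lebesgue_continuous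
      test_function_continuous[OF assms(1)] test_function_continuous[OF assms(2)])

text \<open>By \<open>korn_identity\<close> the transposed part contributes \<nu> times the integral
  of the squared divergence, which is nonnegative, so the coercivity constant is \<nu>
  itself.\<close>

lemma viscous_test_function:
  assumes \<phi>: "\<phi> \<in> test_functions \<Omega>"
  defines "G \<equiv> L2_of \<Omega> (classical_jacobian \<phi>)"
  shows "\<nu> * (norm G)\<^sup>2 \<le> inner (viscous G) G"
proof -
  let ?J = "classical_jacobian \<phi>"
  note si = square_integrable_indicator_test_function
  have J: "?J \<in> test_functions \<Omega>"
    by (rule classical_jacobian_test_function[OF \<phi>])
  have JT: "(\<lambda>x. transpose (?J x)) \<in> test_functions \<Omega>"
    by (rule test_function_bounded_linear[OF J])
      (auto simp: linear_conv_bounded_linear[symmetric] transpose_def vec_eq_iff intro!: linearI)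
  have "viscous G = L2_of \<Omega> (\<lambda>x. \<nu> *\<^sub>R (?J x + transpose (?J x)))"
  proof (rule l2_eqI)
    have t: "(\<lambda>x. \<nu> *\<^sub>R (?J x + transpose (?J x))) \<in> test_functions \<Omega>"
      by (rule test_function_bounded_linear[OF test_function_add[OF J JT] bounded_linear_scaleR_right])
    show "AE x in lebesgue. rep_l2 (viscous G) x = rep_l2 (L2_of \<Omega> (\<lambda>x. \<nu> *\<^sub>R (?J x + transpose (?J x)))) x"
      using rep_pointwise[OF viscous_op, of G] rep_L2_of_test_function[OF J] rep_L2_of_test_function[OF t]
      unfolding viscous_def G_def
    proof eventually_elim
      case (elim x)
      then show ?case
        using test_function_indicator[OF t, of x] by simp
    qed
  qed
  also have "\<dots> = \<nu> *\<^sub>R (G + L2_of \<Omega> (\<lambda>x. transpose (?J x)))"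
    unfolding G_def
    by (subst L2_of_scaleR[OF si[OF test_function_add[OF J JT]]], subst L2_of_add[OF si[OF J] si[OF JT]])
      (rule refl)
  finally have "inner (viscous G) G = \<nu> * ((norm G)\<^sup>2 + inner (L2_of \<Omega> (\<lambda>x. transpose (?J x))) G)"
    by (simp add: inner_add_left power2_norm_eq_inner)
  moreover have "inner (L2_of \<Omega> (\<lambda>x. transpose (?J x))) G = (\<integral>x. (trace (?J x))\<^sup>2 \<partial>lebesgue)"
    unfolding G_def by (simp add: inner_L2_of_test_functions[OF JT J] korn_identity[OF \<phi>])
  ultimately show ?thesis
    using \<nu>_pos by simp
qed

lemma advection_test_function:
  assumes \<phi>: "\<phi> \<in> test_functions \<Omega>"
  shows "inner (advection (L2_of \<Omega> (classical_jacobian \<phi>))) (L2_of \<Omega> \<phi>) = 0"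
proof -
  obtain C where op: "pointwise_operator \<Omega> (\<lambda>x M. M *v b x :: real^'n) C"
    using pointwise_operator_advection[OF sets_\<Omega> b_Linfty] .
  let ?G = "L2_of \<Omega> (classical_jacobian \<phi>)"
  have "inner (advection ?G) (L2_of \<Omega> \<phi>)
      = (LINT x:\<Omega>|lebesgue. inner (rep_l2 (advection ?G) x) (\<phi> x))"
    by (rule inner_L2_of_test_function[OF \<phi>])
  also have "\<dots> = (LINT x:\<Omega>|lebesgue. inner (classical_jacobian \<phi> x *v b x) (\<phi> x))"
    unfolding set_lebesgue_integral_def
  proof (rule integral_cong_AE)
    have m: "\<phi> \<in> borel_measurable lebesgue"
      by (intro borel_measurable_lebesgue_continuous test_function_continuous[OF \<phi>])
    show *: "AE x in lebesgue. indicator \<Omega> x *\<^sub>R inner (rep_l2 (advection ?G) x) (\<phi> x)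
        = indicator \<Omega> x *\<^sub>R inner (classical_jacobian \<phi> x *v b x) (\<phi> x)"
      using rep_pointwise[OF op, of ?G] rep_L2_of_test_function[OF classical_jacobian_test_function[OF \<phi>]]
      unfolding advection_def by eventually_elim (simp add: indicator_def)
    show "(\<lambda>x. indicator \<Omega> x *\<^sub>R inner (rep_l2 (advection ?G) x) (\<phi> x)) \<in> borel_measurable lebesgue"
      using sets_\<Omega> m by measurable
    \<comment> \<open>The product with \<open>b\<close> has to carry the indicator, as
      \<open>b\<close> is measurable on \<Omega> only.\<close>
    have "(\<lambda>x. indicator \<Omega> x *\<^sub>R (classical_jacobian \<phi> x *v b x)) \<in> borel_measurable lebesgue"
      by (rule pointwise_operator.measurable[OF op])
        (intro borel_measurable_lebesgue_continuous test_function_continuous[OF classical_jacobian_test_function[OF \<phi>]])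
    from borel_measurable_inner[OF this m]
    show "(\<lambda>x. indicator \<Omega> x *\<^sub>R inner (classical_jacobian \<phi> x *v b x) (\<phi> x)) \<in> borel_measurable lebesgue"
      by simp
  qed
  also have "\<dots> = 0"
    by (rule advection_skew[OF \<phi> b_div_free])
  finally show ?thesis .
qed

lemma form_coercive:
  obtains c where "c > 0" "\<And>p. p \<in> H10_graph \<Omega> \<Longrightarrow> c * (norm p)\<^sup>2 \<le> inner (form p) p"
proof -
  obtain R where R: "\<And>x. x \<in> \<Omega> \<Longrightarrow> norm x \<le> R"
    using bounded_\<Omega> by (auto simp: bounded_iff)
  \<comment> \<open>Poincare's inequality bounds the squared norm of a pair by
    \<open>1 + 4 * R\<^sup>2\<close> times that of its Jacobian component, and the form is at least
    \<nu> times the latter.\<close>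
  define c where "c = \<nu> / (1 + 4 * R\<^sup>2)"
  have pos: "1 + 4 * R\<^sup>2 > 0"
    by (simp add: add_pos_nonneg)
  have "c > 0"
    using \<nu>_pos pos by (simp add: c_def)
  have test: "c * (norm p)\<^sup>2 \<le> inner (form p) p" if "p \<in> test_graph \<Omega>" for p
  proof -
    obtain \<phi> where \<phi>: "\<phi> \<in> test_functions \<Omega>"
      and p: "p = (L2_of \<Omega> \<phi>, L2_of \<Omega> (classical_jacobian \<phi>))"
      using \<open>p \<in> test_graph \<Omega>\<close> by (auto simp: test_graph_def)
    note J = classical_jacobian_test_function[OF \<phi>]
    have "(norm (fst p))\<^sup>2 \<le> 4 * R\<^sup>2 * (norm (snd p))\<^sup>2"
      using poincare[OF \<phi> R] unfolding power2_norm_eq_inner p fst_conv snd_conv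
      by (simp add: inner_L2_of_test_functions \<phi> J)
    then have "c * (norm p)\<^sup>2 \<le> c * ((1 + 4 * R\<^sup>2) * (norm (snd p))\<^sup>2)"
      using \<open>c > 0\<close> by (intro mult_left_mono) (simp_all add: norm_prod_def algebra_simps)
    also have "\<dots> = \<nu> * (norm (snd p))\<^sup>2"
      using pos by (simp add: c_def)
    also have "\<dots> \<le> inner (form p) p"
      using viscous_test_function[OF \<phi>] advection_test_function[OF \<phi>] by (simp add: form_def p)
    finally show ?thesis .
  qed
  \<comment> \<open>Both sides are continuous; for the right one this uses that advection by the
    essentially bounded \<open>b\<close> is bounded on \<open>l2\<close>.\<close>
  have "closed {p. c * (norm p)\<^sup>2 \<le> inner (form p) p}"
    by (intro closed_Collect_le continuous_intros bounded_linear.continuous_on[OF bounded_linear_form])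
  then have "H10_graph \<Omega> \<subseteq> {p. c * (norm p)\<^sup>2 \<le> inner (form p) p}"
    unfolding H10_graph_def using test by (intro closure_minimal) auto
  with \<open>c > 0\<close> show ?thesis
    by (intro that[of c]) auto
qed

section \<open>Unique solvability, linearity and stability of the variational problem\<close>

definition solves :: "(real^'n, real) l2 \<Rightarrow> (real^'n, real^'n) l2 \<times> (real^'n, real^'n^'n) l2 \<Rightarrow> bool" where
  "solves P u \<longleftrightarrow> u \<in> H10_graph \<Omega> \<and> (\<forall>s\<in>H10_graph \<Omega>. inner (form u) s = inner (load P) s)"

definition solution :: "(real^'n, real) l2 \<Rightarrow> (real^'n, real^'n) l2 \<times> (real^'n, real^'n^'n) l2" where
  "solution P = (THE u. solves P u)"

lemma ex1_solves: "\<exists>!u. solves P u"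
proof -
  obtain c where "c > 0" "\<And>p. p \<in> H10_graph \<Omega> \<Longrightarrow> c * (norm p)\<^sup>2 \<le> inner (form p) p"
    using form_coercive by metis
  from lax_milgram[OF subspace_H10_graph complete_H10_graph bounded_linear_form this]
  show ?thesis
    unfolding solves_def .
qed

lemma solves_solution: "solves P (solution P)"
  unfolding solution_def by (rule theI'[OF ex1_solves])

lemma solution_eqI: "solves P u \<Longrightarrow> solution P = u"
  using ex1_solves solves_solution by blast

text \<open>Linearity is a consequence of uniqueness: the sum of two solutions solves the problem
  with the summed load.\<close>

lemma solution_add: "solution (P + Q) = solution P + solution Q"
proof (rule solution_eqI)
  show "solves (P + Q) (solution P + solution Q)"
    using solves_solution[of P] solves_solution[of Q]
    by (simp add: solves_def subspace_add[OF subspace_H10_graph] linear_add[OF bounded_linear.linear[OF bounded_linear_form]]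
        linear_add[OF bounded_linear.linear[OF bounded_linear_load]] inner_add_left)
qed

lemma solution_scaleR: "solution (c *\<^sub>R P) = c *\<^sub>R solution P"
proof (rule solution_eqI)
  show "solves (c *\<^sub>R P) (c *\<^sub>R solution P)"
    using solves_solution[of P]
    by (simp add: solves_def subspace_scale[OF subspace_H10_graph] linear_cmul[OF bounded_linear.linear[OF bounded_linear_form]]
        linear_cmul[OF bounded_linear.linear[OF bounded_linear_load]])
qed

text \<open>Testing the equation with its own solution and combining coercivity with Cauchy-Schwarz
  leaves one factor of the norm to cancel.\<close>

lemma norm_solution_le: "\<exists>C. \<forall>P. norm (solution P) \<le> C * norm P"
proof -
  obtain c where c: "c > 0" "\<And>p. p \<in> H10_graph \<Omega> \<Longrightarrow> c * (norm p)\<^sup>2 \<le> inner (form p) p"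
    using form_coercive by metis
  obtain K where K: "\<And>P. norm (load P) \<le> norm P * K"
    using bounded_linear.bounded[OF bounded_linear_load] by blast
  have "norm (solution P) \<le> K / c * norm P" for P
  proof -
    let ?u = "solution P"
    have u: "?u \<in> H10_graph \<Omega>" "inner (form ?u) ?u = inner (load P) ?u"
      using solves_solution[of P] by (auto simp: solves_def)
    have "c * (norm ?u)\<^sup>2 \<le> norm (load P) * norm ?u"
      using c(2)[OF u(1)] u(2) norm_cauchy_schwarz[of "load P" ?u] by linarith
    also have "\<dots> \<le> (norm P * K) * norm ?u"
      using K[of P] by (intro mult_right_mono) auto
    finally have "norm ?u * (c * norm ?u) \<le> norm ?u * (norm P * K)"
      by (simp add: power2_eq_square mult_ac)
    \<comment> \<open>Cancelling needs a nonzero solution; for the zero solution the claim is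
      \<open>0 \<le> norm P * K\<close>, which holds because this bounds a norm.\<close>
    then have "c * norm ?u \<le> norm P * K"
      using K[of P] norm_ge_zero[of "load P"] by (cases "?u = 0") (auto simp del: norm_ge_zero)
    then show ?thesis
      using c(1) by (simp add: field_simps)
  qed
  then show ?thesis
    by blast
qed

text \<open>The left side is the predicate described by \<open>the_inv_into\<close>; membership in
  \<open>H10\<close> stays on both sides so that it can be rewritten under the description
  operator.\<close>

lemma A11_eq_A12_iff:
  assumes "P \<in> L2 \<Omega>"
  shows "v \<in> H10 \<Omega> \<and> A11 \<Omega> \<nu> b v = A12 \<Omega> P \<longleftrightarrow> v \<in> H10 \<Omega> \<and> solves P (v, jacobian \<Omega> v)"
proof (intro conj_cong refl)
  assume v: "v \<in> H10 \<Omega>"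
  \<comment> \<open>Both functionals are extensional on \<open>H10 \<Omega>\<close>, so they are
    equal as soon as they agree there.\<close>
  have "A11 \<Omega> \<nu> b v = A12 \<Omega> P \<longleftrightarrow> (\<forall>w\<in>H10 \<Omega>. A11 \<Omega> \<nu> b v w = A12 \<Omega> P w)"
    using v assms by (auto simp: A11_def A12_def fun_eq_iff restrict_def)
  also have "\<dots> \<longleftrightarrow> (\<forall>w\<in>H10 \<Omega>. inner (form (v, jacobian \<Omega> v)) (w, jacobian \<Omega> w)
      = inner (load P) (w, jacobian \<Omega> w))"
    by (simp only: A11_eq[OF v] A12_eq[OF assms] cong: ball_cong)
  also have "\<dots> \<longleftrightarrow> (\<forall>s\<in>H10_graph \<Omega>. inner (form (v, jacobian \<Omega> v)) s = inner (load P) s)"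
    using H10_graphD[OF open_\<Omega>] mem_H10_iff[OF open_\<Omega>] by (metis prod.collapse)
  also have "\<dots> \<longleftrightarrow> solves P (v, jacobian \<Omega> v)"
    using v by (simp add: solves_def mem_H10_iff[OF open_\<Omega>])
  finally show "A11 \<Omega> \<nu> b v = A12 \<Omega> P \<longleftrightarrow> solves P (v, jacobian \<Omega> v)" .
qed

text \<open>\<open>A11_inv\<close> has its intended value only on \<open>Hm1 \<Omega>\<close>, so
  this has to be known before it can be evaluated. Cauchy-Schwarz gives \<open>norm (load P)\<close>
  as the bound of the functional.\<close>

lemma A12_in_Hm1:
  assumes "P \<in> L2 \<Omega>"
  shows "A12 \<Omega> P \<in> Hm1 \<Omega>"
  unfolding Hm1_def bounded_ops_def
proof (intro CollectI conjI ballI allI)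
  show "A12 \<Omega> P \<in> H10 \<Omega> \<rightarrow>\<^sub>E UNIV"
    using assms by (simp add: A12_def)
  fix v assume v: "v \<in> H10 \<Omega>"
  show "A12 \<Omega> P (v + w) = A12 \<Omega> P v + A12 \<Omega> P w" if "w \<in> H10 \<Omega>" for w
    using v that assms
    by (simp add: A12_eq H10_add[OF open_\<Omega>] jacobian_add[OF open_\<Omega>] flip: inner_add_right)
  show "A12 \<Omega> P (c *\<^sub>R v) = c *\<^sub>R A12 \<Omega> P v" for c
    using v assms by (simp add: A12_eq H10_scaleR[OF open_\<Omega>] jacobian_scaleR[OF open_\<Omega>] flip: inner_scaleR_right)
next
  show "\<exists>C. \<forall>v\<in>H10 \<Omega>. norm (A12 \<Omega> P v) \<le> C * H1_norm \<Omega> v"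
    using assms by (intro exI[of _ "norm (load P)"])
      (auto simp only: A12_eq H1_norm_eq real_norm_def intro!: Cauchy_Schwarz_ineq2)
qed

text \<open>The description inside \<open>the_inv_into\<close> is resolved by existence and
  uniqueness of the variational solution.\<close>

lemma A11_inv_A12:
  assumes "P \<in> L2 \<Omega>"
  shows "A11_inv \<Omega> \<nu> b (A12 \<Omega> P) = fst (solution P)"
proof -
  have u: "solution P \<in> H10_graph \<Omega>"
    using solves_solution by (simp add: solves_def)
  have "the_inv_into (H10 \<Omega>) (A11 \<Omega> \<nu> b) (A12 \<Omega> P) = fst (solution P)"
    unfolding the_inv_into_def A11_eq_A12_iff[OF assms]
  proof (rule the_equality)
    show "fst (solution P) \<in> H10 \<Omega> \<and> solves P (fst (solution P), jacobian \<Omega> (fst (solution P)))"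
      using H10_graphD[OF open_\<Omega> u] solves_solution by simp
    show "v = fst (solution P)" if "v \<in> H10 \<Omega> \<and> solves P (v, jacobian \<Omega> v)" for v
      using solution_eqI[of P "(v, jacobian \<Omega> v)"] that by simp
  qed
  then show ?thesis
    using A12_in_Hm1[OF assms] by (simp add: A11_inv_def)
qed

lemma schur_complement_eq:
  assumes "P \<in> L2 \<Omega>"
  shows "schur_complement \<Omega> \<nu> b P = - divergence (snd (solution P))"
proof -
  have u: "solution P \<in> H10_graph \<Omega>"
    using solves_solution by (simp add: solves_def)
  show ?thesis
    using assms H10_graphD[OF open_\<Omega> u]
    by (simp add: schur_complement_def A11_inv_A12 A21_eq)
qed

section \<open>Boundedness and accretivity of the Schur complement\<close>

lemma schur_complement_bounded: "schur_complement \<Omega> \<nu> b \<in> bounded_ops (L2 \<Omega>) norm (L2 \<Omega>) norm"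
  unfolding bounded_ops_def
proof (intro CollectI conjI ballI allI PiE_I)
  note L2 = subspace_L2[OF sets_\<Omega>]
  have lin: "linear divergence"
    by (rule bounded_linear.linear[OF bounded_linear_divergence])
  fix P :: "(real^'n, real) l2" assume P: "P \<in> L2 \<Omega>"
  show "schur_complement \<Omega> \<nu> b P \<in> L2 \<Omega>"
    by (simp add: schur_complement_eq[OF P] subspace_neg[OF L2] divergence_in_L2)
  show "schur_complement \<Omega> \<nu> b (P + Q) = schur_complement \<Omega> \<nu> b P + schur_complement \<Omega> \<nu> b Q"
    if "Q \<in> L2 \<Omega>" for Q
    using P that by (simp add: schur_complement_eq subspace_add[OF L2] solution_add linear_add[OF lin])
  show "schur_complement \<Omega> \<nu> b (c *\<^sub>R P) = c *\<^sub>R schur_complement \<Omega> \<nu> b P" for c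
    using P by (simp add: schur_complement_eq subspace_scale[OF L2] solution_scaleR linear_cmul[OF lin])
next
  \<comment> \<open>Members of \<open>bounded_ops\<close> are extensional, so the value outside
    \<open>L2 \<Omega>\<close> has to be the default one.\<close>
  show "schur_complement \<Omega> \<nu> b P = undefined" if "P \<notin> L2 \<Omega>" for P :: "(real^'n, real) l2"
    using that by (simp add: schur_complement_def)
next
  obtain K where K: "K > 0" "\<And>G. norm (divergence G) \<le> norm G * K"
    using bounded_linear.pos_bounded[OF bounded_linear_divergence] by blast
  obtain C where C: "\<And>P. norm (solution P) \<le> C * norm P"
    using norm_solution_le by blast
  have "norm (schur_complement \<Omega> \<nu> b P) \<le> (C * K) * norm P" if "P \<in> L2 \<Omega>" for P
  proof -
    have "norm (schur_complement \<Omega> \<nu> b P) \<le> norm (snd (solution P)) * K"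
      using K(2) by (simp add: schur_complement_eq[OF that])
    also have "\<dots> \<le> (C * norm P) * K"
      using K(1) C[of P] norm_snd_le[of "snd (solution P)" "fst (solution P)"]
      by (intro mult_right_mono) auto
    finally show ?thesis
      by (simp add: mult_ac)
  qed
  then show "\<exists>C. \<forall>P\<in>L2 \<Omega>. norm (schur_complement \<Omega> \<nu> b P) \<le> C * norm P"
    by blast
qed

lemma schur_complement_accretive: "accretive_on (L2 \<Omega>) (schur_complement \<Omega> \<nu> b)"
  unfolding accretive_on_def
proof
  fix P :: "(real^'n, real) l2" assume P: "P \<in> L2 \<Omega>"
  let ?u = "solution P"
  obtain c where c: "c > 0" "\<And>p. p \<in> H10_graph \<Omega> \<Longrightarrow> c * (norm p)\<^sup>2 \<le> inner (form p) p"
    using form_coercive by metis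
  have u: "?u \<in> H10_graph \<Omega>" "inner (form ?u) ?u = inner (load P) ?u"
    using solves_solution[of P] by (auto simp: solves_def)
  have "0 \<le> c * (norm ?u)\<^sup>2"
    using c(1) by simp
  also have "\<dots> \<le> inner (load P) ?u"
    using c(2)[OF u(1)] u(2) by simp
  \<comment> \<open>The minus sign in \<open>load\<close> and the one in the Schur complement are
    the same: both sides equal minus the inner product of \<open>P\<close> with the divergence of
    the solution.\<close>
  also have "\<dots> = inner (schur_complement \<Omega> \<nu> b P) P"
    by (simp add: schur_complement_eq[OF P] load_def inner_prod_def inner_divergence[symmetric] inner_commute)
  finally show "0 \<le> inner (schur_complement \<Omega> \<nu> b P) P" .
qed

end

theorem proposition6:
  fixes \<Omega> :: "(real^'d) set" and \<nu> :: real and b :: "real^'d \<Rightarrow> real^'d"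
  assumes "CARD('d) \<in> {2, 3}"
    and "open \<Omega>" and "connected \<Omega>" and "\<Omega> \<noteq> {}" and "bounded \<Omega>"
    and "\<nu> > 0"
    and "b \<in> Linfty \<Omega>"
    and "weakly_divergence_free \<Omega> b"
  shows "schur_complement \<Omega> \<nu> b \<in> bounded_ops (L2 \<Omega>) norm (L2 \<Omega>) norm
       \<and> accretive_on (L2 \<Omega>) (schur_complement \<Omega> \<nu> b)"
proof -
  interpret oseen \<Omega> \<nu> b
    using assms by unfold_locales
  show ?thesis
    using schur_complement_bounded schur_complement_accretive by (rule conjI)
qed

end
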